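(* Consider the functions $\delta(\mathbf{Q})$, $\tilde\delta(\mathbf{Q})$ and $\bar I(\mathbf{Q})$ from $\mathcal{C}_1$ to $\mathbb{R}$. The following properties hold true: (i) The functions $\delta(\mathbf{Q})$, $\tilde\delta(\mathbf{Q})$ and $\bar I(\mathbf{Q})$ are differentiable (and in particular continuous) over $\mathcal{C}_1$. (ii) Let $\overline{\mathbf{Q}}_*$ be the argmax of $\bar I$ over $\mathcal{C}_1$, i.e. $\bar I(\mathbf{Q})\le\bar I(\overline{\mathbf{Q}}_* )$ for all $\mathbf{Q}\in\mathcal{C}_1$. Let $\mathbf{Q}\in\mathcal{C}_1$. The property $$\forall\,\mathbf{P}\in\mathcal{C}_1,\quad \langle\nabla\bar I(\mathbf{Q}),\mathbf{P}-\mathbf{Q}\rangle\le0$$ holds true if and only if $\mathbf{Q}=\overline{\mathbf{Q}}_*$. (iii) Denote $\delta_*=\delta(\overline{\mathbf{Q}}_* )$ and $\tilde\delta_*=\tilde\delta(\overline{\mathbf{Q}}_* )$. The matrix $\overline{\mathbf{Q}}_*$ is the solution of the standard waterfilling problem: maximize over $\mathbf{Q}\in\mathcal{C}_1$ the function $V(\delta_*,\tilde\delta_*,\mathbf{Q})$, or equivalently the function $\log\det(\mathbf{I}+\mathbf{Q}\,\mathbf{G}(\delta_*,\tilde\delta_* ))$.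
   Context: Let $r,t\ge1$ be integers, $\sigma^2>0$, $K\ge0$. Let $\mathbf{A}$ be a deterministic $r\times t$ complex matrix with $\frac1r\mathrm{Tr}(\mathbf{A}\mathbf{A}^H)=1$, and $\mathbf{C}>0$ ($r\times r$), $\tilde{\mathbf{C}}>0$ ($t\times t$) Hermitian positive definite matrices with $\frac1r\mathrm{Tr}\,\mathbf{C}=1$, $\frac1t\mathrm{Tr}\,\tilde{\mathbf{C}}=1$. $\mathcal{C}_1$ is the set of nonnegative Hermitian $t\times t$ matrices $\mathbf{Q}$ with $\frac1t\mathrm{Tr}(\mathbf{Q})=1$. For $\mathbf{Q}\in\mathcal{C}_1$, $(\delta,\tilde\delta)=(\delta(\mathbf{Q}),\tilde\delta(\mathbf{Q}))$ is the unique strictly positive solution of the system $$\delta=\tfrac1t\mathrm{Tr}\left\{\mathbf{C}\left[\sigma^2\left(\mathbf{I}_r+\tfrac{\tilde\delta}{K+1}\mathbf{C}\right)+\tfrac{K}{K+1}\mathbf{A}\mathbf{Q}^{1/2}\left(\mathbf{I}_t+\tfrac{\delta}{K+1}\mathbf{Q}^{1/2}\tilde{\mathbf{C}}\mathbf{Q}^{1/2}\right)^{-1}\mathbf{Q}^{1/2}\mathbf{A}^H\right]^{-1}\right\},$$ $$\tilde\delta=\tfrac1t\mathrm{Tr}\left\{\mathbf{Q}^{1/2}\tilde{\mathbf{C}}\mathbf{Q}^{1/2}\left[\sigma^2\left(\mathbf{I}_t+\tfrac{\delta}{K+1}\mathbf{Q}^{1/2}\tilde{\mathbf{C}}\mathbf{Q}^{1/2}\right)+\tfrac{K}{K+1}\mathbf{Q}^{1/2}\mathbf{A}^H\left(\mathbf{I}_r+\tfrac{\tilde\delta}{K+1}\mathbf{C}\right)^{-1}\mathbf{A}\mathbf{Q}^{1/2}\right]^{-1}\right\}.$$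 For $\kappa,\tilde\kappa\ge0$ and $\mathbf{Q}\in\mathcal{C}_1$, $$V(\kappa,\tilde\kappa,\mathbf{Q})=\log\det\left(\mathbf{I}_t+\tfrac{\kappa}{K+1}\mathbf{Q}^{1/2}\tilde{\mathbf{C}}\mathbf{Q}^{1/2}+\tfrac{K}{\sigma^2(K+1)}\mathbf{Q}^{1/2}\mathbf{A}^H\left(\mathbf{I}_r+\tfrac{\tilde\kappa}{K+1}\mathbf{C}\right)^{-1}\mathbf{A}\mathbf{Q}^{1/2}\right)+\log\det\left(\mathbf{I}_r+\tfrac{\tilde\kappa}{K+1}\mathbf{C}\right)-\tfrac{t\sigma^2\kappa\tilde\kappa}{K+1},$$ and $$\mathbf{G}(\kappa,\tilde\kappa)=\tfrac{\kappa}{K+1}\tilde{\mathbf{C}}+\tfrac{K}{\sigma^2(K+1)}\mathbf{A}^H\left(\mathbf{I}_r+\tfrac{\tilde\kappa}{K+1}\mathbf{C}\right)^{-1}\mathbf{A},$$ so that $V(\kappa,\tilde\kappa,\mathbf{Q})=\log\det(\mathbf{I}+\mathbf{Q}\mathbf{G}(\kappa,\tilde\kappa))+\log\det(\mathbf{I}_r+\frac{\tilde\kappa}{K+1}\mathbf{C})-\frac{t\sigma^2\kappa\tilde\kappa}{K+1}$. Finally $\bar I(\mathbf{Q})=V(\delta(\mathbf{Q}),\tilde\delta(\mathbf{Q}),\mathbf{Q})$. $\nabla F(\mathbf{Q})$ denotes the derivative of a differentiable function $F$ at $\mathbf{Q}$ and $\langle\nabla F(\mathbf{Q}),\mathbf{M}\rangle$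 the value of this derivative (a linear map) at $\mathbf{M}$; for $\mathbf{P},\mathbf{Q}\in\mathcal{C}_1$ one has $\langle\nabla F(\mathbf{Q}),\mathbf{P}-\mathbf{Q}\rangle=\lim_{s\downarrow0}\frac{F(\mathbf{Q}+s(\mathbf{P}-\mathbf{Q}))-F(\mathbf{Q})}{s}$. The function $\bar I$ is strictly concave on $\mathcal{C}_1$, so its maximizer is unique. *)

theory Defs
  imports "HOL-Analysis.Analysis"
begin

definition ctranspose :: "complex^'n^'m \<Rightarrow> complex^'m^'n" where
  "ctranspose M = (\<chi> i j. cnj (M $ j $ i))"

definition hermitian :: "complex^'n^'n \<Rightarrow> bool" where
  "hermitian M \<longleftrightarrow> ctranspose M = M"

(* x^H M x; it is real for hermitian M, so taking Re below loses nothing. *)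
definition quad_form :: "complex^'n^'n \<Rightarrow> complex^'n \<Rightarrow> complex" where
  "quad_form M x = (\<Sum>i\<in>UNIV. \<Sum>j\<in>UNIV. cnj (x $ i) * M $ i $ j * x $ j)"

definition psd :: "complex^'n^'n \<Rightarrow> bool" where
  "psd M \<longleftrightarrow> hermitian M \<and> (\<forall>x. 0 \<le> Re (quad_form M x))"

definition pos_def :: "complex^'n^'n \<Rightarrow> bool" where
  "pos_def M \<longleftrightarrow> hermitian M \<and> (\<forall>x. x \<noteq> 0 \<longrightarrow> 0 < Re (quad_form M x))"

definition psd_sqrt :: "complex^'n^'n \<Rightarrow> complex^'n^'n" where
  "psd_sqrt Q = (THE R. psd R \<and> R ** R = Q)"

(* Meant for determinants that are real and positive, where Re is only a coercion. *)
definition log_det :: "complex^'n^'n \<Rightarrow> real" where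
  "log_det M = ln (Re (det M))"

definition C1 :: "(complex^'t^'t) set" where
  "C1 = {Q. psd Q \<and> trace Q / of_nat CARD('t) = 1}"

(* Throughout, Ct is the transmit-side matrix written C with a tilde (likewise dt, kt),
   and the noise variance is the square of \<sigma>. *)
definition canonical_system ::
  "real \<Rightarrow> real \<Rightarrow> complex^'t^'r \<Rightarrow> complex^'r^'r \<Rightarrow> complex^'t^'t \<Rightarrow> complex^'t^'t
    \<Rightarrow> real \<Rightarrow> real \<Rightarrow> bool" where
  "canonical_system \<sigma> K A C Ct Q d dt \<longleftrightarrow>
    (let S = psd_sqrt Q;
         X = S ** Ct ** S;
         T = mat 1 + (d / (K + 1)) *\<^sub>R X;
         U = mat 1 + (dt / (K + 1)) *\<^sub>R C
     in complex_of_real d =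
          trace (C ** matrix_inv (\<sigma>\<^sup>2 *\<^sub>R U
            + (K / (K + 1)) *\<^sub>R (A ** S ** matrix_inv T ** S ** ctranspose A)))
          / of_nat CARD('t)
      \<and> complex_of_real dt =
          trace (X ** matrix_inv (\<sigma>\<^sup>2 *\<^sub>R T
            + (K / (K + 1)) *\<^sub>R (S ** ctranspose A ** matrix_inv U ** A ** S)))
          / of_nat CARD('t))"

definition canonical_solution ::
  "real \<Rightarrow> real \<Rightarrow> complex^'t^'r \<Rightarrow> complex^'r^'r \<Rightarrow> complex^'t^'t \<Rightarrow> complex^'t^'t
    \<Rightarrow> real \<times> real" where
  "canonical_solution \<sigma> K A C Ct Q =
    (THE p. 0 < fst p \<and> 0 < snd p \<and> canonical_system \<sigma> K A C Ct Q (fst p) (snd p))"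

definition delta ::
  "real \<Rightarrow> real \<Rightarrow> complex^'t^'r \<Rightarrow> complex^'r^'r \<Rightarrow> complex^'t^'t \<Rightarrow> complex^'t^'t \<Rightarrow> real" where
  "delta \<sigma> K A C Ct Q = fst (canonical_solution \<sigma> K A C Ct Q)"

definition delta_tilde ::
  "real \<Rightarrow> real \<Rightarrow> complex^'t^'r \<Rightarrow> complex^'r^'r \<Rightarrow> complex^'t^'t \<Rightarrow> complex^'t^'t \<Rightarrow> real" where
  "delta_tilde \<sigma> K A C Ct Q = snd (canonical_solution \<sigma> K A C Ct Q)"

definition V ::
  "real \<Rightarrow> real \<Rightarrow> complex^'t^'r \<Rightarrow> complex^'r^'r \<Rightarrow> complex^'t^'t
    \<Rightarrow> real \<Rightarrow> real \<Rightarrow> complex^'t^'t \<Rightarrow> real" where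
  "V \<sigma> K A C Ct k kt Q =
    (let S = psd_sqrt Q;
         U = mat 1 + (kt / (K + 1)) *\<^sub>R C
     in log_det (mat 1 + (k / (K + 1)) *\<^sub>R (S ** Ct ** S)
          + (K / (\<sigma>\<^sup>2 * (K + 1))) *\<^sub>R (S ** ctranspose A ** matrix_inv U ** A ** S))
        + log_det U
        - real CARD('t) * \<sigma>\<^sup>2 * k * kt / (K + 1))"

definition G ::
  "real \<Rightarrow> real \<Rightarrow> complex^'t^'r \<Rightarrow> complex^'r^'r \<Rightarrow> complex^'t^'t
    \<Rightarrow> real \<Rightarrow> real \<Rightarrow> complex^'t^'t" where
  "G \<sigma> K A C Ct k kt =
    (k / (K + 1)) *\<^sub>R Ct
    + (K / (\<sigma>\<^sup>2 * (K + 1))) *\<^sub>R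
        (ctranspose A ** matrix_inv (mat 1 + (kt / (K + 1)) *\<^sub>R C) ** A)"

definition I_bar ::
  "real \<Rightarrow> real \<Rightarrow> complex^'t^'r \<Rightarrow> complex^'r^'r \<Rightarrow> complex^'t^'t \<Rightarrow> complex^'t^'t \<Rightarrow> real" where
  "I_bar \<sigma> K A C Ct Q =
    V \<sigma> K A C Ct (delta \<sigma> K A C Ct Q) (delta_tilde \<sigma> K A C Ct Q) Q"

(* C1 has empty interior, so a derivative within C1 is not unique as a linear map on all
   matrices. Its values at P - Q with P, Q in C1 are: they are the one-sided directional
   derivatives along the segment from Q to P. Only those values are used. *)
definition grad_C1 :: "(complex^'t^'t \<Rightarrow> real) \<Rightarrow> complex^'t^'t \<Rightarrow> complex^'t^'t \<Rightarrow> real" where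
  "grad_C1 F Q M = frechet_derivative F (at Q within C1) M"

end

theory Submission
  imports Defs
begin

text \<open>For a fixed covariance \<open>Q\<close>, put \<open>V(k, kt) = V(k, kt, Q)\<close>. The partial derivatives of \<open>V\<close> vanish
  exactly at the solutions of the canonical system, and the solution \<open>(d, dt)\<close> is a saddle point:
  \<open>V\<close> is concave in \<open>kt\<close> for fixed \<open>k\<close>, but along the hyperbola \<open>k kt = d dt\<close> it is minimal at
  \<open>(d, dt)\<close> (\<open>rate_sol_le_hyperbola\<close>). Moreover, for fixed \<open>k > 0\<close> the function \<open>V\<close> is jointly
  concave in \<open>(kt, Q)\<close>, strictly in \<open>Q\<close>, with an explicit affine tangent (\<open>rate_tangent\<close>): in the form
  \<open>rate_eq\<close> it is, up to terms affine in \<open>kt\<close>, a sum of log-determinants of matrices that are affine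
  or concave in \<open>(kt, Q)\<close>.

  The two facts combine as follows. Given \<open>P\<close> and \<open>Q\<close> in the constraint set, move along the
  hyperbola of \<open>P\<close> until the first coordinate is \<open>d(Q)\<close>; this does not decrease the rate of \<open>P\<close>. Then
  compare with the tangent of \<open>V(d(Q), _, _)\<close> at \<open>(dt(Q), Q)\<close>, which has slope zero in \<open>kt\<close>. Hence
  the optimized rate of \<open>P\<close> lies below an affine function of \<open>P\<close> touching it at \<open>Q\<close>, strictly
  unless \<open>P = Q\<close> (\<open>opt_rate_tangent\<close>). So the rate is strictly concave; being squeezed between its
  own tangents, whose slopes are continuous, it is differentiable with that slope as gradient; its
  maximizer is unique and is the only stationary point; and as the same slope is the gradient
  in \<open>Q\<close> of \<open>V\<close> with the first two arguments frozen, the maximizer solves the waterfilling problem.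

  The canonical system itself is studied through one scaling estimate (\<open>schur_trace_scaling\<close>): in the
  coordinates \<open>k\<close> and \<open>1 / kt\<close> its right-hand sides form a monotone, strictly subhomogeneous map. This
  gives uniqueness, the sign of the derivative along the hyperbola, and the nondegeneracy of the
  Jacobian; existence is Brouwer's theorem. The square root of \<open>Q\<close>, which is not differentiable
  at singular \<open>Q\<close>, is eliminated by \<open>Q\<^sup>1\<^sup>/\<^sup>2 (I + Q\<^sup>1\<^sup>/\<^sup>2 M Q\<^sup>1\<^sup>/\<^sup>2)\<inverse> Q\<^sup>1\<^sup>/\<^sup>2 = (I + Q M)\<inverse> Q\<close>, after which an
  implicit function argument relative to the constraint set gives the differentiability of the
  solution.\<close>

section \<open>Hermitian matrices and the Loewner order\<close>

notation ctranspose ("(_\<^sup>H)" [1000] 999)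

text \<open>A real-valued functional that is linear over the reals; on the products of Hermitian matrices met
  below the trace is already real.\<close>

definition re_trace :: "complex^'n^'n \<Rightarrow> real" where
  "re_trace M = Re (trace M)"

lemma matrix_add_rdistrib_cplx: "((B::complex^'m^'n) + C) ** (A::complex^'p^'m) = B ** A + C ** A"
  by (vector matrix_matrix_mult_def sum.distrib[symmetric] field_simps)

lemma matrix_diff_ldistrib: "(A::complex^'m^'n) ** ((B::complex^'p^'m) - C) = A ** B - A ** C"
  by (vector matrix_matrix_mult_def sum_subtractf[symmetric] field_simps)

lemma matrix_diff_rdistrib: "((B::complex^'m^'n) - C) ** (A::complex^'p^'m) = B ** A - C ** A"
  by (vector matrix_matrix_mult_def sum_subtractf[symmetric] field_simps)

lemma scaleR_mult_left: "(k *\<^sub>R (A::complex^'m^'n)) ** (B::complex^'p^'m) = k *\<^sub>R (A ** B)"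
  by (simp add: matrix_matrix_mult_def scaleR_sum_right vec_eq_iff)

lemma scaleR_mult_right: "(A::complex^'m^'n) ** (k *\<^sub>R (B::complex^'p^'m)) = k *\<^sub>R (A ** B)"
  by (simp add: matrix_matrix_mult_def scaleR_sum_right vec_eq_iff)

lemma scaleR_mult_vec: "(k *\<^sub>R (A::complex^'m^'n)) *v x = k *\<^sub>R (A *v x)"
  by (simp add: matrix_vector_mult_def scaleR_sum_right vec_eq_iff)

lemma mult_vec_scaleR: "(A::complex^'m^'n) *v (k *\<^sub>R x) = k *\<^sub>R (A *v x)"
  by (simp add: linear_cmul)

lemmas matrix_expand = matrix_add_ldistrib matrix_add_rdistrib_cplx matrix_diff_ldistrib
  matrix_diff_rdistrib scaleR_mult_left scaleR_mult_right

lemma bounded_bilinear_matrix_mult: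
  "bounded_bilinear (\<lambda>(A::complex^'m^'n) (B::complex^'p^'m). A ** B)"
  unfolding bilinear_conv_bounded_bilinear[symmetric] bilinear_def
  by (auto intro!: linearI simp: matrix_expand)

subsection \<open>Conjugate transpose\<close>

lemma ctranspose_ctranspose [simp]: "(M\<^sup>H)\<^sup>H = M"
  by (simp add: ctranspose_def vec_eq_iff)

lemma ctranspose_mult: "(A ** B)\<^sup>H = B\<^sup>H ** A\<^sup>H"
  by (simp add: ctranspose_def vec_eq_iff matrix_matrix_mult_def mult.commute)

lemma ctranspose_add: "(A + B)\<^sup>H = A\<^sup>H + B\<^sup>H"
  by (simp add: ctranspose_def vec_eq_iff)

lemma ctranspose_diff: "(A - B)\<^sup>H = A\<^sup>H - B\<^sup>H"
  by (simp add: ctranspose_def vec_eq_iff)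

lemma ctranspose_scaleR: "(k *\<^sub>R A)\<^sup>H = k *\<^sub>R A\<^sup>H"
  by (simp add: ctranspose_def vec_eq_iff)

lemma ctranspose_mat [simp]: "(mat 1)\<^sup>H = mat 1"
  by (auto simp: ctranspose_def vec_eq_iff mat_def)

lemma linear_ctranspose: "linear (ctranspose :: complex^'n^'m \<Rightarrow> _)"
  by (intro linearI) (simp_all add: ctranspose_add ctranspose_scaleR)

text \<open>The Hermitian inner product. Its real part is the Euclidean inner product, which is enough for
  positivity statements; orthogonality over the complex numbers needs the full value.\<close>

definition cdot :: "complex^'n \<Rightarrow> complex^'n \<Rightarrow> complex" where
  "cdot x y = (\<Sum>i\<in>UNIV. cnj (x $ i) * y $ i)"

lemma inner_eq_Re_cdot: "(x::complex^'n) \<bullet> y = Re (cdot x y)"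
  by (simp add: cdot_def inner_vec_def inner_complex_def)

lemma cdot_adjoint: "cdot x (M *v y) = cdot (M\<^sup>H *v x) y"
proof -
  have "(\<Sum>i\<in>UNIV. cnj (x $ i) * (\<Sum>j\<in>UNIV. M $ i $ j * y $ j))
      = (\<Sum>j\<in>UNIV. (\<Sum>i\<in>UNIV. cnj (x $ i) * M $ i $ j) * y $ j)"
    unfolding sum_distrib_left sum_distrib_right
    by (subst sum.swap) (simp add: mult.assoc)
  then show ?thesis
    by (simp add: cdot_def matrix_vector_mult_def ctranspose_def mult.commute)
qed

lemma inner_adjoint: "x \<bullet> (M *v y) = (M\<^sup>H *v x) \<bullet> (y::complex^'n)"
  by (simp add: inner_eq_Re_cdot cdot_adjoint)

lemma Re_quad_form: "Re (quad_form M x) = x \<bullet> (M *v x)"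
  by (simp add: quad_form_def inner_eq_Re_cdot cdot_def matrix_vector_mult_def sum_distrib_left mult.assoc)

lemma psd_iff: "psd M \<longleftrightarrow> M\<^sup>H = M \<and> (\<forall>x. 0 \<le> x \<bullet> (M *v x))"
  by (simp add: psd_def hermitian_def Re_quad_form)

lemma pos_def_iff: "pos_def M \<longleftrightarrow> M\<^sup>H = M \<and> (\<forall>x. x \<noteq> 0 \<longrightarrow> 0 < x \<bullet> (M *v x))"
  by (simp add: pos_def_def hermitian_def Re_quad_form)

subsection \<open>Real trace\<close>

lemma re_trace_add: "re_trace (A + B) = re_trace A + re_trace B"
  by (simp add: re_trace_def trace_def sum.distrib)

lemma re_trace_diff: "re_trace (A - B) = re_trace A - re_trace B"
  by (simp add: re_trace_def trace_def sum_subtractf)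

lemma re_trace_scaleR: "re_trace (k *\<^sub>R A) = k * re_trace A"
  by (simp add: re_trace_def trace_def sum_distrib_left)

lemma re_trace_zero [simp]: "re_trace 0 = 0"
  by (simp add: re_trace_def trace_def)

lemma re_trace_mat: "re_trace (mat 1 :: complex^'n^'n) = CARD('n)"
  by (simp add: re_trace_def trace_def mat_def)

lemma linear_re_trace: "linear re_trace"
  by (intro linearI) (simp_all add: re_trace_add re_trace_scaleR)

lemma trace_mult_sym: "trace ((A::complex^'n^'m) ** (B::complex^'m^'n)) = trace (B ** A)"
  unfolding trace_def matrix_matrix_mult_def
  by (simp, subst sum.swap) (simp add: mult.commute)

lemma re_trace_mult_sym: "re_trace ((A::complex^'n^'m) ** (B::complex^'m^'n)) = re_trace (B ** A)"
  unfolding re_trace_def by (subst trace_mult_sym) (rule refl)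

lemma trace_ctranspose: "trace (A\<^sup>H) = cnj (trace A)"
  by (simp add: trace_def ctranspose_def)

lemma inner_eq_re_trace: "(A::complex^'n^'m) \<bullet> B = re_trace (A\<^sup>H ** B)"
  unfolding re_trace_def trace_def matrix_matrix_mult_def ctranspose_def
  by (simp add: inner_vec_def inner_complex_def, subst sum.swap) simp

text \<open>Conjugating the trace reverses the order of the factors, and the trace is cyclic.\<close>

lemma trace_mult_hermitian_real:
  assumes "A\<^sup>H = A" "B\<^sup>H = B"
  shows "trace (A ** B) = of_real (re_trace (A ** B))"
proof -
  have "cnj (trace (A ** B)) = trace (A ** B)"
    unfolding trace_ctranspose[symmetric] ctranspose_mult assms by (rule trace_mult_sym)
  then show ?thesis
    unfolding re_trace_def by (metis Reals_cnj_iff of_real_Re)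
qed

subsection \<open>Positive semidefinite and positive definite matrices\<close>

lemma psd_hermitian: "psd M \<Longrightarrow> M\<^sup>H = M" by (simp add: psd_iff)

lemma pos_def_hermitian: "pos_def M \<Longrightarrow> M\<^sup>H = M" by (simp add: pos_def_iff)

lemma psd_inner: "psd M \<Longrightarrow> 0 \<le> x \<bullet> (M *v x)" by (simp add: psd_iff)

lemma pos_def_psd: "pos_def M \<Longrightarrow> psd M"
  by (auto simp: pos_def_iff psd_iff) (metis inner_zero_left less_eq_real_def)

lemma pos_def_mat [simp]: "pos_def (mat 1)"
  by (simp add: pos_def_iff)

lemma psd_add: "psd A \<Longrightarrow> psd B \<Longrightarrow> psd (A + B)"
  by (simp add: psd_iff ctranspose_add matrix_vector_mult_add_rdistrib inner_add_right)

lemma psd_scaleR: "psd A \<Longrightarrow> 0 \<le> k \<Longrightarrow> psd (k *\<^sub>R A)"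
  by (simp add: psd_iff ctranspose_scaleR scaleR_mult_vec)

lemma pos_def_add_psd: "pos_def A \<Longrightarrow> psd B \<Longrightarrow> pos_def (A + B)"
  by (simp add: psd_iff pos_def_iff ctranspose_add matrix_vector_mult_add_rdistrib inner_add_right add_pos_nonneg)

lemma pos_def_scaleR: "pos_def A \<Longrightarrow> 0 < k \<Longrightarrow> pos_def (k *\<^sub>R A)"
  by (simp add: pos_def_iff ctranspose_scaleR scaleR_mult_vec)

lemma psd_congruence: "psd P \<Longrightarrow> psd (B ** P ** B\<^sup>H)"
proof -
  assume P: "psd P"
  have "x \<bullet> ((B ** P ** B\<^sup>H) *v x) = (B\<^sup>H *v x) \<bullet> (P *v (B\<^sup>H *v x))" for x
    by (simp add: matrix_vector_mul_assoc[symmetric] inner_adjoint)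
  then show ?thesis
    using P by (simp add: psd_iff ctranspose_mult matrix_mul_assoc)
qed

lemma psd_congruence': "psd P \<Longrightarrow> psd (B\<^sup>H ** P ** B)"
  using psd_congruence[of P "B\<^sup>H"] by simp

lemma psd_congruence_hermitian: "psd P \<Longrightarrow> S\<^sup>H = S \<Longrightarrow> psd (S ** P ** S)"
  using psd_congruence[of P S] by simp

lemma psd_self_mult: "psd (B ** B\<^sup>H)"
  using psd_congruence[of "mat 1" B] by (simp add: pos_def_psd)

text \<open>Being nonnegative on the line \<open>x + s M x\<close> and zero at \<open>s = 0\<close>, the form has no linear term in \<open>s\<close>;
  that term is \<open>2 s\<close> times the squared norm of \<open>M x\<close>.\<close>

lemma nonneg_form_zero_imp_kernel:
  fixes M :: "complex^'n^'n"
  assumes herm_M: "M\<^sup>H = M" and W: "subspace W" "\<And>z. z \<in> W \<Longrightarrow> M *v z \<in> W"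
    and nonneg: "\<And>z. z \<in> W \<Longrightarrow> 0 \<le> z \<bullet> (M *v z)"
    and x: "x \<in> W" "x \<bullet> (M *v x) = 0"
  shows "M *v x = 0"
proof -
  have herm: "(M *v x) \<bullet> z = x \<bullet> (M *v z)" for z
    using herm_M by (simp add: inner_adjoint)
  define y where "y = M *v x"
  define b where "b = y \<bullet> (M *v y)"
  have q: "0 \<le> 2 * s * (y \<bullet> y) + s\<^sup>2 * b" for s
  proof -
    have "0 \<le> (x + s *\<^sub>R y) \<bullet> (M *v (x + s *\<^sub>R y))"
      unfolding y_def by (intro nonneg subspace_add subspace_scale W x)
    also have "\<dots> = 2 * s * (y \<bullet> y) + s\<^sup>2 * b"
      using x(2) herm[of y]
      by (simp add: matrix_vector_right_distrib mult_vec_scaleR inner_add_left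
          inner_add_right b_def power2_eq_square y_def[symmetric] algebra_simps)
    finally show ?thesis .
  qed
  have b: "0 \<le> b" unfolding b_def y_def by (intro nonneg W x)
  have "y \<bullet> y = 0"
  proof (rule ccontr)
    assume "y \<bullet> y \<noteq> 0"
    then have yy: "0 < y \<bullet> y" by (metis inner_ge_zero less_eq_real_def)
    define s where "s = - (y \<bullet> y) / (b + 1)"
    have s: "y \<bullet> y = - s * (b + 1)" "s \<noteq> 0" using b yy by (auto simp: s_def)
    have "2 * s * (y \<bullet> y) + s\<^sup>2 * b = - (s\<^sup>2 * (b + 2))"
      unfolding s(1) by (simp add: algebra_simps power2_eq_square)
    also have "\<dots> < 0" using s(2) b by simp
    finally show False using q[of s] by simp
  qed
  then show ?thesis by (simp add: y_def)
qed

lemma psd_inner_zero_imp: "psd M \<Longrightarrow> x \<bullet> (M *v x) = 0 \<Longrightarrow> M *v x = 0"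
  by (rule nonneg_form_zero_imp_kernel[where W = UNIV]) (auto simp: psd_iff)

lemma invertibleI: "(A::complex^'n^'n) ** B = mat 1 \<Longrightarrow> invertible A"
  using invertible_right_inverse by blast

lemma invertible_kerI: "(\<And>x. (A::complex^'n^'n) *v x = 0 \<Longrightarrow> x = 0) \<Longrightarrow> invertible A"
  unfolding invertible_left_inverse matrix_left_invertible_ker by blast

lemma inv_right: "invertible (A::complex^'n^'n) \<Longrightarrow> A ** matrix_inv A = mat 1"
  and inv_left: "invertible (A::complex^'n^'n) \<Longrightarrow> matrix_inv A ** A = mat 1"
proof -
  assume "invertible A"
  then have "\<exists>B. A ** B = mat 1 \<and> B ** A = mat 1" by (simp add: invertible_def)
  then have "A ** matrix_inv A = mat 1 \<and> matrix_inv A ** A = mat 1"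
    unfolding matrix_inv_def by (rule someI_ex)
  then show "A ** matrix_inv A = mat 1" "matrix_inv A ** A = mat 1" by auto
qed

lemma matrix_inv_eqI: "(A::complex^'n^'n) ** B = mat 1 \<Longrightarrow> matrix_inv A = B"
  by (metis inv_left invertibleI matrix_mul_assoc matrix_mul_lid matrix_mul_rid)

lemma inv_right_assoc: "invertible (A::complex^'n^'n) \<Longrightarrow> A ** (matrix_inv A ** B) = (B::complex^'m^'n)"
  and inv_left_assoc: "invertible (A::complex^'n^'n) \<Longrightarrow> matrix_inv A ** (A ** B) = (B::complex^'m^'n)"
  by (simp_all add: matrix_mul_assoc inv_left inv_right)

lemma matrix_inv_matrix_inv: "invertible (A::complex^'n^'n) \<Longrightarrow> matrix_inv (matrix_inv A) = A"
  by (simp add: inv_left matrix_inv_eqI)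

lemma matrix_inv_mult:
  "invertible (A::complex^'n^'n) \<Longrightarrow> invertible (B::complex^'n^'n) \<Longrightarrow> matrix_inv (A ** B) = matrix_inv B ** matrix_inv A"
  by (rule matrix_inv_eqI) (simp add: matrix_mul_assoc[symmetric] inv_right inv_right_assoc)

lemma matrix_inv_mat [simp]: "matrix_inv (mat 1 :: complex^'n^'n) = mat 1"
  by (rule matrix_inv_eqI) simp

lemma matrix_inv_scaleR:
  "invertible (A::complex^'n^'n) \<Longrightarrow> k \<noteq> 0 \<Longrightarrow> matrix_inv (k *\<^sub>R A) = (1 / k) *\<^sub>R matrix_inv A"
  by (rule matrix_inv_eqI) (simp add: matrix_expand inv_right)

lemma pos_def_invertible: "pos_def A \<Longrightarrow> invertible A"
  by (rule invertible_kerI) (metis inner_zero_right less_irrefl pos_def_iff)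

lemma ctranspose_matrix_inv: "invertible (A::complex^'n^'n) \<Longrightarrow> (matrix_inv A)\<^sup>H = matrix_inv (A\<^sup>H)"
  by (rule matrix_inv_eqI[symmetric]) (simp add: ctranspose_mult[symmetric] inv_left)

lemma pos_def_matrix_inv:
  assumes "pos_def A"
  shows "pos_def (matrix_inv A)"
proof -
  note i = pos_def_invertible[OF assms]
  have h: "(matrix_inv A)\<^sup>H = matrix_inv A"
    using ctranspose_matrix_inv[OF i] assms by (simp add: pos_def_iff)
  have "0 < x \<bullet> (matrix_inv A *v x)" if "x \<noteq> 0" for x
  proof -
    let ?y = "matrix_inv A *v x"
    have x: "A *v ?y = x" by (simp add: matrix_vector_mul_assoc inv_right[OF i])
    then have "?y \<noteq> 0" using that by auto
    then have "0 < ?y \<bullet> (A *v ?y)" using assms by (simp add: pos_def_iff)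
    then show ?thesis by (simp add: x inner_commute)
  qed
  with h show ?thesis by (simp add: pos_def_iff)
qed

lemma psd_nonsingular_pos_def:
  assumes "psd M" "invertible M"
  shows "pos_def M"
proof -
  have "x = 0" if "x \<bullet> (M *v x) = 0" for x
  proof -
    have "M *v x = 0" using psd_inner_zero_imp[OF assms(1) that] .
    then have "matrix_inv M *v (M *v x) = 0" by simp
    then show ?thesis by (simp add: matrix_vector_mul_assoc inv_left assms(2))
  qed
  then show ?thesis using assms(1) unfolding psd_iff pos_def_iff
    by (metis less_eq_real_def)
qed

text \<open>Both summands of \<open>X\<inverse> - Y\<inverse> = (X\<inverse> - Y\<inverse>) X (X\<inverse> - Y\<inverse>) + Y\<inverse> (Y - X) Y\<inverse>\<close> are positive
  semidefinite.\<close>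

lemma psd_matrix_inv_diff:
  assumes X: "pos_def X" and Y: "pos_def Y" and XY: "psd (Y - X)"
  shows "psd (matrix_inv X - matrix_inv Y)"
proof -
  let ?R = "matrix_inv X" and ?P = "matrix_inv Y"
  note iX = pos_def_invertible[OF X] and iY = pos_def_invertible[OF Y]
  have hR: "?R\<^sup>H = ?R" and hP: "?P\<^sup>H = ?P"
    using pos_def_matrix_inv X Y pos_def_hermitian by blast+
  have "?R - ?P = (?R - ?P) ** X ** (?R - ?P) + ?P ** (Y - X) ** ?P"
    by (simp add: matrix_expand matrix_mul_assoc[symmetric] inv_right inv_left inv_right_assoc
        inv_left_assoc iX iY)
  moreover have "psd ((?R - ?P) ** X ** (?R - ?P))"
    by (rule psd_congruence_hermitian) (simp_all add: X pos_def_psd ctranspose_diff hR hP)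
  moreover have "psd (?P ** (Y - X) ** ?P)"
    by (rule psd_congruence_hermitian) (simp_all add: XY hP)
  ultimately show ?thesis by (metis psd_add)
qed

text \<open>The error of the first-order expansion of the inverse at \<open>Y\<close> is \<open>(Z\<inverse> - Y\<inverse>) Z (Z\<inverse> - Y\<inverse>)\<close>, so
  matrix inversion is convex in the Loewner order.\<close>

lemma psd_matrix_inv_tangent:
  assumes Z: "pos_def Z" and Y: "pos_def Y"
  shows "psd (matrix_inv Z - (matrix_inv Y - matrix_inv Y ** (Z - Y) ** matrix_inv Y))"
proof -
  let ?R = "matrix_inv Z" and ?P = "matrix_inv Y"
  note iZ = pos_def_invertible[OF Z] and iY = pos_def_invertible[OF Y]
  have hR: "?R\<^sup>H = ?R" and hP: "?P\<^sup>H = ?P"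
    using pos_def_matrix_inv Z Y pos_def_hermitian by blast+
  have "?R - (?P - ?P ** (Z - Y) ** ?P) = (?R - ?P) ** Z ** (?R - ?P)"
    by (simp add: matrix_expand matrix_mul_assoc[symmetric] inv_right inv_left inv_right_assoc
        inv_left_assoc iZ iY)
  then show ?thesis
    using psd_congruence_hermitian[of Z "?R - ?P"] by (simp add: Z pos_def_psd ctranspose_diff hR hP)
qed

section \<open>Spectral theorem and positive semidefinite square roots\<close>

lemma cdot_self: "cdot x x = of_real ((norm x)\<^sup>2)"
proof -
  have "cdot x x = of_real (\<Sum>i\<in>UNIV. (cmod (x $ i))\<^sup>2)"
    unfolding cdot_def of_real_sum
    by (intro sum.cong refl) (metis complex_norm_square mult.commute)
  also have "(\<Sum>i\<in>UNIV. (cmod (x $ i))\<^sup>2) = (norm x)\<^sup>2"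
    by (simp add: norm_vec_def L2_set_def sum_nonneg)
  finally show ?thesis .
qed

lemma cdot_commute: "cdot x y = cnj (cdot y x)"
  by (simp add: cdot_def mult.commute)

lemma cdot_add_right: "cdot x (y + z) = cdot x y + cdot x z"
  by (simp add: cdot_def distrib_left sum.distrib)

lemma cdot_scaleR_right: "cdot x (k *\<^sub>R y) = of_real k * cdot x y"
  by (simp add: cdot_def sum_distrib_left complex_eq_iff algebra_simps sum_subtractf sum.distrib)

lemma cdot_scaleR_left: "cdot (k *\<^sub>R x) y = of_real k * cdot x y"
  by (simp add: cdot_def sum_distrib_left complex_eq_iff algebra_simps sum_subtractf sum.distrib)

lemma cdot_zero_right [simp]: "cdot x 0 = 0"
  by (simp add: cdot_def)

text \<open>The eigenvector is a maximizer of the Rayleigh quotient on the unit sphere of the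
  subspace.\<close>

lemma hermitian_eigenvector_in_subspace:
  fixes M :: "complex^'n^'n"
  assumes herm: "M\<^sup>H = M" and W: "subspace W" "\<And>z. z \<in> W \<Longrightarrow> M *v z \<in> W"
    and ne: "x0 \<in> W" "x0 \<noteq> 0"
  obtains v \<mu> where "v \<in> W" "norm v = 1" "M *v v = (\<mu>::real) *\<^sub>R v"
proof -
  let ?K = "W \<inter> sphere 0 1"
  have "compact ?K"
    by (intro closed_Int_compact closed_subspace W compact_sphere)
  moreover have "(1 / norm x0) *\<^sub>R x0 \<in> ?K"
    using ne W by (simp add: subspace_scale)
  moreover have "continuous_on ?K (\<lambda>x. x \<bullet> (M *v x))"
    by (intro continuous_intros linear_continuous_on_compose linear_continuous_on
        matrix_vector_mul_bounded_linear)
  ultimately obtain v where v: "v \<in> ?K" "\<And>z. z \<in> ?K \<Longrightarrow> z \<bullet> (M *v z) \<le> v \<bullet> (M *v v)"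
    using continuous_attains_sup[of ?K "\<lambda>x. x \<bullet> (M *v x)"] by blast
  define \<mu> where "\<mu> = v \<bullet> (M *v v)"
  define N where "N = \<mu> *\<^sub>R mat 1 - M"
  have N: "N *v z = \<mu> *\<^sub>R z - M *v z" for z
    by (simp add: N_def matrix_vector_mult_diff_rdistrib scaleR_mult_vec)
  have "N *v v = 0"
  proof (rule nonneg_form_zero_imp_kernel[where W = W])
    show "N\<^sup>H = N" using herm by (simp add: N_def ctranspose_diff ctranspose_scaleR)
    show "N *v z \<in> W" if "z \<in> W" for z
      unfolding N by (intro subspace_diff subspace_scale W that)
    show "0 \<le> z \<bullet> (N *v z)" if "z \<in> W" for z
    proof (cases "z = 0")
      case False
      let ?z = "(1 / norm z) *\<^sub>R z"
      have "?z \<in> ?K" using that False W by (simp add: subspace_scale)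
      then have "?z \<bullet> (M *v ?z) \<le> \<mu>" using v(2) \<mu>_def by blast
      then have "z \<bullet> (M *v z) / (norm z)\<^sup>2 \<le> \<mu>"
        by (simp add: mult_vec_scaleR power2_eq_square)
      then have "z \<bullet> (M *v z) \<le> \<mu> * (norm z)\<^sup>2"
        using False by (simp add: divide_le_eq)
      then show ?thesis by (simp add: N inner_diff_right dot_square_norm)
    qed simp
    show "v \<in> W" using v by simp
    show "v \<bullet> (N *v v) = 0"
      using v(1) by (simp add: N inner_diff_right dot_square_norm \<mu>_def)
  qed (use W in simp)
  then show thesis using v(1) by (intro that[of v \<mu>]) (auto simp: N)
qed

definition cdiag :: "('n \<Rightarrow> real) \<Rightarrow> complex^'n^'n" where
  "cdiag d = (\<chi> i j. if i = j then of_real (d i) else 0)"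

text \<open>The family is built by adding one vector at a time: the vectors orthogonal to those already found
  form an invariant subspace, which contains a further eigenvector as long as it is nonzero.\<close>

lemma orthonormal_eigenvectors:
  fixes M :: "complex^'n^'n" and I :: "'n set"
  assumes herm: "M\<^sup>H = M"
  shows "\<exists>v \<mu>. (\<forall>i\<in>I. M *v v i = (\<mu> i :: real) *\<^sub>R v i) \<and>
    (\<forall>i\<in>I. \<forall>k\<in>I. cdot (v i) (v k) = (if i = k then 1 else 0))"
proof -
  have "finite I" by simp
  then show ?thesis
  proof induction
    case empty
    show ?case by simp
  next
    case (insert j I)
    obtain v \<mu> where eig: "\<And>i. i \<in> I \<Longrightarrow> M *v v i = (\<mu> i :: real) *\<^sub>R v i"
      and orth: "\<And>i k. i \<in> I \<Longrightarrow> k \<in> I \<Longrightarrow> cdot (v i) (v k) = (if i = k then 1 else 0)"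
      using insert.IH by blast
    let ?W = "{x. \<forall>i\<in>I. cdot (v i) x = 0}"
    \<comment> \<open>Fewer than \<open>n\<close> homogeneous equations: the square system with a zero row is singular.\<close>
    define R :: "complex^'n^'n" where "R = (\<chi> i k. if i \<in> I then cnj (v i $ k) else 0)"
    have "row j R = 0"
      using insert.hyps by (simp add: R_def row_def vec_eq_iff)
    then have "det R = 0" by (rule det_zero_row)
    then have "\<not> invertible R" by (simp add: invertible_det_nz)
    then obtain x0 where x0: "R *v x0 = 0" "x0 \<noteq> 0" using invertible_kerI by blast
    have "cdot (v i) x0 = (R *v x0) $ i" if "i \<in> I" for i
      using that by (simp add: cdot_def R_def matrix_vector_mult_def)
    then have "x0 \<in> ?W" using x0 by simp
    moreover have "subspace ?W"
      by (simp add: subspace_def cdot_add_right cdot_scaleR_right)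
    moreover have "M *v z \<in> ?W" if "z \<in> ?W" for z
      using that by (simp add: cdot_adjoint herm eig cdot_scaleR_left)
    ultimately obtain w \<nu> where w: "w \<in> ?W" "norm w = 1" "M *v w = (\<nu>::real) *\<^sub>R w"
      using hermitian_eigenvector_in_subspace[OF herm, of ?W x0] x0(2) by blast
    have "cdot w w = 1" using w(2) by (simp add: cdot_self)
    moreover have "cdot w (v i) = 0" if "i \<in> I" for i
      using that w(1) cdot_commute[of w "v i"] by simp
    ultimately show ?case
      using insert.hyps w eig orth
      by (intro exI[of _ "v(j := w)"] exI[of _ "\<mu>(j := \<nu>)"]) auto
  qed
qed

theorem hermitian_spectral:
  fixes M :: "complex^'n^'n"
  assumes herm: "M\<^sup>H = M"
  obtains U :: "complex^'n^'n" and d where "U\<^sup>H ** U = mat 1" "U ** U\<^sup>H = mat 1" "M = U ** cdiag d ** U\<^sup>H"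
proof -
  obtain v \<mu> where eig: "\<And>i::'n. M *v v i = (\<mu> i :: real) *\<^sub>R v i"
    and orth: "\<And>i k. cdot (v i) (v k) = (if i = k then 1 else 0)"
    using orthonormal_eigenvectors[OF herm, of UNIV] by auto
  define U :: "complex^'n^'n" where "U = (\<chi> i k. v k $ i)"
  have 1: "U\<^sup>H ** U = mat 1"
    using orth by (simp add: U_def ctranspose_def matrix_matrix_mult_def mat_def vec_eq_iff cdot_def)
  then have 2: "U ** U\<^sup>H = mat 1" by (simp add: matrix_left_right_inverse)
  have "(M ** U) $ i $ k = (U ** cdiag \<mu>) $ i $ k" for i k
  proof -
    have "(M ** U) $ i $ k = (M *v v k) $ i"
      by (simp add: U_def matrix_matrix_mult_def matrix_vector_mult_def)
    also have "\<dots> = v k $ i * of_real (\<mu> k)" unfolding eig by (simp add: complex_eq_iff)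
    also have "\<dots> = (U ** cdiag \<mu>) $ i $ k"
      by (simp add: U_def cdiag_def matrix_matrix_mult_def if_distrib cong: if_cong)
    finally show ?thesis .
  qed
  then have "M ** U = U ** cdiag \<mu>" by (simp add: vec_eq_iff)
  then have "M = U ** cdiag \<mu> ** U\<^sup>H" by (metis 2 matrix_mul_assoc matrix_mul_rid)
  with 1 2 show thesis by (rule that)
qed

lemma inner_cdiag: "x \<bullet> (cdiag d *v x) = (\<Sum>i\<in>UNIV. d i * (cmod (x $ i))\<^sup>2)"
proof -
  have "(cdiag d *v x) $ i = d i *\<^sub>R (x $ i)" for i
    by (simp add: cdiag_def matrix_vector_mult_def if_distrib[of "\<lambda>z. z * _"] scaleR_conv_of_real
        cong: if_cong)
  then show ?thesis by (simp add: inner_vec_def dot_square_norm)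
qed

lemma ctranspose_cdiag [simp]: "(cdiag d)\<^sup>H = cdiag d"
  by (auto simp: cdiag_def ctranspose_def vec_eq_iff)

lemma psd_cdiag: "(\<And>i. 0 \<le> d i) \<Longrightarrow> psd (cdiag d)"
  by (simp add: psd_iff inner_cdiag sum_nonneg)

lemma cdiag_mult: "cdiag a ** cdiag b = cdiag (\<lambda>i. a i * b i)"
  by (auto simp: cdiag_def matrix_matrix_mult_def vec_eq_iff if_distrib[of "\<lambda>z. z * _"] cong: if_cong)

lemma det_cdiag: "det (cdiag d) = of_real (\<Prod>i\<in>UNIV. d i)"
  by (subst det_diagonal) (simp_all add: cdiag_def)

lemma re_trace_cdiag: "re_trace (cdiag d) = (\<Sum>i\<in>UNIV. d i)"
  by (simp add: re_trace_def trace_def cdiag_def)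

lemma cdiag_eigenvalue:
  fixes M U :: "complex^'n^'n"
  assumes "U\<^sup>H ** U = mat 1" "M = U ** cdiag d ** U\<^sup>H"
  obtains x where "x \<noteq> 0" "x \<bullet> (M *v x) = d i"
proof -
  let ?e = "axis i 1 :: complex^'n"
  let ?x = "U *v ?e"
  have e: "U\<^sup>H *v ?x = ?e" by (simp add: matrix_vector_mul_assoc assms(1))
  then have "?x \<noteq> 0" by (metis axis_eq_0_iff matrix_vector_mult_0_right zero_neq_one)
  moreover have "?x \<bullet> (M *v ?x) = ?e \<bullet> (cdiag d *v ?e)"
    unfolding assms(2) matrix_vector_mul_assoc[symmetric] e
    by (simp add: inner_adjoint e)
  moreover have "?e \<bullet> (cdiag d *v ?e) = d i"
    by (simp add: inner_cdiag axis_def if_distrib[of "\<lambda>z. _ * z"] if_distrib[of cmod]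
        if_distrib[of "\<lambda>z. z^2"] cong: if_cong)
  ultimately show thesis by (intro that) auto
qed

lemma psd_spectral:
  fixes M :: "complex^'n^'n"
  assumes "psd M"
  obtains U :: "complex^'n^'n" and d where "U\<^sup>H ** U = mat 1" "U ** U\<^sup>H = mat 1" "M = U ** cdiag d ** U\<^sup>H" "\<And>i. 0 \<le> d i"
proof -
  obtain U :: "complex^'n^'n" and d where *: "U\<^sup>H ** U = mat 1" "U ** U\<^sup>H = mat 1" "M = U ** cdiag d ** U\<^sup>H"
    by (rule hermitian_spectral[OF psd_hermitian[OF assms]])
  have "0 \<le> d i" for i
    using cdiag_eigenvalue[OF *(1,3), of i] psd_inner[OF assms] by metis
  with * show thesis by (rule that)
qed

lemma pos_def_spectral:
  fixes M :: "complex^'n^'n"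
  assumes "pos_def M"
  obtains U :: "complex^'n^'n" and d where "U\<^sup>H ** U = mat 1" "U ** U\<^sup>H = mat 1" "M = U ** cdiag d ** U\<^sup>H" "\<And>i. 0 < d i"
proof -
  obtain U :: "complex^'n^'n" and d where *: "U\<^sup>H ** U = mat 1" "U ** U\<^sup>H = mat 1" "M = U ** cdiag d ** U\<^sup>H"
    by (rule hermitian_spectral[OF pos_def_hermitian[OF assms]])
  have "0 < d i" for i
    using cdiag_eigenvalue[OF *(1,3), of i] assms pos_def_iff by metis
  with * show thesis by (rule that)
qed

lemma psd_sqrt_exists:
  fixes Q :: "complex^'n^'n"
  assumes "psd Q"
  shows "\<exists>R. psd R \<and> R ** R = Q"
proof -
  obtain U :: "complex^'n^'n" and d where *: "U\<^sup>H ** U = mat 1" "U ** U\<^sup>H = mat 1" "Q = U ** cdiag d ** U\<^sup>H" "\<And>i. 0 \<le> d i"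
    by (rule psd_spectral[OF assms]) (rule that)
  let ?R = "U ** cdiag (\<lambda>i. sqrt (d i)) ** U\<^sup>H"
  have "?R ** ?R = U ** cdiag (\<lambda>i. sqrt (d i)) ** (U\<^sup>H ** U) ** cdiag (\<lambda>i. sqrt (d i)) ** U\<^sup>H"
    by (simp add: matrix_mul_assoc)
  also have "\<dots> = U ** (cdiag (\<lambda>i. sqrt (d i)) ** cdiag (\<lambda>i. sqrt (d i))) ** U\<^sup>H"
    by (simp add: *(1) matrix_mul_assoc)
  also have "\<dots> = Q" by (simp add: cdiag_mult *(4)) (simp add: *(3))
  finally have "?R ** ?R = Q" .
  moreover have "psd ?R" by (intro psd_congruence psd_cdiag real_sqrt_ge_zero *(4))
  ultimately show ?thesis by blast
qed

subsection \<open>Traces of products\<close>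

lemma inner_axis_matrix: "axis i 1 \<bullet> ((M::complex^'n^'n) *v axis i 1) = Re (M $ i $ i)"
proof -
  have "axis i 1 \<bullet> (M *v axis i 1) = (M *v axis i 1) $ i \<bullet> 1"
    by (metis inner_axis inner_commute)
  also have "(M *v axis i 1) $ i = M $ i $ i"
    by (simp add: matrix_vector_mult_def axis_def if_distrib cong: if_cong)
  finally show ?thesis by (simp add: inner_complex_def)
qed

lemma re_trace_axis: "re_trace M = (\<Sum>i\<in>UNIV. axis i 1 \<bullet> (M *v axis i 1))"
  by (simp add: re_trace_def trace_def inner_axis_matrix)

lemma re_trace_psd_nonneg: "psd M \<Longrightarrow> 0 \<le> re_trace M"
  unfolding re_trace_axis by (intro sum_nonneg psd_inner)

text \<open>With \<open>P = S S\<close> the trace is that of the positive semidefinite matrix \<open>S R S\<close>.\<close>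

lemma re_trace_mult_nonneg:
  assumes "psd P" "psd R"
  shows "0 \<le> re_trace (P ** R)"
proof -
  obtain S where S: "psd S" "P = S ** S" using psd_sqrt_exists[OF assms(1)] by blast
  have "re_trace (P ** R) = re_trace (S ** R ** S)"
    unfolding S(2) matrix_mul_assoc[symmetric] by (subst re_trace_mult_sym) (simp add: matrix_mul_assoc)
  moreover have "psd (S ** R ** S)"
    using S psd_hermitian assms(2) by (blast intro: psd_congruence_hermitian)
  ultimately show ?thesis by (simp add: re_trace_psd_nonneg)
qed

lemma re_trace_mult_mono:
  assumes "psd P" "psd (B - A)"
  shows "re_trace (P ** A) \<le> re_trace (P ** B)"
  using re_trace_mult_nonneg[OF assms] by (simp add: matrix_diff_ldistrib re_trace_diff)

lemma matrix_eq_zero_axisI: "(\<And>i. (M::complex^'n^'m) *v axis i 1 = 0) \<Longrightarrow> M = 0"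
  by (simp add: vec_eq_iff matrix_vector_mult_def axis_def if_distrib cong: if_cong)

text \<open>With \<open>R = S S\<close> the trace is the sum of the values of the form \<open>P\<close> at the columns of \<open>S\<close>.\<close>

lemma re_trace_mult_pos:
  assumes "pos_def P" "psd R" "R \<noteq> 0"
  shows "0 < re_trace (P ** R)"
proof -
  obtain S where S: "psd S" "R = S ** S" using psd_sqrt_exists[OF assms(2)] by blast
  have hS: "S\<^sup>H = S" using S psd_hermitian by blast
  have eq: "re_trace (P ** R) = re_trace (S ** P ** S)"
    unfolding S(2) matrix_mul_assoc by (subst re_trace_mult_sym) (simp add: matrix_mul_assoc)
  also have "\<dots> = (\<Sum>i\<in>UNIV. (S *v axis i 1) \<bullet> (P *v (S *v axis i 1)))"
    unfolding re_trace_axis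
    by (intro sum.cong refl) (simp add: matrix_vector_mul_assoc[symmetric] inner_adjoint hS)
  also have "\<dots> > 0"
  proof -
    obtain i where "S *v axis i 1 \<noteq> 0" using matrix_eq_zero_axisI[of S] S(2) assms(3) times0_left by metis
    then show ?thesis
      using assms(1) pos_def_psd psd_inner
      by (intro sum_pos2[of _ i]) (auto simp: pos_def_iff)
  qed
  finally show ?thesis .
qed

text \<open>Two square roots \<open>R\<close>, \<open>S\<close> of one matrix have \<open>R (R - S) + (R - S) S = 0\<close>; multiplying by
  \<open>R - S\<close> and taking traces leaves two nonnegative terms, so both vanish.\<close>

lemma psd_sqrt_unique:
  assumes R: "psd R" and S: "psd S" and eq: "R ** R = S ** S"
  shows "R = S"
proof -
  define D where "D = R - S"
  have hD: "D\<^sup>H = D" using R S by (simp add: D_def ctranspose_diff psd_hermitian)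
  have 0: "R ** D + D ** S = 0" by (simp add: D_def matrix_expand eq)
  have "re_trace (D ** R ** D) + re_trace (D ** S ** D) = 0"
  proof -
    have "re_trace (D ** S ** D) = re_trace (D ** (D ** S))" by (rule re_trace_mult_sym)
    moreover have "D ** R ** D = D ** (R ** D)" by (simp add: matrix_mul_assoc)
    moreover have "re_trace (D ** (R ** D + D ** S)) = 0" by (simp add: 0)
    ultimately show ?thesis by (simp add: matrix_add_ldistrib re_trace_add)
  qed
  moreover have "psd (D ** R ** D)" "psd (D ** S ** D)"
    using psd_congruence_hermitian R S hD by blast+
  ultimately have z: "re_trace (D ** R ** D) = 0" "re_trace (D ** S ** D) = 0"
    using re_trace_psd_nonneg by (metis add_nonneg_eq_0_iff)+
  have kernel: "T ** D = 0" if T: "psd T" "re_trace (D ** T ** D) = 0" for T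
  proof -
    have "(\<Sum>i\<in>UNIV. (D *v axis i 1) \<bullet> (T *v (D *v axis i 1))) = 0"
      using T(2) unfolding re_trace_axis
      by (simp add: matrix_vector_mul_assoc[symmetric] inner_adjoint hD)
    then have "(D *v axis i 1) \<bullet> (T *v (D *v axis i 1)) = 0" for i
      using T(1) by (subst (asm) sum_nonneg_eq_0_iff) (auto intro: psd_inner)
    then have "T *v (D *v axis i 1) = 0" for i by (rule psd_inner_zero_imp[OF T(1)])
    then show ?thesis by (intro matrix_eq_zero_axisI) (simp add: matrix_vector_mul_assoc[symmetric])
  qed
  have "D\<^sup>H ** D = R ** D - S ** D" by (simp add: hD) (simp add: D_def matrix_diff_rdistrib)
  also have "\<dots> = 0" using kernel[OF R z(1)] kernel[OF S z(2)] by simp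
  finally have "D \<bullet> D = 0" by (simp add: inner_eq_re_trace)
  then show ?thesis by (simp add: D_def)
qed

lemma psd_sqrt:
  assumes "psd Q"
  shows psd_psd_sqrt: "psd (psd_sqrt Q)" and psd_sqrt_mult_self: "psd_sqrt Q ** psd_sqrt Q = Q"
proof -
  have "\<exists>!R. psd R \<and> R ** R = Q"
    using psd_sqrt_exists[OF assms] psd_sqrt_unique by metis
  then have "psd (psd_sqrt Q) \<and> psd_sqrt Q ** psd_sqrt Q = Q"
    unfolding psd_sqrt_def by (rule theI')
  then show "psd (psd_sqrt Q)" "psd_sqrt Q ** psd_sqrt Q = Q" by auto
qed

section \<open>Concavity of the log-determinant\<close>

lemma pos_def_det:
  fixes M :: "complex^'n^'n"
  assumes "pos_def M"
  shows "det M = of_real (exp (log_det M))"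
proof -
  obtain U :: "complex^'n^'n" and d where *: "U\<^sup>H ** U = mat 1" "U ** U\<^sup>H = mat 1" "M = U ** cdiag d ** U\<^sup>H" "\<And>i. 0 < d i"
    by (rule pos_def_spectral[OF assms]) (rule that)
  have "det U * det (U\<^sup>H) = 1" by (metis *(2) det_mul det_I)
  then have "det M = of_real (\<Prod>i\<in>UNIV. d i)"
    by (simp add: *(3) det_mul det_cdiag)
  moreover have "0 < (\<Prod>i\<in>UNIV. d i)" by (simp add: *(4) prod_pos)
  ultimately show ?thesis by (simp add: log_det_def del: of_real_prod)
qed

lemma log_det_eqI: "det M = of_real (exp x) \<Longrightarrow> log_det M = x"
  by (simp add: log_det_def)

lemma log_det_mat [simp]: "log_det (mat 1) = 0"
  by (simp add: log_det_def det_I)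

text \<open>In terms of eigenvalues this is the scalar inequality \<open>ln d \<le> d - 1\<close>.\<close>

lemma log_det_le_trace:
  fixes Z :: "complex^'n^'n"
  assumes "pos_def Z"
  shows "log_det Z \<le> re_trace Z - CARD('n)"
    and "log_det Z = re_trace Z - CARD('n) \<Longrightarrow> Z = mat 1"
proof -
  obtain U :: "complex^'n^'n" and d where *: "U\<^sup>H ** U = mat 1" "U ** U\<^sup>H = mat 1" "Z = U ** cdiag d ** U\<^sup>H" "\<And>i. 0 < d i"
    by (rule pos_def_spectral[OF assms]) (rule that)
  have "det U * det (U\<^sup>H) = 1" by (metis *(2) det_mul det_I)
  then have "det Z = of_real (\<Prod>i\<in>UNIV. d i)"
    by (simp add: *(3) det_mul det_cdiag)
  then have ld: "log_det Z = (\<Sum>i\<in>UNIV. ln (d i))"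
    using *(4) by (simp add: log_det_def del: of_real_prod) (subst ln_prod, auto simp: less_imp_neq[symmetric])
  have "re_trace Z = re_trace (U\<^sup>H ** (U ** cdiag d))"
    unfolding *(3) by (rule re_trace_mult_sym)
  then have tr: "re_trace Z = (\<Sum>i\<in>UNIV. d i)"
    by (simp add: matrix_mul_assoc *(1) re_trace_cdiag)
  have eq: "re_trace Z - CARD('n) - log_det Z = (\<Sum>i\<in>UNIV. d i - 1 - ln (d i))"
    by (simp add: ld tr sum_subtractf)
  have nn: "0 \<le> d i - 1 - ln (d i)" for i
    using ln_le_minus_one[OF *(4)[of i]] by simp
  then have "0 \<le> (\<Sum>i\<in>UNIV. d i - 1 - ln (d i))" by (simp add: sum_nonneg)
  then show "log_det Z \<le> re_trace Z - CARD('n)" using eq by simp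
  assume "log_det Z = re_trace Z - CARD('n)"
  then have "(\<Sum>i\<in>UNIV. d i - 1 - ln (d i)) = 0" using eq by simp
  then have "d i - 1 - ln (d i) = 0" for i
    using nn by (subst (asm) sum_nonneg_eq_0_iff) auto
  then have "d i = 1" for i
    using ln_eq_minus_one[OF *(4)[of i]] by (smt (verit))
  then have "cdiag d = mat 1" by (simp add: cdiag_def mat_def vec_eq_iff)
  then show "Z = mat 1" by (simp add: *(2,3))
qed

text \<open>With \<open>R R = Y\<inverse>\<close> this is the case \<open>Y = mat 1\<close>, applied to \<open>R Z R\<close>.\<close>

lemma log_det_tangent:
  fixes Y Z :: "complex^'n^'n"
  assumes Y: "pos_def Y" and Z: "pos_def Z"
  shows "log_det Z \<le> log_det Y + re_trace (matrix_inv Y ** (Z - Y))" (is "?le")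
    and "Z \<noteq> Y \<Longrightarrow> log_det Z < log_det Y + re_trace (matrix_inv Y ** (Z - Y))"
proof -
  note iY = pos_def_invertible[OF Y]
  obtain R where R: "psd R" "R ** R = matrix_inv Y"
    using psd_sqrt_exists pos_def_psd pos_def_matrix_inv[OF Y] by blast
  have hR: "R\<^sup>H = R" using R psd_hermitian by blast
  have RY: "R ** (R ** Y) = mat 1" by (simp add: matrix_mul_assoc R(2) inv_left iY)
  then have iR: "invertible R" by (rule invertibleI)
  define X where "X = R ** Z ** R"
  have "psd X" unfolding X_def using Z hR by (simp add: psd_congruence_hermitian pos_def_psd)
  moreover have "invertible X"
    unfolding X_def by (intro invertible_mult iR pos_def_invertible Z)
  ultimately have X: "pos_def X" by (rule psd_nonsingular_pos_def)
  have "det X * det Y = det Z"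
  proof -
    have "det R * det R * det Y = 1" by (metis RY det_mul det_I mult.assoc)
    then show ?thesis by (simp add: X_def det_mul mult.commute mult.left_commute)
  qed
  then have "of_real (exp (log_det X + log_det Y)) = (of_real (exp (log_det Z)) :: complex)"
    unfolding pos_def_det[OF X] pos_def_det[OF Y] pos_def_det[OF Z]
    by (simp add: exp_add)
  then have ld: "log_det X + log_det Y = log_det Z"
    by (metis exp_inj_iff of_real_eq_iff)
  have "re_trace X = re_trace (matrix_inv Y ** Z)"
    unfolding X_def R(2)[symmetric] by (subst re_trace_mult_sym) (simp add: matrix_mul_assoc)
  then have tr: "re_trace X - CARD('n) = re_trace (matrix_inv Y ** (Z - Y))"
    by (simp add: matrix_diff_ldistrib inv_left iY re_trace_diff re_trace_mat)
  show ?le using log_det_le_trace(1)[OF X] ld tr by simp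
  assume ne: "Z \<noteq> Y"
  have "log_det X \<noteq> re_trace X - CARD('n)"
  proof
    assume "log_det X = re_trace X - CARD('n)"
    then have "X = mat 1" by (rule log_det_le_trace(2)[OF X])
    then have "R ** (Z ** R) = mat 1" by (simp add: X_def matrix_mul_assoc)
    then have "Z ** R ** R = mat 1" by (metis matrix_left_right_inverse)
    then have "Z ** matrix_inv Y = mat 1" by (simp add: R(2) matrix_mul_assoc[symmetric])
    then have "Z = Y" by (metis iY inv_left matrix_mul_assoc matrix_mul_lid matrix_mul_rid)
    with ne show False by simp
  qed
  then show "log_det Z < log_det Y + re_trace (matrix_inv Y ** (Z - Y))"
    using log_det_le_trace(1)[OF X] ld tr by simp
qed

section \<open>Differentiability of the matrix inverse and of the log-determinant\<close>

lemma matrix_mult_bound: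
  obtains k where "0 < k" "\<And>(A::complex^'n^'n) (B::complex^'n^'n). norm (A ** B) \<le> norm A * norm B * k"
proof -
  have "bounded_bilinear (\<lambda>(A::complex^'n^'n) (B::complex^'n^'n). A ** B)" by (rule bounded_bilinear_matrix_mult)
  then show thesis using bounded_bilinear.pos_bounded that by blast
qed

text \<open>In \<open>N\<inverse> = M\<inverse> - M\<inverse> (N - M) N\<inverse>\<close> the last term takes up at most half of the norm of \<open>N\<inverse>\<close> when \<open>N\<close> is
  close to \<open>M\<close>.\<close>

lemma eventually_invertible_bounded:
  fixes M :: "complex^'n^'n"
  assumes M: "invertible M"
  obtains B where "0 < B" "\<forall>\<^sub>F N in nhds M. invertible N \<and> norm (matrix_inv N) \<le> B"
proof -
  obtain k where k: "0 < k" "\<And>(A::complex^'n^'n) (B::complex^'n^'n). norm (A ** B) \<le> norm A * norm B * k"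
    by (rule matrix_mult_bound) (rule that)
  obtain k' where k': "0 < k'" "\<And>(A::complex^'n^'n) x. norm (A *v x) \<le> norm A * norm x * k'"
  proof -
    have "bounded_bilinear (\<lambda>(A::complex^'n^'n) x. A *v x)"
      unfolding bilinear_conv_bounded_bilinear[symmetric] bilinear_def
      by (auto intro!: linearI simp: mult_vec_scaleR scaleR_mult_vec matrix_vector_right_distrib
          matrix_vector_mult_add_rdistrib)
    then show thesis using bounded_bilinear.pos_bounded that by blast
  qed
  let ?R = "matrix_inv M"
  define r where "r = norm ?R + 1"
  have r: "0 < r" "norm ?R \<le> r" by (auto simp: r_def add_nonneg_pos)
  define e where "e = 1 / (2 * r * k * (k + k'))"
  have e: "0 < e" using r k k' by (simp add: e_def add_pos_pos)
  \<comment> \<open>\<open>e\<close> makes \<open>M\<inverse> E\<close> a contraction, both on vectors and as a left factor of a matrix.\<close>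
  have small: "norm (?R ** E) * (k + k') < 1 / 2" if "norm E < e" for E :: "complex^'n^'n"
  proof -
    have "norm (?R ** E) \<le> r * norm E * k"
      using k(2)[of ?R E] r k by (smt (verit) mult_right_mono norm_ge_zero)
    also have "\<dots> < r * e * k" using that r k by simp
    finally have "norm (?R ** E) * (k + k') < (r * e * k) * (k + k')" using k k' by simp
    also have "\<dots> = 1 / 2" using r k k' by (simp add: e_def)
    finally show ?thesis .
  qed
  have "invertible N \<and> norm (matrix_inv N) \<le> 2 * r" if N: "dist N M < e" for N
  proof -
    define E where "E = N - M"
    have E: "norm (?R ** E) * k' \<le> 1/2" "norm (?R ** E) * k \<le> 1/2"
      using small[of E] N k k' norm_ge_zero[of "?R ** E"] unfolding E_def dist_norm distrib_left
      by (smt (verit) mult_nonneg_nonneg)+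
    have RN: "?R ** N = mat 1 + ?R ** E"
      by (simp add: E_def matrix_diff_ldistrib inv_left M)
    have N': "invertible N"
    proof (rule invertible_kerI)
      fix x assume "N *v x = 0"
      then have "(?R ** N) *v x = 0" by (simp add: matrix_vector_mul_assoc[symmetric])
      then have "x = - ((?R ** E) *v x)"
        unfolding RN by (simp add: matrix_vector_mult_add_rdistrib eq_neg_iff_add_eq_0)
      then have "norm x \<le> norm (?R ** E) * norm x * k'"
        using k'(2)[of "?R ** E" x] by (metis norm_minus_cancel)
      also have "\<dots> = (norm (?R ** E) * k') * norm x" by simp
      also have "\<dots> \<le> 1/2 * norm x" using E(1) by (rule mult_right_mono) simp
      finally show "x = 0" by simp
    qed
    let ?Y = "matrix_inv N"
    have "?Y = ?R - ?R ** E ** ?Y"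
      by (simp add: E_def matrix_expand matrix_mul_assoc[symmetric] inv_right inv_left_assoc M N')
    then have "norm ?Y \<le> norm ?R + norm (?R ** E ** ?Y)" by (metis norm_triangle_ineq4)
    also have "norm (?R ** E ** ?Y) \<le> (norm (?R ** E) * k) * norm ?Y"
      using k(2)[of "?R ** E" ?Y] by (simp add: ac_simps)
    also have "\<dots> \<le> 1/2 * norm ?Y" using E(2) by (rule mult_right_mono) simp
    finally show ?thesis using N' r by simp
  qed
  then have "\<forall>\<^sub>F N in nhds M. invertible N \<and> norm (matrix_inv N) \<le> 2 * r"
    unfolding eventually_nhds_metric using e by blast
  then show thesis using r by (intro that[of "2 * r"]) auto
qed

lemma matrix_inv_diff:
  "invertible (M::complex^'n^'n) \<Longrightarrow> invertible N \<Longrightarrow>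
    matrix_inv N - matrix_inv M = - (matrix_inv N ** (N - M) ** matrix_inv M)"
  by (simp add: matrix_expand matrix_mul_assoc[symmetric] inv_right inv_left inv_left_assoc)

lemma isCont_matrix_inv:
  fixes M :: "complex^'n^'n"
  assumes M: "invertible M"
  shows "isCont matrix_inv M"
proof -
  obtain B where B: "0 < B" "\<forall>\<^sub>F N in nhds M. invertible N \<and> norm (matrix_inv N) \<le> B"
    by (rule eventually_invertible_bounded[OF M])
  obtain k where k: "0 < k" "\<And>(A::complex^'n^'n) (B::complex^'n^'n). norm (A ** B) \<le> norm A * norm B * k"
    by (rule matrix_mult_bound) (rule that)
  have "((\<lambda>N. matrix_inv N - matrix_inv M) \<longlongrightarrow> 0) (nhds M)"
  proof (rule Lim_null_comparison)
    show "\<forall>\<^sub>F N in nhds M. norm (matrix_inv N - matrix_inv M)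
        \<le> B * k * norm (matrix_inv M) * k * norm (N - M)"
      using B(2)
    proof eventually_elim
      case (elim N)
      have "norm (matrix_inv N - matrix_inv M) = norm (matrix_inv N ** (N - M) ** matrix_inv M)"
        using elim M by (simp add: matrix_inv_diff)
      also have "\<dots> \<le> norm (matrix_inv N ** (N - M)) * norm (matrix_inv M) * k" by (rule k)
      also have "\<dots> \<le> (norm (matrix_inv N) * norm (N - M) * k) * norm (matrix_inv M) * k"
        using k by (intro mult_right_mono k) auto
      also have "\<dots> \<le> (B * norm (N - M) * k) * norm (matrix_inv M) * k"
        using elim k by (intro mult_right_mono) auto
      finally show ?case by (simp add: ac_simps)
    qed
    have "((\<lambda>N. B * k * norm (matrix_inv M) * k * norm (N - M)) \<longlongrightarrow>
        B * k * norm (matrix_inv M) * k * norm (M - M)) (nhds M)"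
      by (intro tendsto_intros filterlim_ident)
    then show "((\<lambda>N. B * k * norm (matrix_inv M) * k * norm (N - M)) \<longlongrightarrow> 0) (nhds M)" by simp
  qed
  then have "(matrix_inv \<longlongrightarrow> matrix_inv M) (nhds M)" by (simp add: LIM_zero_iff)
  then show ?thesis unfolding isCont_def by (rule filterlim_mono) (auto simp: at_within_le_nhds)
qed

lemma continuous_on_matrix_inv:
  fixes f :: "'a::t2_space \<Rightarrow> complex^'n^'n"
  assumes "continuous_on S f" "\<And>x. x \<in> S \<Longrightarrow> invertible (f x)"
  shows "continuous_on S (\<lambda>x. matrix_inv (f x))"
  unfolding continuous_on_eq_continuous_within
proof
  fix x assume x: "x \<in> S"
  show "continuous (at x within S) (\<lambda>x. matrix_inv (f x))"
    by (rule continuous_within_compose3[OF isCont_matrix_inv])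
      (use assms x in \<open>auto simp: continuous_on_eq_continuous_within\<close>)
qed

lemmas continuous_on_matrix_mult = bounded_bilinear.continuous_on[OF bounded_bilinear_matrix_mult]

lemma bounded_linear_re_trace: "bounded_linear re_trace"
  using linear_re_trace by (rule linear_conv_bounded_linear[THEN iffD1])

lemmas continuous_on_re_trace = bounded_linear.continuous_on[OF bounded_linear_re_trace]

lemma has_derivative_matrix_inv:
  fixes M :: "complex^'n^'n"
  assumes M: "invertible M"
  shows "(matrix_inv has_derivative (\<lambda>H. - (matrix_inv M ** H ** matrix_inv M))) (at M within S)"
proof -
  obtain B where B: "\<forall>\<^sub>F N in nhds M. invertible N \<and> norm (matrix_inv N) \<le> B"
    by (rule eventually_invertible_bounded[OF M])
  obtain k where k: "0 < k" "\<And>(A::complex^'n^'n) (B::complex^'n^'n). norm (A ** B) \<le> norm A * norm B * k"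
    by (rule matrix_mult_bound) (rule that)
  let ?R = "matrix_inv M"
  have "bounded_linear (\<lambda>H. - (?R ** H ** ?R))"
    by (intro bounded_linear_minus linear_conv_bounded_linear[THEN iffD1] linearI)
      (simp_all add: matrix_expand)
  moreover have "((\<lambda>N. norm (matrix_inv N - ?R - - (?R ** (N - M) ** ?R)) / norm (N - M)) \<longlongrightarrow> 0) (at M)"
  proof (rule Lim_null_comparison)
    show "\<forall>\<^sub>F N in at M. norm (norm (matrix_inv N - ?R - - (?R ** (N - M) ** ?R)) / norm (N - M))
        \<le> norm (matrix_inv N - ?R) * k * norm ?R * k"
      using B[unfolded eventually_nhds_conv_at, THEN conjunct1] eventually_neq_at_within
    proof eventually_elim
      fix N assume elim: "invertible N \<and> norm (matrix_inv N) \<le> B" "N \<noteq> M"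
      have "matrix_inv N - ?R - - (?R ** (N - M) ** ?R) = - ((matrix_inv N - ?R) ** (N - M) ** ?R)"
        by (subst matrix_inv_diff) (use elim M in \<open>simp_all add: matrix_diff_rdistrib[of "matrix_inv N" ?R]
            matrix_diff_rdistrib[of "_ ** (N - M)" "_ ** (N - M)"]\<close>)
      then have "norm (matrix_inv N - ?R - - (?R ** (N - M) ** ?R))
          = norm ((matrix_inv N - ?R) ** (N - M) ** ?R)" by simp
      also have "\<dots> \<le> norm ((matrix_inv N - ?R) ** (N - M)) * norm ?R * k" by (rule k)
      also have "\<dots> \<le> (norm (matrix_inv N - ?R) * norm (N - M) * k) * norm ?R * k"
        using k by (intro mult_right_mono k) auto
      finally show "norm (norm (matrix_inv N - ?R - - (?R ** (N - M) ** ?R)) / norm (N - M))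
        \<le> norm (matrix_inv N - ?R) * k * norm ?R * k"
        using elim by (simp add: divide_le_eq ac_simps)
    qed
    have "(matrix_inv \<longlongrightarrow> ?R) (at M)" using isCont_matrix_inv[OF M] by (simp add: isCont_def)
    then have "((\<lambda>N. norm (matrix_inv N - ?R) * k * norm ?R * k) \<longlongrightarrow>
        norm (?R - ?R) * k * norm ?R * k) (at M)"
      by (intro tendsto_intros)
    then show "((\<lambda>N. norm (matrix_inv N - ?R) * k * norm ?R * k) \<longlongrightarrow> 0) (at M)" by simp
  qed
  ultimately have "(matrix_inv has_derivative (\<lambda>H. - (?R ** H ** ?R))) (at M)"
    by (simp add: has_derivative_iff_norm)
  then show ?thesis by (rule has_derivative_at_withinI)
qed

lemma differentiable_matrix_inv:
  fixes f :: "'a::real_normed_vector \<Rightarrow> complex^'n^'n"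
  assumes "f differentiable (at x within S)" "invertible (f x)"
  shows "(\<lambda>x. matrix_inv (f x)) differentiable (at x within S)"
  using assms differentiable_def has_derivative_compose[OF _ has_derivative_matrix_inv[where S = UNIV]]
  by blast

lemma differentiable_matrix_mult:
  fixes f :: "'a::real_normed_vector \<Rightarrow> complex^'n^'m"
  assumes "f differentiable (at x within S)" "g differentiable (at x within S)"
  shows "(\<lambda>x. f x ** g x) differentiable (at x within S)"
  using assms bounded_bilinear.FDERIV[OF bounded_bilinear_matrix_mult] unfolding differentiable_def
  by blast

lemma differentiable_re_trace:
  "f differentiable (at x within S) \<Longrightarrow> (\<lambda>x. re_trace (f x)) differentiable (at x within S)"
  using bounded_linear.has_derivative[OF bounded_linear_re_trace] unfolding differentiable_def
  by blast

lemma norm_re_trace_mult_le: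
  obtains c where "\<And>(A::complex^'n^'n) (B::complex^'n^'n). \<bar>re_trace (A ** B)\<bar> \<le> norm A * norm B * c"
proof -
  have "bounded_bilinear (\<lambda>(A::complex^'n^'n) (B::complex^'n^'n). re_trace (A ** B))"
    unfolding bilinear_conv_bounded_bilinear[symmetric] bilinear_def
    by (auto intro!: linearI simp: matrix_expand re_trace_add re_trace_scaleR)
  from bounded_bilinear.bounded[OF this] show thesis using that unfolding real_norm_def by blast
qed

text \<open>The tangents at \<open>x\<close> and at \<open>y\<close> bound the increment from \<open>x\<close> to \<open>y\<close> on both sides, and they differ only
  by the variation of the slope.\<close>

lemma has_derivative_within_tangent:
  fixes f :: "'a::real_normed_vector \<Rightarrow> real"
  assumes upper: "\<And>y z. y \<in> S \<Longrightarrow> z \<in> S \<Longrightarrow> f z \<le> f y + \<Phi> y (z - y)"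
    and lin: "\<And>y. y \<in> S \<Longrightarrow> bounded_linear (\<Phi> y)"
    and x: "x \<in> S"
    and bound: "\<And>y h. y \<in> S \<Longrightarrow> \<bar>\<Phi> y h - \<Phi> x h\<bar> \<le> \<epsilon> y * norm h"
    and lim: "(\<epsilon> \<longlongrightarrow> 0) (at x within S)"
  shows "(f has_derivative \<Phi> x) (at x within S)"
proof -
  have "((\<lambda>y. norm (f y - f x - \<Phi> x (y - x)) / norm (y - x)) \<longlongrightarrow> 0) (at x within S)"
  proof (rule Lim_null_comparison[OF _ lim])
    have "\<bar>f y - f x - \<Phi> x (y - x)\<bar> \<le> \<epsilon> y * norm (y - x)" if "y \<in> S" for y
    proof -
      have "\<Phi> y (x - y) = - \<Phi> y (y - x)"
        using linear_neg[OF bounded_linear.linear[OF lin[OF that]], of "y - x"] by simp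
      then show ?thesis
        using upper[OF x that] upper[OF that x] bound[OF that, of "y - x"] by linarith
    qed
    then show "\<forall>\<^sub>F y in at x within S. norm (norm (f y - f x - \<Phi> x (y - x)) / norm (y - x)) \<le> \<epsilon> y"
      unfolding eventually_at_filter by (intro always_eventually) (simp add: divide_le_eq)
  qed
  then show ?thesis using lin[OF x] by (simp add: has_derivative_iff_norm)
qed

text \<open>The tangent inequality provides the affine bounds, and the slope \<open>Z\<inverse>\<close> is continuous in \<open>Z\<close>.\<close>

lemma has_derivative_log_det:
  fixes Y :: "complex^'n^'n"
  assumes Y: "pos_def Y"
  shows "(log_det has_derivative (\<lambda>H. re_trace (matrix_inv Y ** H))) (at Y within {Z. pos_def Z})"
proof -
  obtain c where c: "\<And>(A::complex^'n^'n) (B::complex^'n^'n). \<bar>re_trace (A ** B)\<bar> \<le> norm A * norm B * c"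
    by (rule norm_re_trace_mult_le) (rule that)
  show ?thesis
  proof (rule has_derivative_within_tangent
      [where \<Phi> = "\<lambda>Z H. re_trace (matrix_inv Z ** H)" and \<epsilon> = "\<lambda>Z. norm (matrix_inv Z - matrix_inv Y) * c"])
    show "log_det Z \<le> log_det X + re_trace (matrix_inv X ** (Z - X))"
      if "X \<in> {Z. pos_def Z}" "Z \<in> {Z. pos_def Z}" for X Z
      using that by (simp add: log_det_tangent)
    show "bounded_linear (\<lambda>H. re_trace (matrix_inv X ** H))" for X :: "complex^'n^'n"
      by (intro linear_conv_bounded_linear[THEN iffD1] linearI)
        (simp_all add: matrix_expand re_trace_add re_trace_scaleR)
    show "\<bar>re_trace (matrix_inv X ** H) - re_trace (matrix_inv Y ** H)\<bar>
        \<le> norm (matrix_inv X - matrix_inv Y) * c * norm H" for X H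
      using c[of "matrix_inv X - matrix_inv Y" H]
      by (simp add: matrix_diff_rdistrib re_trace_diff ac_simps)
    have "isCont matrix_inv Y" using Y by (intro isCont_matrix_inv pos_def_invertible)
    then have "(matrix_inv \<longlongrightarrow> matrix_inv Y) (at Y within {Z. pos_def Z})"
      by (metis continuous_at_imp_continuous_within continuous_within)
    then have "((\<lambda>Z. norm (matrix_inv Z - matrix_inv Y) * c) \<longlongrightarrow> norm (matrix_inv Y - matrix_inv Y) * c)
        (at Y within {Z. pos_def Z})"
      by (intro tendsto_intros)
    then show "((\<lambda>Z. norm (matrix_inv Z - matrix_inv Y) * c) \<longlongrightarrow> 0) (at Y within {Z. pos_def Z})"
      by simp
  qed (use Y in simp)
qed

lemma has_real_derivative_log_det:
  fixes f :: "real \<Rightarrow> complex^'n^'n"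
  assumes f: "(f has_vector_derivative f') (at x within S)"
    and pd: "\<And>y. y \<in> S \<Longrightarrow> pos_def (f y)" and x: "x \<in> S"
  shows "((\<lambda>y. log_det (f y)) has_real_derivative re_trace (matrix_inv (f x) ** f')) (at x within S)"
proof -
  have "(log_det has_derivative (\<lambda>H. re_trace (matrix_inv (f x) ** H))) (at (f x) within f ` S)"
    using has_derivative_log_det[OF pd[OF x]] by (rule has_derivative_subset) (use pd in auto)
  from diff_chain_within[OF f[unfolded has_vector_derivative_def] this]
  show ?thesis
    by (simp add: has_field_derivative_def o_def matrix_expand re_trace_scaleR mult_commute_abs)
qed

lemma matrix_inv_intertwine:
  fixes W :: "complex^'m^'m" and Z :: "complex^'n^'n" and X Y :: "complex^'n^'m"
  assumes "W ** X = Y ** Z" "invertible W" "invertible Z"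
  shows "X ** matrix_inv Z = matrix_inv W ** Y"
proof -
  have "X ** matrix_inv Z = matrix_inv W ** (W ** X) ** matrix_inv Z"
    using assms(2) by (simp only: inv_left_assoc)
  also have "\<dots> = matrix_inv W ** Y"
    unfolding assms(1) by (simp add: matrix_mul_assoc[symmetric] inv_right assms)
  finally show ?thesis .
qed

text \<open>Sylvester's determinant identity. After replacing \<open>B\<^sup>H\<close> by \<open>s B\<^sup>H\<close> both sides agree at \<open>s = 0\<close> and
  have the same logarithmic derivative in \<open>s\<close>, by
  \<open>U\<inverse> B (T + s B\<^sup>H U\<inverse> B)\<inverse> = (U + s B T\<inverse> B\<^sup>H)\<inverse> B T\<inverse>\<close>.\<close>

lemma log_det_sylvester:
  fixes U :: "complex^'r^'r" and T :: "complex^'t^'t" and B :: "complex^'t^'r"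
  assumes U: "pos_def U" and T: "pos_def T"
  shows "log_det U + log_det (T + B\<^sup>H ** matrix_inv U ** B)
    = log_det T + log_det (U + B ** matrix_inv T ** B\<^sup>H)"
proof -
  note iU = pos_def_invertible[OF U] and iT = pos_def_invertible[OF T]
  let ?P = "B\<^sup>H ** matrix_inv U ** B" and ?R = "B ** matrix_inv T ** B\<^sup>H"
  have P: "psd ?P" and R: "psd ?R"
    using U T by (auto intro: psd_congruence psd_congruence' pos_def_psd pos_def_matrix_inv)
  have pdP: "pos_def (T + s *\<^sub>R ?P)" and pdR: "pos_def (U + s *\<^sub>R ?R)" if "0 \<le> s" for s
    using that U T P R by (auto intro: pos_def_add_psd psd_scaleR)
  define g where "g s = log_det (T + s *\<^sub>R ?P) - log_det (U + s *\<^sub>R ?R)" for s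
  have "(g has_real_derivative 0) (at s within {0..1})" if s: "s \<in> {0..1}" for s
  proof -
    note iP = pos_def_invertible[OF pdP] and iR = pos_def_invertible[OF pdR]
    let ?Z = "matrix_inv (T + s *\<^sub>R ?P)" and ?W = "matrix_inv (U + s *\<^sub>R ?R)"
    have s0: "0 \<le> s" using s by simp
    have swap: "matrix_inv U ** B ** ?Z = ?W ** B ** matrix_inv T"
    proof -
      have "(U + s *\<^sub>R ?R) ** (matrix_inv U ** B) = (B ** matrix_inv T) ** (T + s *\<^sub>R ?P)"
        by (simp add: matrix_expand matrix_mul_assoc[symmetric] inv_right_assoc inv_left iU iT)
      then show ?thesis
        using iR[OF s0] iP[OF s0] by (simp add: matrix_inv_intertwine matrix_mul_assoc)
    qed
    have "re_trace (?Z ** ?P) = re_trace (B\<^sup>H ** (matrix_inv U ** B ** ?Z))"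
      by (subst re_trace_mult_sym) (simp add: matrix_mul_assoc)
    also have "\<dots> = re_trace ((?W ** B ** matrix_inv T) ** B\<^sup>H)"
      unfolding swap by (rule re_trace_mult_sym)
    also have "\<dots> = re_trace (?W ** ?R)" by (simp add: matrix_mul_assoc)
    finally have eq: "re_trace (?Z ** ?P) = re_trace (?W ** ?R)" .
    have d1: "((\<lambda>s. log_det (T + s *\<^sub>R ?P)) has_real_derivative re_trace (?Z ** ?P)) (at s within {0..1})"
      using s by (intro has_real_derivative_log_det pdP) (auto intro!: derivative_eq_intros)
    have d2: "((\<lambda>s. log_det (U + s *\<^sub>R ?R)) has_real_derivative re_trace (?W ** ?R)) (at s within {0..1})"
      using s by (intro has_real_derivative_log_det pdR) (auto intro!: derivative_eq_intros)
    show ?thesis unfolding g_def using DERIV_diff[OF d1 d2] eq by simp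
  qed
  then obtain c where "\<And>s. s \<in> {0..1} \<Longrightarrow> g s = c"
    using has_field_derivative_zero_constant[of "{0..1::real}" g] by auto
  then have "g 1 = g 0" by simp
  then show ?thesis by (simp add: g_def)
qed

lemma log_det_mult:
  fixes X Y :: "complex^'n^'n"
  assumes "pos_def X" "pos_def Y"
  shows "log_det (X ** Y) = log_det X + log_det Y"
  by (rule log_det_eqI) (simp add: det_mul pos_def_det assms exp_add)

lemma log_det_matrix_inv:
  fixes Y :: "complex^'n^'n"
  assumes "pos_def Y"
  shows "log_det (matrix_inv Y) = - log_det Y"
  using log_det_mult[OF assms pos_def_matrix_inv[OF assms]]
  by (simp add: inv_right pos_def_invertible assms)

section \<open>The coupled fixed-point equations\<close>

text \<open>The Schur complement of \<open>mat 1 + k X\<close> in the block matrix with diagonal blocks \<open>mat 1 + kt C\<close>,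
  \<open>mat 1 + k X\<close> and off-diagonal blocks \<open>B\<close>, \<open>- B\<^sup>H\<close>. The other Schur complement has the same form with
  \<open>C\<close> and \<open>X\<close>, \<open>k\<close> and \<open>kt\<close>, \<open>B\<close> and \<open>B\<^sup>H\<close> exchanged (the signs of the off-diagonal blocks cancel),
  so every fact about one fixed-point equation serves both.\<close>

definition schur_mat :: "complex^'m^'m \<Rightarrow> complex^'n^'n \<Rightarrow> complex^'n^'m \<Rightarrow> real \<Rightarrow> real \<Rightarrow> complex^'m^'m" where
  "schur_mat C X B k kt = mat 1 + kt *\<^sub>R C + B ** matrix_inv (mat 1 + k *\<^sub>R X) ** B\<^sup>H"

definition schur_trace :: "complex^'m^'m \<Rightarrow> complex^'n^'n \<Rightarrow> complex^'n^'m \<Rightarrow> real \<Rightarrow> real \<Rightarrow> real" where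
  "schur_trace C X B k kt = re_trace (C ** matrix_inv (schur_mat C X B k kt))"

lemma pos_def_shift: "psd X \<Longrightarrow> 0 \<le> k \<Longrightarrow> pos_def (mat 1 + k *\<^sub>R X)"
  by (simp add: pos_def_add_psd psd_scaleR)

lemma pos_def_schur_mat:
  assumes "psd C" "psd X" "0 \<le> k" "0 \<le> kt"
  shows "pos_def (schur_mat C X B k kt)"
  unfolding schur_mat_def
  by (rule pos_def_add_psd[OF pos_def_shift psd_congruence])
    (use assms in \<open>auto intro: pos_def_psd pos_def_matrix_inv pos_def_shift\<close>)

lemma schur_trace_nonneg:
  assumes "psd C" "psd X" "0 \<le> k" "0 \<le> kt"
  shows "0 \<le> schur_trace C X B k kt"
  unfolding schur_trace_def
  by (rule re_trace_mult_nonneg[OF assms(1)])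
    (intro pos_def_psd pos_def_matrix_inv pos_def_schur_mat assms)

lemma schur_trace_pos:
  assumes "psd C" "psd X" "0 \<le> k" "0 \<le> kt" "C \<noteq> 0"
  shows "0 < schur_trace C X B k kt"
  unfolding schur_trace_def
  using assms by (subst re_trace_mult_sym) (intro re_trace_mult_pos pos_def_matrix_inv pos_def_schur_mat)

lemma re_trace_inv_mono:
  assumes "psd C" "pos_def W" "pos_def W'" "psd (W' - W)"
  shows "re_trace (C ** matrix_inv W') \<le> re_trace (C ** matrix_inv W)"
  using assms by (intro re_trace_mult_mono psd_matrix_inv_diff)

lemma schur_trace_le:
  assumes "psd C" "psd X" "0 \<le> k" "0 \<le> kt"
  shows "schur_trace C X B k kt \<le> re_trace C"
proof -
  have "psd (schur_mat C X B k kt - mat 1)"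
    using assms unfolding schur_mat_def
    by (simp add: psd_add psd_scaleR psd_congruence pos_def_psd pos_def_matrix_inv pos_def_shift)
  then have "re_trace (C ** matrix_inv (schur_mat C X B k kt)) \<le> re_trace (C ** matrix_inv (mat 1))"
    using assms by (intro re_trace_inv_mono pos_def_schur_mat pos_def_mat)
  then show ?thesis by (simp add: schur_trace_def)
qed

lemma psd_inv_shift_diff:
  assumes "psd X" "0 \<le> k" "k \<le> k'"
  shows "psd (matrix_inv (mat 1 + k *\<^sub>R X) - matrix_inv (mat 1 + k' *\<^sub>R X))"
proof (rule psd_matrix_inv_diff)
  have "mat 1 + k' *\<^sub>R X - (mat 1 + k *\<^sub>R X) = (k' - k) *\<^sub>R X" by (simp add: scaleR_diff_left)
  then show "psd (mat 1 + k' *\<^sub>R X - (mat 1 + k *\<^sub>R X))" using assms by (simp add: psd_scaleR)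
qed (use assms in \<open>auto intro: pos_def_shift\<close>)

lemma schur_trace_mono:
  assumes "psd C" "psd X" "0 \<le> k" "k \<le> k'" "0 \<le> kt'" "kt' \<le> kt"
  shows "schur_trace C X B k kt \<le> schur_trace C X B k' kt'"
  unfolding schur_trace_def
proof (rule re_trace_inv_mono)
  have "schur_mat C X B k kt - schur_mat C X B k' kt' = (kt - kt') *\<^sub>R C
      + B ** (matrix_inv (mat 1 + k *\<^sub>R X) - matrix_inv (mat 1 + k' *\<^sub>R X)) ** B\<^sup>H"
    by (simp add: schur_mat_def matrix_expand scaleR_diff_left)
  also have "psd \<dots>"
    using assms by (intro psd_add psd_scaleR psd_congruence psd_inv_shift_diff) auto
  finally show "psd (schur_mat C X B k kt - schur_mat C X B k' kt')" .
qed (use assms in \<open>auto intro: pos_def_schur_mat\<close>)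

lemma hermitian_le_mat:
  fixes W :: "complex^'n^'n"
  assumes "W\<^sup>H = W"
  obtains m where "0 < m" "psd (mat 1 - m *\<^sub>R W)"
proof -
  have "bounded_linear (\<lambda>x. W *v x)" by (rule matrix_vector_mul_bounded_linear)
  then obtain b where b: "0 < b" "\<And>x. norm (W *v x) \<le> norm x * b"
    using bounded_linear.pos_bounded by blast
  have "0 \<le> x \<bullet> ((mat 1 - (1/b) *\<^sub>R W) *v x)" for x
  proof -
    have "x \<bullet> (W *v x) \<le> norm x * (norm x * b)"
      using norm_cauchy_schwarz[of x "W *v x"] b(2)[of x]
      by (meson mult_left_mono norm_ge_zero order_trans)
    then have "x \<bullet> (W *v x) / b \<le> x \<bullet> x"
      using b(1) by (simp add: divide_le_eq dot_square_norm power2_eq_square)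
    then show ?thesis
      by (simp add: matrix_vector_mult_diff_rdistrib scaleR_mult_vec inner_diff_right)
  qed
  then show thesis
    using b(1) assms by (intro that[of "1/b"]) (auto simp: psd_iff ctranspose_diff ctranspose_scaleR)
qed

text \<open>Let \<open>W\<close> be the Schur complement and \<open>W'\<close> its value after replacing \<open>(k, kt)\<close> by \<open>(l k, kt / l)\<close>.
  All terms of \<open>l W'\<close> dominate those of \<open>W\<close>, and the identity matrix grows by the factor \<open>l\<close>, so that
  \<open>l W' \<ge> W + (l - 1) mat 1 \<ge> (1 + (l - 1) m) W\<close> as soon as \<open>mat 1 \<ge> m W\<close>. The explicit gain is
  needed for the derivative in \<open>l\<close>, where mere strictness would be lost.\<close>

lemma schur_trace_scaling:
  assumes C: "psd C" and X: "psd X" and k: "0 \<le> k" and kt: "0 \<le> kt"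
  obtains m where "0 < m"
    "\<And>l. 1 \<le> l \<Longrightarrow> schur_trace C X B (l * k) (kt / l) \<le> l * schur_trace C X B k kt / (1 + (l - 1) * m)"
proof -
  let ?W = "schur_mat C X B k kt"
  have W: "pos_def ?W" using assms by (intro pos_def_schur_mat)
  obtain m where m: "0 < m" "psd (mat 1 - m *\<^sub>R ?W)"
    by (rule hermitian_le_mat[OF pos_def_hermitian[OF W]])
  have "schur_trace C X B (l * k) (kt / l) \<le> l * schur_trace C X B k kt / (1 + (l - 1) * m)"
    if l: "1 \<le> l" for l
  proof -
    let ?V = "schur_mat C X B (l * k) (kt / l)" and ?q = "1 + (l - 1) * m"
    have l0: "0 < l" using l by simp
    have q: "0 < ?q" using l m by (simp add: add_pos_nonneg)
    have V: "pos_def ?V" using assms l by (intro pos_def_schur_mat) auto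
    let ?Y = "(1 / l) *\<^sub>R mat 1 + k *\<^sub>R X"
    have Yl: "(1 / l) *\<^sub>R (mat 1 + (l * k) *\<^sub>R X) = ?Y" using l0 by (simp add: scaleR_add_right)
    have T: "pos_def (mat 1 + (l * k) *\<^sub>R X)" using l k X by (intro pos_def_shift) auto
    have Y: "pos_def ?Y" unfolding Yl[symmetric] using T l0 by (intro pos_def_scaleR) auto
    have inv_Y: "matrix_inv ?Y = l *\<^sub>R matrix_inv (mat 1 + (l * k) *\<^sub>R X)"
      unfolding Yl[symmetric] using l0 by (simp add: matrix_inv_scaleR pos_def_invertible T)
    have "psd (matrix_inv ?Y - matrix_inv (mat 1 + k *\<^sub>R X))"
    proof (rule psd_matrix_inv_diff[OF Y])
      have "mat 1 + k *\<^sub>R X - ?Y = (1 - 1 / l) *\<^sub>R mat 1" by (simp add: scaleR_diff_left)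
      then show "psd (mat 1 + k *\<^sub>R X - ?Y)" using l by (simp add: psd_scaleR pos_def_psd)
    qed (use X k in \<open>simp add: pos_def_shift\<close>)
    moreover have "l *\<^sub>R ?V - ?q *\<^sub>R ?W = B ** (matrix_inv ?Y - matrix_inv (mat 1 + k *\<^sub>R X)) ** B\<^sup>H
        + (l - 1) *\<^sub>R (mat 1 - m *\<^sub>R ?W)"
      unfolding inv_Y using l0
      by (simp add: schur_mat_def matrix_expand scaleR_add_right scaleR_diff_right scaleR_add_left
          scaleR_diff_left algebra_simps)
    ultimately have "psd (l *\<^sub>R ?V - ?q *\<^sub>R ?W)"
      using m l by (simp add: psd_add psd_congruence psd_scaleR)
    then have "re_trace (C ** matrix_inv (l *\<^sub>R ?V)) \<le> re_trace (C ** matrix_inv (?q *\<^sub>R ?W))"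
      using C W V l0 q by (intro re_trace_inv_mono pos_def_scaleR)
    then have "schur_trace C X B (l * k) (kt / l) / l \<le> schur_trace C X B k kt / ?q"
      using l0 q by (simp add: matrix_inv_scaleR pos_def_invertible W V matrix_expand
          re_trace_scaleR schur_trace_def)
    then show ?thesis using l0 by (simp add: divide_le_eq mult.commute)
  qed
  with m(1) show thesis by (rule that)
qed

lemma schur_trace_scaling_strict:
  assumes "psd C" "psd X" "0 \<le> k" "0 \<le> kt" "C \<noteq> 0" and l: "1 < l"
  shows "schur_trace C X B (l * k) (kt / l) < l * schur_trace C X B k kt"
proof -
  obtain m where m: "0 < m" "\<And>l. 1 \<le> l \<Longrightarrow>
      schur_trace C X B (l * k) (kt / l) \<le> l * schur_trace C X B k kt / (1 + (l - 1) * m)"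
    by (rule schur_trace_scaling[OF assms(1-4)]) (rule that)
  have p: "0 < l * schur_trace C X B k kt" using schur_trace_pos[OF assms(1-5)] l by simp
  have "1 < 1 + (l - 1) * m" using l m(1) by simp
  then have "l * schur_trace C X B k kt / (1 + (l - 1) * m) < l * schur_trace C X B k kt"
    using p by (simp add: divide_less_eq distrib_left)
  then show ?thesis using m(2)[of l] l by simp
qed

text \<open>Twice the same equation, by the symmetry between the two Schur complements.\<close>

definition fixed_point_pair :: "real \<Rightarrow> complex^'m^'m \<Rightarrow> complex^'n^'n \<Rightarrow> complex^'n^'m \<Rightarrow> real \<Rightarrow> real \<Rightarrow> bool" where
  "fixed_point_pair c C X B k kt \<longleftrightarrow>
    c * k = schur_trace C X B k kt \<and> c * kt = schur_trace X C (B\<^sup>H) kt k"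

text \<open>The coordinates \<open>k\<close> and \<open>1 / kt\<close> turn the equations into a fixed point of a monotone,
  strictly subhomogeneous map: let \<open>l\<close> be the least factor by which the first solution must be
  enlarged to dominate the second; strict subhomogeneity excludes \<open>l > 1\<close>.\<close>

lemma fixed_point_pair_le:
  assumes C: "psd C" "C \<noteq> 0" and X: "psd X" "X \<noteq> 0" and c: "0 < c"
    and 1: "fixed_point_pair c C X B k kt" "0 < k" "0 < kt"
    and 2: "fixed_point_pair c C X B k' kt'" "0 < k'" "0 < kt'"
  shows "k' \<le> k \<and> kt \<le> kt'"
proof (rule ccontr)
  assume neg: "\<not> (k' \<le> k \<and> kt \<le> kt')"
  define l where "l = max (k' / k) (kt / kt')"
  have l: "1 < l" using neg 1 2 by (auto simp: l_def less_max_iff_disj)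
  have k': "k' \<le> l * k"
    using max.cobounded1[of "k' / k" "kt / kt'"] 1(2) by (simp add: l_def[symmetric] divide_le_eq)
  have kt: "kt \<le> l * kt'"
    using max.cobounded2[of "kt / kt'" "k' / k"] 2(3) by (simp add: l_def[symmetric] divide_le_eq)
  consider "l = k' / k" | "l = kt / kt'" unfolding l_def max_def by metis
  then show False
  proof cases
    case 1
    have "c * k' = schur_trace C X B k' kt'" using 2 by (simp add: fixed_point_pair_def)
    also have "\<dots> \<le> schur_trace C X B (l * k) (kt / l)"
      using C X k' kt l assms(7,8,10,11) by (intro schur_trace_mono) (auto simp: divide_le_eq mult.commute)
    also have "\<dots> < l * schur_trace C X B k kt"
      using C X l assms(7,8) by (intro schur_trace_scaling_strict) auto
    also have "\<dots> = l * (c * k)" using assms(6) by (simp add: fixed_point_pair_def)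
    also have "\<dots> = c * k'" using 1 assms(7) by simp
    finally show False by simp
  next
    case 2
    have "c * kt = schur_trace X C (B\<^sup>H) kt k" using assms(6) by (simp add: fixed_point_pair_def)
    also have "\<dots> \<le> schur_trace X C (B\<^sup>H) (l * kt') (k' / l)"
      using C X k' kt l assms(7,8,10,11) by (intro schur_trace_mono) (auto simp: divide_le_eq mult.commute)
    also have "\<dots> < l * schur_trace X C (B\<^sup>H) kt' k'"
      using C X l assms(10,11) by (intro schur_trace_scaling_strict) auto
    also have "\<dots> = l * (c * kt')" using assms(9) by (simp add: fixed_point_pair_def)
    also have "\<dots> = c * kt" using 2 assms(11) by simp
    finally show False by simp
  qed
qed

lemma fixed_point_pair_unique:
  assumes "psd C" "C \<noteq> 0" "psd X" "X \<noteq> 0" "0 < c"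
    and "fixed_point_pair c C X B k kt" "0 < k" "0 < kt"
    and "fixed_point_pair c C X B k' kt'" "0 < k'" "0 < kt'"
  shows "k' = k \<and> kt' = kt"
  using fixed_point_pair_le[OF assms] fixed_point_pair_le[OF assms(1-5) assms(9-11) assms(6-8)]
  by (auto intro: antisym)

lemma fixed_point_pair_bounds:
  assumes "psd C" "C \<noteq> 0" "psd X" "X \<noteq> 0" "0 < c" "0 \<le> k" "0 \<le> kt"
    and "fixed_point_pair c C X B k kt"
  shows "0 < k" "0 < kt" "c * k \<le> re_trace C" "c * kt \<le> re_trace X"
proof -
  have "0 < c * k" "0 < c * kt"
    using assms schur_trace_pos[of C X k kt B] schur_trace_pos[of X C kt k "B\<^sup>H"]
    by (auto simp: fixed_point_pair_def)
  then show "0 < k" "0 < kt" using assms(5) by (simp_all add: zero_less_mult_iff)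
  show "c * k \<le> re_trace C" "c * kt \<le> re_trace X"
    using assms schur_trace_le[of C X k kt B] schur_trace_le[of X C kt k "B\<^sup>H"]
    by (auto simp: fixed_point_pair_def)
qed

lemma continuous_on_schur_trace:
  fixes f g :: "'a::t2_space \<Rightarrow> real"
  assumes "continuous_on S f" "continuous_on S g" "psd C" "psd X"
    "\<And>x. x \<in> S \<Longrightarrow> 0 \<le> f x" "\<And>x. x \<in> S \<Longrightarrow> 0 \<le> g x"
  shows "continuous_on S (\<lambda>x. schur_trace C X B (f x) (g x))"
proof -
  have "continuous_on S (\<lambda>x. schur_mat C X B (f x) (g x))"
    unfolding schur_mat_def
    by (intro continuous_intros continuous_on_matrix_mult continuous_on_matrix_inv assms
        pos_def_invertible pos_def_shift)
  then show ?thesis unfolding schur_trace_def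
    by (intro continuous_on_re_trace continuous_on_matrix_mult continuous_on_matrix_inv
        continuous_on_const pos_def_invertible pos_def_schur_mat assms)
qed

text \<open>Both traces are bounded, so the map sends a box into itself and Brouwer's theorem applies.\<close>

lemma fixed_point_pair_exists:
  assumes C: "psd C" "C \<noteq> 0" and X: "psd X" "X \<noteq> 0" and c: "0 < c"
  shows "\<exists>k kt. 0 < k \<and> 0 < kt \<and> fixed_point_pair c C X B k kt"
proof -
  define F where "F = (\<lambda>p. (schur_trace C X B (fst p) (snd p) / c, schur_trace X C (B\<^sup>H) (snd p) (fst p) / c))"
  let ?S = "{0..re_trace C / c} \<times> {0..re_trace X / c}"
  have "\<exists>p\<in>?S. F p = p"
  proof (rule brouwer)
    have "0 \<le> re_trace C / c" "0 \<le> re_trace X / c"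
      using C X c by (simp_all add: re_trace_psd_nonneg)
    then show "?S \<noteq> {}" by auto
    show "continuous_on ?S F"
      unfolding F_def using C X c
      by (intro continuous_intros continuous_on_schur_trace) auto
    show "F \<in> ?S \<rightarrow> ?S"
      using C X c by (auto simp: F_def divide_right_mono schur_trace_le schur_trace_nonneg)
  qed (auto intro: compact_Times convex_Times)
  then obtain p where p: "p \<in> ?S" "F p = p" by blast
  have "fixed_point_pair c C X B (fst p) (snd p)"
    using p(2) c unfolding F_def fixed_point_pair_def
    by (metis fst_conv snd_conv nonzero_mult_div_cancel_left times_divide_eq_right less_irrefl)
  then show ?thesis
    using fixed_point_pair_bounds[OF C X c, of "fst p" "snd p" B] p(1)
    by (intro exI[of _ "fst p"] exI[of _ "snd p"]) auto
qed

subsection \<open>Nondegeneracy of the fixed-point equations\<close>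

lemma nonpos_derivative_right:
  fixes g :: "real \<Rightarrow> real"
  assumes "(g has_real_derivative g') (at x)" "\<And>y. x < y \<Longrightarrow> g y \<le> g x"
  shows "g' \<le> 0"
proof (rule ccontr)
  assume "\<not> g' \<le> 0"
  then obtain d where d: "0 < d" "\<And>h. 0 < h \<Longrightarrow> h < d \<Longrightarrow> g x < g (x + h)"
    using DERIV_pos_inc_right[OF assms(1)] by auto
  then have "g x < g (x + d / 2)" by simp
  moreover have "g (x + d / 2) \<le> g x" using d(1) by (intro assms(2)) simp
  ultimately show False by simp
qed

text \<open>Infinitesimal versions of monotonicity and of the scaling estimate.\<close>

lemma schur_trace_derivative_signs:
  assumes C: "psd C" "C \<noteq> 0" and X: "psd X" and k: "0 < k" and kt: "0 < kt"
    and L: "((\<lambda>p. schur_trace C X B (fst p) (snd p)) has_derivative L) (at (k, kt))"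
  shows "0 \<le> L (1, 0)" "L (0, 1) \<le> 0" "L (k, - kt) < schur_trace C X B k kt"
proof -
  let ?F = "\<lambda>p. schur_trace C X B (fst p) (snd p)"
  have lin: "L (h *\<^sub>R p) = h * L p" for h p
    using has_derivative_linear[OF L] by (simp add: linear_cmul)
  have curve: "((\<lambda>s. ?F (\<gamma> s)) has_real_derivative L v) (at s0)"
    if "(\<gamma> has_vector_derivative v) (at s0)" "\<gamma> s0 = (k, kt)" for \<gamma> v s0
  proof -
    have "((\<lambda>s. ?F (\<gamma> s)) has_derivative (\<lambda>h. L (h *\<^sub>R v))) (at s0)"
      using has_derivative_compose[OF that(1)[unfolded has_vector_derivative_def], of ?F L] L that(2) by simp
    then show ?thesis by (simp add: has_field_derivative_def lin mult_commute_abs)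
  qed
  have "((\<lambda>s. ?F (k + s, kt)) has_real_derivative L (1, 0)) (at 0)"
    by (rule curve) (auto intro!: derivative_eq_intros simp: zero_prod_def)
  then have "((\<lambda>s. - ?F (k + s, kt)) has_real_derivative - L (1, 0)) (at 0)" by (rule DERIV_minus)
  then have "- L (1, 0) \<le> 0"
    by (rule nonpos_derivative_right) (use C X k kt in \<open>auto intro!: schur_trace_mono\<close>)
  then show "0 \<le> L (1, 0)" by simp
  have "((\<lambda>s. ?F (k, kt + s)) has_real_derivative L (0, 1)) (at 0)"
    by (rule curve) (auto intro!: derivative_eq_intros simp: zero_prod_def)
  then show "L (0, 1) \<le> 0"
    by (rule nonpos_derivative_right) (use C X k kt in \<open>auto intro!: schur_trace_mono\<close>)
  let ?T = "schur_trace C X B k kt"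
  obtain m where m: "0 < m" "\<And>l. 1 \<le> l \<Longrightarrow>
      schur_trace C X B (l * k) (kt / l) \<le> l * ?T / (1 + (l - 1) * m)"
    by (rule schur_trace_scaling[of C X k kt B]) (use C X k kt that in auto)
  have "((\<lambda>l. ?F (l * k, kt / l)) has_real_derivative L (k, - kt)) (at 1)"
    by (rule curve) (auto intro!: derivative_eq_intros simp: has_vector_derivative_def)
  moreover have "((\<lambda>l. l * ?T / (1 + (l - 1) * m)) has_real_derivative ?T * (1 - m)) (at 1)"
    by (auto intro!: derivative_eq_intros simp: algebra_simps)
  ultimately have "((\<lambda>l. ?F (l * k, kt / l) - l * ?T / (1 + (l - 1) * m)) has_real_derivative
      L (k, - kt) - ?T * (1 - m)) (at 1)"
    by (rule DERIV_diff)
  then have "L (k, - kt) - ?T * (1 - m) \<le> 0"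
    by (rule nonpos_derivative_right) (use m(2) in auto)
  moreover have "0 < ?T * m" using schur_trace_pos[of C X k kt B] C X k kt m(1) by simp
  ultimately show "L (k, - kt) < ?T" by (simp add: algebra_simps)
qed

text \<open>In the coordinates \<open>k\<close>, \<open>- kt\<close> the Jacobian of the right-hand sides has nonnegative entries
  and maps the positive vector \<open>(k, kt)\<close> strictly below \<open>c (k, kt)\<close>, so \<open>c\<close> is not an eigenvalue.\<close>

lemma fixed_point_pair_nondegenerate:
  assumes C: "psd C" "C \<noteq> 0" and X: "psd X" "X \<noteq> 0"
    and fp: "fixed_point_pair c C X B k kt" and k: "0 < k" and kt: "0 < kt"
    and L1: "((\<lambda>p. schur_trace C X B (fst p) (snd p)) has_derivative L1) (at (k, kt))"
    and L2: "((\<lambda>p. schur_trace X C (B\<^sup>H) (fst p) (snd p)) has_derivative L2) (at (kt, k))"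
    and 1: "c * h = L1 (h, ht)" and 2: "c * ht = L2 (ht, h)"
  shows "h = 0 \<and> ht = 0"
proof -
  have lin: "L (x, y) = x * L (1, 0) + y * L (0, 1)" if "linear L" for L :: "real \<times> real \<Rightarrow> real" and x y
  proof -
    have "L (x, y) = L (x *\<^sub>R (1, 0) + y *\<^sub>R (0, 1))" by simp
    also have "\<dots> = x * L (1, 0) + y * L (0, 1)"
      unfolding linear_add[OF that] linear_cmul[OF that] by simp
    finally show ?thesis .
  qed
  note lin1 = lin[OF has_derivative_linear[OF L1]] and lin2 = lin[OF has_derivative_linear[OF L2]]
  define \<alpha> \<beta> \<alpha>' \<beta>' where "\<alpha> = c - L1 (1, 0)" and "\<beta> = - L1 (0, 1)"
    and "\<alpha>' = c - L2 (1, 0)" and "\<beta>' = - L2 (0, 1)"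
  have "0 \<le> \<beta>" "0 \<le> \<beta>'"
    using schur_trace_derivative_signs(2)[OF C X(1) k kt L1]
      schur_trace_derivative_signs(2)[OF X C(1) kt k L2] by (simp_all add: \<beta>_def \<beta>'_def)
  have lt1: "\<beta> * kt < \<alpha> * k"
    using schur_trace_derivative_signs(3)[OF C X(1) k kt L1] fp lin1[of k "- kt"]
    by (simp add: fixed_point_pair_def \<alpha>_def \<beta>_def algebra_simps)
  have lt2: "\<beta>' * k < \<alpha>' * kt"
    using schur_trace_derivative_signs(3)[OF X C(1) kt k L2] fp lin2[of kt "- k"]
    by (simp add: fixed_point_pair_def \<alpha>'_def \<beta>'_def algebra_simps)
  have "(\<beta> * kt) * (\<beta>' * k) < (\<alpha> * k) * (\<alpha>' * kt)"
    by (rule mult_strict_mono'[OF lt1 lt2]) (use \<open>0 \<le> \<beta>\<close> \<open>0 \<le> \<beta>'\<close> k kt in auto)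
  then have "(\<beta> * \<beta>') * (k * kt) < (\<alpha> * \<alpha>') * (k * kt)" by (simp add: ac_simps)
  then have det: "\<beta> * \<beta>' < \<alpha> * \<alpha>'" using k kt by (simp add: mult_less_cancel_right)
  have e1: "\<alpha> * h = - \<beta> * ht" using 1 lin1[of h ht] by (simp add: \<alpha>_def \<beta>_def algebra_simps)
  have e2: "\<alpha>' * ht = - \<beta>' * h" using 2 lin2[of ht h] by (simp add: \<alpha>'_def \<beta>'_def algebra_simps)
  have "(\<alpha> * \<alpha>') * h = \<alpha>' * (\<alpha> * h)" by simp
  also have "\<dots> = - \<beta> * (\<alpha>' * ht)" unfolding e1 by simp
  also have "\<dots> = (\<beta> * \<beta>') * h" unfolding e2 by simp
  finally have "h = 0" using det by simp
  moreover have "\<alpha>' * ht = 0" using e2 \<open>h = 0\<close> by simp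
  moreover have "\<alpha>' \<noteq> 0" using det mult_nonneg_nonneg[OF \<open>0 \<le> \<beta>\<close> \<open>0 \<le> \<beta>'\<close>] by auto
  ultimately show ?thesis by simp
qed

text \<open>The expansion of \<open>F\<close> determines \<open>x p - x q\<close> up to an error small compared with
  \<open>norm (x p - x q) + norm (p - q)\<close>; the first part of the error is absorbed into the left-hand side.
  Only the expansion at one point is needed because \<open>x\<close> is already known to be continuous, and \<open>S\<close> may
  have empty interior.\<close>

lemma implicit_differentiable_within:
  fixes F :: "'e::euclidean_space \<times> 'q::real_normed_vector \<Rightarrow> 'e" and x :: "'q \<Rightarrow> 'e"
  assumes F: "(F has_derivative L) (at (x q, q))"
    and zero: "\<And>p. p \<in> S \<Longrightarrow> F (x p, p) = 0" and q: "q \<in> S"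
    and cont: "continuous (at q within S) x"
    and inj: "\<And>h. L (h, 0) = 0 \<Longrightarrow> h = 0"
  shows "x differentiable (at q within S)"
proof -
  note linL = has_derivative_linear[OF F] and bL = has_derivative_bounded_linear[OF F]
  have lin1: "linear (\<lambda>h. L (h, 0))"
    using linear_compose[OF _ linL, of "\<lambda>h. (h, 0)"] by (simp add: o_def linear_iff)
  have "inj (\<lambda>h. L (h, 0))" using inj lin1 by (simp add: linear_injective_0)
  then obtain N where N: "linear N" "\<And>h. N (L (h, 0)) = h"
    using linear_injective_left_inverse[OF lin1] by (auto simp: o_def fun_eq_iff)
  have bN: "bounded_linear N" using N(1) by (simp add: linear_conv_bounded_linear)
  have bq: "bounded_linear (\<lambda>v. - N (L (0, v)))"
    by (intro bounded_linear_minus bounded_linear_compose[OF bN] bounded_linear_compose[OF bL]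
        bounded_linear_Pair bounded_linear_zero bounded_linear_ident)
  obtain n where n: "0 < n" "\<And>v. norm (N v) \<le> norm v * n" using bounded_linear.pos_bounded[OF bN] by blast
  obtain b where b: "0 < b" "\<And>v. norm (- N (L (0, v))) \<le> norm v * b"
    using bounded_linear.pos_bounded[OF bq] by blast
  define R where "R p = x p - x q - (- N (L (0, p - q)))" for p
  have R: "norm (R p) \<le> n * norm (F (x p, p) - F (x q, q) - L ((x p, p) - (x q, q)))" if "p \<in> S" for p
  proof -
    have "L ((x p, p) - (x q, q)) = L (x p - x q, 0) + L (0, p - q)"
      by (simp add: linear_add[OF linL, symmetric])
    then have "N (L ((x p, p) - (x q, q))) = R p"
      by (simp add: R_def linear_add[OF N(1)] N(2))
    then have "norm (R p) \<le> norm (L ((x p, p) - (x q, q))) * n" using n(2) by metis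
    then show ?thesis using zero[OF that] zero[OF q] by (simp add: mult.commute)
  qed
  have small: "\<forall>\<^sub>F p in at q within S. norm (R p) \<le> e * norm (p - q)" if e: "0 < e" for e
  proof -
    \<comment> \<open>The first bound on \<open>e'\<close> absorbs half of \<open>R p\<close>, the second controls what remains.\<close>
    define e' where "e' = min (1 / (2 * n)) (e / (n * (2 * b + 2)))"
    have e': "0 < e'" "n * e' \<le> 1 / 2" "n * e' * (2 * b + 2) \<le> e"
    proof -
      show "0 < e'" using e n b by (simp add: e'_def)
      have "e' \<le> 1 / (2 * n)" by (simp add: e'_def)
      then show "n * e' \<le> 1 / 2" using n by (simp add: field_simps)
      have "e' \<le> e / (n * (2 * b + 2))" by (simp add: e'_def)
      then show "n * e' * (2 * b + 2) \<le> e" using n(1) b(1) pos_le_divide_eq[of "n * (2 * b + 2)" e' e] by (simp add: ac_simps)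
    qed
    obtain d where d: "0 < d" "\<And>y. norm (y - (x q, q)) < d \<Longrightarrow>
        norm (F y - F (x q, q) - L (y - (x q, q))) \<le> e' * norm (y - (x q, q))"
      using F e'(1) unfolding has_derivative_at_alt by blast
    have "((\<lambda>p. (x p, p)) \<longlongrightarrow> (x q, q)) (at q within S)"
      using cont by (intro tendsto_Pair tendsto_ident_at) (simp add: continuous_within)
    then have "\<forall>\<^sub>F p in at q within S. dist (x p, p) (x q, q) < d" using d(1) by (rule tendstoD)
    moreover have "\<forall>\<^sub>F p in at q within S. p \<in> S" by (simp add: eventually_at_filter)
    ultimately show ?thesis
    proof eventually_elim
      case (elim p)
      have "norm ((x p, p) - (x q, q)) \<le> norm (x p - x q) + norm (p - q)"
        using norm_Pair_le[of "x p - x q" "p - q"] by simp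
      also have "norm (x p - x q) \<le> norm (R p) + b * norm (p - q)"
        using norm_triangle_ineq[of "R p" "- N (L (0, p - q))"] b(2)[of "p - q"]
        by (simp add: R_def mult.commute)
      finally have 1: "norm ((x p, p) - (x q, q)) \<le> norm (R p) + (b + 1) * norm (p - q)"
        by (simp add: algebra_simps)
      have "norm (R p) \<le> n * (e' * norm ((x p, p) - (x q, q)))"
        using R[OF elim(2)] d(2)[of "(x p, p)"] elim(1) n(1)
        by (smt (verit) dist_norm mult_left_mono)
      also have "\<dots> \<le> n * e' * (norm (R p) + (b + 1) * norm (p - q))"
        using 1 n(1) e'(1) by (simp add: mult_left_mono mult.assoc)
      also have "\<dots> = n * e' * norm (R p) + n * e' * (b + 1) * norm (p - q)" by (simp add: algebra_simps)
      also have "n * e' * norm (R p) \<le> 1 / 2 * norm (R p)" using e'(2) by (rule mult_right_mono) simp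
      finally have "norm (R p) \<le> n * e' * (2 * b + 2) * norm (p - q)" by (simp add: algebra_simps)
      also have "\<dots> \<le> e * norm (p - q)" using e'(3) by (rule mult_right_mono) simp
      finally show ?case .
    qed
  qed
  have "(x has_derivative (\<lambda>v. - N (L (0, v)))) (at q within S)"
    unfolding has_derivative_iff_norm
  proof (intro conjI bq tendstoI)
    fix e :: real assume "0 < e"
    then have "\<forall>\<^sub>F p in at q within S. norm (R p) \<le> e / 2 * norm (p - q)" by (intro small) simp
    moreover have "\<forall>\<^sub>F p in at q within S. p \<noteq> q" by (simp add: eventually_at_filter)
    ultimately show "\<forall>\<^sub>F p in at q within S. dist (norm (x p - x q - - N (L (0, p - q))) / norm (p - q)) 0 < e"
    proof eventually_elim
      case (elim p)
      then have "norm (R p) / norm (p - q) \<le> e / 2" by (simp add: divide_le_eq)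
      also have "\<dots> < e" using \<open>0 < e\<close> by simp
      finally show ?case by (simp add: R_def)
    qed
  qed
  then show ?thesis unfolding differentiable_def by blast
qed

section \<open>Eliminating the square root of the input covariance\<close>

text \<open>Equal to \<open>S (mat 1 + S M S)\<inverse> S\<close> for the square root \<open>S\<close> of \<open>Q\<close>, but visibly smooth in \<open>Q\<close>.\<close>

definition reduced :: "complex^'t^'t \<Rightarrow> complex^'t^'t \<Rightarrow> complex^'t^'t" where
  "reduced Q M = matrix_inv (mat 1 + Q ** M) ** Q"

lemma invertible_shift_psd_mult:
  assumes Q: "psd Q" and M: "psd M"
  shows "invertible (mat 1 + Q ** M)"
proof (rule invertible_kerI)
  fix x assume "(mat 1 + Q ** M) *v x = 0"
  then have x: "x = - (Q *v (M *v x))"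
    by (simp add: matrix_vector_mult_add_rdistrib matrix_vector_mul_assoc eq_neg_iff_add_eq_0)
  have "x \<bullet> (M *v x) = - ((M *v x) \<bullet> (Q *v (M *v x)))"
    by (subst x) (simp add: inner_commute)
  then have "x \<bullet> (M *v x) = 0" using psd_inner[OF Q, of "M *v x"] psd_inner[OF M, of x] by simp
  then have "M *v x = 0" by (rule psd_inner_zero_imp[OF M])
  then show "x = 0" using x by simp
qed

lemma reduced_sqrt:
  assumes S: "psd S" and M: "psd M"
  shows "S ** matrix_inv (mat 1 + S ** M ** S) ** S = reduced (S ** S) M"
proof -
  have pd: "pos_def (mat 1 + S ** M ** S)"
    using S M by (intro pos_def_add_psd pos_def_mat psd_congruence_hermitian psd_hermitian)
  have SS: "psd (S ** S)" using psd_self_mult[of S] S by (simp add: psd_hermitian)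
  have "S ** matrix_inv (mat 1 + S ** M ** S) = matrix_inv (mat 1 + S ** S ** M) ** S"
    by (rule matrix_inv_intertwine)
      (use pd SS M in \<open>simp_all add: matrix_expand matrix_mul_assoc pos_def_invertible
        invertible_shift_psd_mult\<close>)
  then show ?thesis by (simp add: reduced_def matrix_mul_assoc[symmetric])
qed

text \<open>With \<open>E = (k D)\<inverse>\<close> this exhibits the parallel sum of \<open>Q\<close> and \<open>E\<close> through a single inverse, which makes
  its concavity in \<open>Q\<close> visible.\<close>

lemma reduced_scaleR_pos_def:
  assumes D: "pos_def D" and Q: "psd Q" and k: "0 < k"
  defines "E \<equiv> matrix_inv (k *\<^sub>R D)"
  shows "reduced Q (k *\<^sub>R D) = E - E ** matrix_inv (E + Q) ** E"
proof -
  have kD: "pos_def (k *\<^sub>R D)" using D k by (rule pos_def_scaleR)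
  note ikD = pos_def_invertible[OF kD]
  have E: "pos_def E" unfolding E_def using kD by (rule pos_def_matrix_inv)
  have EQ: "invertible (E + Q)" using E Q by (intro pos_def_invertible pos_def_add_psd)
  have "mat 1 + Q ** (k *\<^sub>R D) = (E + Q) ** (k *\<^sub>R D)"
    unfolding matrix_add_rdistrib_cplx E_def inv_left[OF ikD] ..
  then have "matrix_inv (mat 1 + Q ** (k *\<^sub>R D)) = E ** matrix_inv (E + Q)"
    using matrix_inv_mult[OF EQ ikD] by (simp add: E_def)
  then have "reduced Q (k *\<^sub>R D) = E ** matrix_inv (E + Q) ** ((E + Q) - E)"
    by (simp add: reduced_def)
  also have "\<dots> = E - E ** matrix_inv (E + Q) ** E"
    unfolding matrix_diff_ldistrib matrix_mul_assoc[symmetric] inv_left[OF EQ] by simp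
  finally show ?thesis .
qed

text \<open>The channel with all scalar factors absorbed: \<open>C\<close> and \<open>D\<close> are the correlation matrices at the
  receiver and at the transmitter, \<open>A\<close> is the line-of-sight component.\<close>

locale channel =
  fixes A :: "complex^'t^'r" and C :: "complex^'r^'r" and D :: "complex^'t^'t" and c :: real
  assumes C: "pos_def C" and D: "pos_def D" and c: "0 < c"
begin

lemma psd_C: "psd C" and psd_D: "psd D" and C_nonzero: "C \<noteq> 0"
proof -
  show "psd C" "psd D" using C D by (simp_all add: pos_def_psd)
  show "C \<noteq> 0" using C axis_eq_0_iff[of undefined "1::complex"] by (auto simp: pos_def_iff)
qed

definition rx :: "real \<Rightarrow> complex^'r^'r" where
  "rx kt = mat 1 + kt *\<^sub>R C"

text \<open>The matrix \<open>G\<close> of the waterfilling problem.\<close>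

definition gain :: "real \<Rightarrow> real \<Rightarrow> complex^'t^'t" where
  "gain k kt = k *\<^sub>R D + A\<^sup>H ** matrix_inv (rx kt) ** A"

text \<open>The right-hand sides of the two equations, written without the square root of \<open>Q\<close>.\<close>

definition rx_load :: "real \<Rightarrow> real \<Rightarrow> complex^'t^'t \<Rightarrow> real" where
  "rx_load k kt Q = re_trace (C ** matrix_inv (rx kt + A ** reduced Q (k *\<^sub>R D) ** A\<^sup>H))"

definition tx_load :: "real \<Rightarrow> real \<Rightarrow> complex^'t^'t \<Rightarrow> real" where
  "tx_load k kt Q = re_trace (D ** reduced Q (gain k kt))"

lemma pos_def_rx: "0 \<le> kt \<Longrightarrow> pos_def (rx kt)"
  unfolding rx_def by (rule pos_def_shift[OF psd_C])

lemma psd_gain: "0 \<le> k \<Longrightarrow> 0 \<le> kt \<Longrightarrow> psd (gain k kt)"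
  unfolding gain_def
  by (intro psd_add psd_scaleR psd_D psd_congruence' pos_def_psd pos_def_matrix_inv pos_def_rx)

lemma pos_def_gain: "0 < k \<Longrightarrow> 0 \<le> kt \<Longrightarrow> pos_def (gain k kt)"
  unfolding gain_def
  by (rule pos_def_add_psd[OF pos_def_scaleR[OF D]])
    (auto intro: psd_congruence' pos_def_psd pos_def_matrix_inv pos_def_rx)

context
  fixes Q S :: "complex^'t^'t"
  assumes S: "psd S" and Q: "S ** S = Q"
begin

lemma S_herm: "S\<^sup>H = S" using S by (rule psd_hermitian)

lemma psd_Q: "psd Q" using psd_self_mult[of S] by (simp add: S_herm Q)

lemma psd_SDS: "psd (S ** D ** S)"
  using psd_D S_herm by (rule psd_congruence_hermitian)

lemma re_trace_SDS: "re_trace (S ** D ** S) = re_trace (D ** Q)"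
  unfolding Q[symmetric] matrix_mul_assoc[symmetric]
  by (subst re_trace_mult_sym) (simp add: matrix_mul_assoc)

lemma SDS_nonzero: "Q \<noteq> 0 \<Longrightarrow> S ** D ** S \<noteq> 0"
  using re_trace_mult_pos[OF D psd_Q] re_trace_SDS by (metis less_irrefl re_trace_zero)

lemma schur_mat_sqrt:
  assumes "0 \<le> k"
  shows "schur_mat C (S ** D ** S) (A ** S) k kt = rx kt + A ** reduced Q (k *\<^sub>R D) ** A\<^sup>H"
  unfolding Q[symmetric] reduced_sqrt[OF S psd_scaleR[OF psd_D assms], symmetric]
  by (simp add: schur_mat_def rx_def ctranspose_mult S_herm matrix_expand matrix_mul_assoc)

lemma schur_mat_sqrt_gain:
  "schur_mat (S ** D ** S) C ((A ** S)\<^sup>H) kt k = mat 1 + S ** gain k kt ** S"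
  by (simp add: schur_mat_def gain_def rx_def ctranspose_mult S_herm matrix_expand matrix_mul_assoc)

lemma schur_trace_rx_load:
  "0 \<le> k \<Longrightarrow> schur_trace C (S ** D ** S) (A ** S) k kt = rx_load k kt Q"
  by (simp add: schur_trace_def schur_mat_sqrt rx_load_def)

lemma schur_trace_tx_load:
  assumes "0 \<le> k" "0 \<le> kt"
  shows "schur_trace (S ** D ** S) C ((A ** S)\<^sup>H) kt k = tx_load k kt Q"
proof -
  have "re_trace (S ** (D ** (S ** matrix_inv (mat 1 + S ** gain k kt ** S))))
      = re_trace ((D ** (S ** matrix_inv (mat 1 + S ** gain k kt ** S))) ** S)"
    by (rule re_trace_mult_sym)
  then show ?thesis
    unfolding schur_trace_def schur_mat_sqrt_gain tx_load_def Q[symmetric]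
      reduced_sqrt[OF S psd_gain[OF assms], symmetric]
    by (simp add: matrix_mul_assoc)
qed

lemma fixed_point_pair_iff_load:
  "0 \<le> k \<Longrightarrow> 0 \<le> kt \<Longrightarrow> fixed_point_pair c C (S ** D ** S) (A ** S) k kt
    \<longleftrightarrow> c * k = rx_load k kt Q \<and> c * kt = tx_load k kt Q"
  by (simp add: fixed_point_pair_def schur_trace_rx_load schur_trace_tx_load)

end

text \<open>Defined with the square root, in the form of the given system; the characterization by \<open>rx_load\<close>
  and \<open>tx_load\<close> follows.\<close>

definition sol :: "complex^'t^'t \<Rightarrow> real \<times> real" where
  "sol Q = (THE p. 0 < fst p \<and> 0 < snd p \<and>
    fixed_point_pair c C (psd_sqrt Q ** D ** psd_sqrt Q) (A ** psd_sqrt Q) (fst p) (snd p))"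

context
  fixes Q :: "complex^'t^'t"
  assumes Q: "psd Q" "Q \<noteq> 0"
begin

lemmas sqrt_facts = psd_psd_sqrt[OF Q(1)] psd_sqrt_mult_self[OF Q(1)]

lemma sol_ex1: "\<exists>!p. 0 < fst p \<and> 0 < snd p \<and>
    fixed_point_pair c C (psd_sqrt Q ** D ** psd_sqrt Q) (A ** psd_sqrt Q) (fst p) (snd p)"
proof (rule ex_ex1I)
  note * = psd_C C_nonzero psd_SDS[OF sqrt_facts] SDS_nonzero[OF sqrt_facts Q(2)] c
  obtain k kt where "0 < k" "0 < kt"
      "fixed_point_pair c C (psd_sqrt Q ** D ** psd_sqrt Q) (A ** psd_sqrt Q) k kt"
    using fixed_point_pair_exists[OF *, where B = "A ** psd_sqrt Q"] by blast
  then show "\<exists>p. 0 < fst p \<and> 0 < snd p \<and>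
    fixed_point_pair c C (psd_sqrt Q ** D ** psd_sqrt Q) (A ** psd_sqrt Q) (fst p) (snd p)"
    by (intro exI[of _ "(k, kt)"]) simp
  fix p p' assume
    "0 < fst p \<and> 0 < snd p \<and>
      fixed_point_pair c C (psd_sqrt Q ** D ** psd_sqrt Q) (A ** psd_sqrt Q) (fst p) (snd p)"
    "0 < fst p' \<and> 0 < snd p' \<and>
      fixed_point_pair c C (psd_sqrt Q ** D ** psd_sqrt Q) (A ** psd_sqrt Q) (fst p') (snd p')"
  then have "fst p' = fst p \<and> snd p' = snd p"
    by (intro fixed_point_pair_unique[OF *, where B = "A ** psd_sqrt Q"]) auto
  then show "p = p'" by (simp add: prod_eq_iff)
qed

lemma sol_fixed_point:
  shows sol_pos1: "0 < fst (sol Q)" and sol_pos2: "0 < snd (sol Q)"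
    and sol_pair: "fixed_point_pair c C (psd_sqrt Q ** D ** psd_sqrt Q) (A ** psd_sqrt Q) (fst (sol Q)) (snd (sol Q))"
  using theI'[OF sol_ex1] unfolding sol_def[symmetric] by auto

lemma sol_load:
  "c * fst (sol Q) = rx_load (fst (sol Q)) (snd (sol Q)) Q"
  "c * snd (sol Q) = tx_load (fst (sol Q)) (snd (sol Q)) Q"
  using sol_pair fixed_point_pair_iff_load[OF sqrt_facts, of "fst (sol Q)" "snd (sol Q)"] sol_pos1 sol_pos2
  by auto

lemma sol_eqI:
  assumes "0 \<le> k" "0 \<le> kt" "c * k = rx_load k kt Q" "c * kt = tx_load k kt Q"
  shows "sol Q = (k, kt)"
proof -
  have fp: "fixed_point_pair c C (psd_sqrt Q ** D ** psd_sqrt Q) (A ** psd_sqrt Q) k kt"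
    using assms fixed_point_pair_iff_load[OF sqrt_facts] by blast
  have pos: "0 < k" "0 < kt"
    using fixed_point_pair_bounds[OF psd_C C_nonzero psd_SDS[OF sqrt_facts]
        SDS_nonzero[OF sqrt_facts Q(2)] c assms(1,2) fp] by auto
  show ?thesis using sol_ex1 fp pos sol_pos1 sol_pos2 sol_pair
    by (metis fst_conv snd_conv)
qed

lemma sol_bounds: "c * fst (sol Q) \<le> re_trace C" "c * snd (sol Q) \<le> re_trace (D ** Q)"
  using fixed_point_pair_bounds(3,4)[OF psd_C C_nonzero psd_SDS[OF sqrt_facts]
        SDS_nonzero[OF sqrt_facts Q(2)] c _ _ sol_pair] sol_pos1 sol_pos2 re_trace_SDS[OF sqrt_facts]
  by auto

end

subsection \<open>Differentiability of the solution\<close>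

definition defect :: "(real \<times> real) \<times> (complex^'t^'t) \<Rightarrow> real \<times> real" where
  "defect z = (c * fst (fst z) - rx_load (fst (fst z)) (snd (fst z)) (snd z),
    c * snd (fst z) - tx_load (fst (fst z)) (snd (fst z)) (snd z))"

lemma differentiable_defect:
  assumes "0 \<le> k" "0 \<le> kt" "psd Q"
  shows "defect differentiable (at ((k, kt), Q) within T)"
proof -
  have [simp]: "(\<lambda>z. fst (fst z)) differentiable (at x within T)"
    "(\<lambda>z. snd (fst z)) differentiable (at x within T)" "snd differentiable (at x within T)"
    for x :: "(real \<times> real) \<times> (complex^'t^'t)"
    by (intro bounded_linear_imp_differentiable bounded_linear_fst_comp bounded_linear_snd_comp
        bounded_linear_fst bounded_linear_snd)+
  have "invertible (mat 1 + Q ** (k *\<^sub>R D))" "invertible (mat 1 + Q ** gain k kt)" "invertible (rx kt)"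
    using assms by (auto intro: invertible_shift_psd_mult psd_scaleR psd_D psd_gain pos_def_rx pos_def_invertible)
  moreover have "invertible (rx kt + A ** reduced Q (k *\<^sub>R D) ** A\<^sup>H)"
    using pos_def_schur_mat[OF psd_C psd_SDS[OF psd_psd_sqrt[OF assms(3)] psd_sqrt_mult_self[OF assms(3)]] assms(1,2)]
      schur_mat_sqrt[OF psd_psd_sqrt[OF assms(3)] psd_sqrt_mult_self[OF assms(3)] assms(1)]
    by (metis pos_def_invertible)
  ultimately show ?thesis
    unfolding defect_def[abs_def] rx_load_def tx_load_def gain_def rx_def reduced_def
    by (intro differentiable_Pair differentiable_diff differentiable_mult differentiable_add
        differentiable_scaleR differentiable_const differentiable_re_trace differentiable_matrix_mult
        differentiable_matrix_inv) simp_all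
qed

lemma defect_sol: "psd Q \<Longrightarrow> Q \<noteq> 0 \<Longrightarrow> defect (sol Q, Q) = 0"
  by (simp add: defect_def sol_load[symmetric] zero_prod_def)

text \<open>Near the solution both coordinates are positive, so the partial derivatives of \<open>defect\<close> are those of
  the two Schur traces and the nondegeneracy of the fixed-point equations applies.\<close>

lemma defect_partial_injective:
  assumes Q: "psd Q" "Q \<noteq> 0" and L: "(defect has_derivative L) (at (sol Q, Q))"
    and h: "L (h, 0) = 0"
  shows "h = 0"
proof -
  note sq = psd_psd_sqrt[OF Q(1)] psd_sqrt_mult_self[OF Q(1)]
  let ?S = "psd_sqrt Q"
  let ?X = "?S ** D ** ?S" and ?B = "A ** ?S"
  note pos = sol_pos1[OF Q] sol_pos2[OF Q]
  let ?O = "{0<..} \<times> {0<..} :: (real \<times> real) set"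
  have op: "open ?O" by (intro open_Times) auto
  have d: "((\<lambda>p. defect (p, Q)) has_derivative (\<lambda>v. L (v, 0))) (at (sol Q))"
    using has_derivative_compose[of "\<lambda>p. (p, Q)" "\<lambda>v. (v, 0)" "sol Q" UNIV defect L] L
      has_derivative_Pair[OF has_derivative_ident has_derivative_const] by blast
  have "((\<lambda>p. c * fst p - fst (defect (p, Q))) has_derivative (\<lambda>v. c * fst v - fst (L (v, 0)))) (at (sol Q))"
    by (rule derivative_eq_intros d | simp)+
  then have L1: "((\<lambda>p. schur_trace C ?X ?B (fst p) (snd p)) has_derivative (\<lambda>v. c * fst v - fst (L (v, 0))))
      (at (fst (sol Q), snd (sol Q)))"
    unfolding prod.collapse
    by (rule has_derivative_transform_within_open[OF _ op])
      (use pos in \<open>auto simp: mem_Times_iff defect_def schur_trace_rx_load[OF sq]\<close>)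
  have d': "((\<lambda>p. defect ((snd p, fst p), Q)) has_derivative (\<lambda>v. L ((snd v, fst v), 0))) (at (snd (sol Q), fst (sol Q)))"
    using has_derivative_compose[of "\<lambda>p. (snd p, fst p)" "\<lambda>v. (snd v, fst v)" "(snd (sol Q), fst (sol Q))" UNIV "\<lambda>p. defect (p, Q)" "\<lambda>v. L (v, 0)"] d
      bounded_linear_imp_has_derivative[OF bounded_linear_Pair[OF bounded_linear_snd bounded_linear_fst]]
    unfolding fst_conv snd_conv prod.collapse by blast
  have "((\<lambda>p. c * fst p - snd (defect ((snd p, fst p), Q))) has_derivative (\<lambda>v. c * fst v - snd (L ((snd v, fst v), 0)))) (at (snd (sol Q), fst (sol Q)))"
    by (rule derivative_eq_intros d' | simp)+
  then have L2: "((\<lambda>p. schur_trace ?X C (?B\<^sup>H) (fst p) (snd p)) has_derivative (\<lambda>v. c * fst v - snd (L ((snd v, fst v), 0))))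
      (at (snd (sol Q), fst (sol Q)))"
    by (rule has_derivative_transform_within_open[OF _ op])
      (use pos in \<open>auto simp: mem_Times_iff defect_def schur_trace_tx_load[OF sq]\<close>)
  have "fst h = 0 \<and> snd h = 0"
    by (rule fixed_point_pair_nondegenerate[OF psd_C C_nonzero psd_SDS[OF sq] SDS_nonzero[OF sq Q(2)]
        sol_pair[OF Q] pos L1 L2]) (use h in simp_all)
  then show ?thesis by (simp add: prod_eq_iff)
qed

end

section \<open>The rate function: saddle structure and concavity\<close>

lemma woodbury:
  fixes U :: "complex^'r^'r" and T :: "complex^'t^'t" and B :: "complex^'t^'r"
  assumes U: "pos_def U" and T: "pos_def T"
  shows "matrix_inv (U + B ** matrix_inv T ** B\<^sup>H) = matrix_inv U
    - matrix_inv U ** B ** matrix_inv (T + B\<^sup>H ** matrix_inv U ** B) ** B\<^sup>H ** matrix_inv U"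
proof (rule matrix_inv_eqI)
  let ?W = "U + B ** matrix_inv T ** B\<^sup>H" and ?Z = "T + B\<^sup>H ** matrix_inv U ** B"
  have W: "pos_def ?W" and Z: "pos_def ?Z"
    using U T by (auto intro!: pos_def_add_psd psd_congruence psd_congruence' pos_def_psd[OF pos_def_matrix_inv])
  note iU = pos_def_invertible[OF U] and iT = pos_def_invertible[OF T]
  have "(matrix_inv U ** B) ** matrix_inv ?Z = matrix_inv ?W ** (B ** matrix_inv T)"
  proof (rule matrix_inv_intertwine)
    show "?W ** (matrix_inv U ** B) = (B ** matrix_inv T) ** ?Z"
      by (simp add: matrix_expand matrix_mul_assoc[symmetric] inv_right_assoc inv_left iU iT)
  qed (use W Z in \<open>auto intro: pos_def_invertible\<close>)
  then have "?W ** (matrix_inv U ** B ** matrix_inv ?Z) = B ** matrix_inv T"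
    using W by (simp add: inv_right_assoc pos_def_invertible)
  then have "?W ** (matrix_inv U ** B ** matrix_inv ?Z ** B\<^sup>H ** matrix_inv U)
      = B ** matrix_inv T ** B\<^sup>H ** matrix_inv U"
    by (simp only: matrix_mul_assoc)
  then have "?W ** (matrix_inv U - matrix_inv U ** B ** matrix_inv ?Z ** B\<^sup>H ** matrix_inv U)
      = ?W ** matrix_inv U - B ** matrix_inv T ** B\<^sup>H ** matrix_inv U"
    by (simp only: matrix_diff_ldistrib)
  also have "\<dots> = mat 1" by (simp add: matrix_add_rdistrib_cplx inv_right iU)
  finally show "?W ** (matrix_inv U - matrix_inv U ** B ** matrix_inv ?Z ** B\<^sup>H ** matrix_inv U) = mat 1" .
qed

text \<open>Sylvester's identity with \<open>U = M\<inverse>\<close> and \<open>T = mat 1\<close>. The right-hand side depends on \<open>S\<close> only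
  through its square.\<close>

lemma log_det_sqrt_shift:
  assumes S: "psd S" and M: "pos_def M"
  shows "log_det (mat 1 + S ** M ** S) = log_det M + log_det (matrix_inv M + S ** S)"
  using log_det_sylvester[OF pos_def_matrix_inv[OF M] pos_def_mat, of S] S M
  by (simp add: psd_hermitian matrix_inv_matrix_inv pos_def_invertible log_det_matrix_inv)

lemma has_vector_derivative_matrix_inv:
  fixes f :: "real \<Rightarrow> complex^'n^'n"
  assumes "(f has_vector_derivative f') (at x)" "invertible (f x)"
  shows "((\<lambda>x. matrix_inv (f x)) has_vector_derivative
    - (matrix_inv (f x) ** f' ** matrix_inv (f x))) (at x)"
  using has_derivative_compose[OF assms(1)[unfolded has_vector_derivative_def]
      has_derivative_matrix_inv[OF assms(2)]]
  by (simp add: has_vector_derivative_def matrix_expand)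

lemma has_vector_derivative_matrix_mult:
  fixes f :: "real \<Rightarrow> complex^'n^'m"
  assumes "(f has_vector_derivative f') (at x)"
  shows "((\<lambda>x. M ** f x ** N) has_vector_derivative M ** f' ** N) (at x)"
proof -
  have "bounded_linear (\<lambda>X. M ** X ** N)"
    by (intro linear_conv_bounded_linear[THEN iffD1] linearI) (simp_all add: matrix_expand)
  then show ?thesis using assms by (rule bounded_linear.has_vector_derivative)
qed

context channel
begin

text \<open>The function \<open>V\<close> of the normalized channel.\<close>

definition rate :: "real \<Rightarrow> real \<Rightarrow> complex^'t^'t \<Rightarrow> real" where
  "rate k kt Q = log_det (mat 1 + psd_sqrt Q ** gain k kt ** psd_sqrt Q) + log_det (rx kt) - c * k * kt"

lemma log_det_sqrt_gain:
  assumes "psd Q" "0 < k" "0 \<le> kt"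
  shows "log_det (mat 1 + psd_sqrt Q ** gain k kt ** psd_sqrt Q)
    = log_det (gain k kt) + log_det (matrix_inv (gain k kt) + Q)"
  using log_det_sqrt_shift[OF psd_psd_sqrt[OF assms(1)] pos_def_gain[OF assms(2,3)]]
  by (simp add: psd_sqrt_mult_self assms(1))

lemma log_det_mult_gain:
  assumes "psd Q" "0 < k" "0 \<le> kt"
  shows "log_det (mat 1 + Q ** gain k kt) = log_det (mat 1 + psd_sqrt Q ** gain k kt ** psd_sqrt Q)"
proof -
  note G = pos_def_gain[OF assms(2,3)]
  have "mat 1 + Q ** gain k kt = (matrix_inv (gain k kt) + Q) ** gain k kt"
    by (simp add: matrix_add_rdistrib_cplx inv_left pos_def_invertible G)
  then show ?thesis
    using log_det_mult[OF pos_def_add_psd[OF pos_def_matrix_inv[OF G] assms(1)] G]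
    by (simp add: log_det_sqrt_gain assms)
qed

subsection \<open>The rate along hyperbolas\<close>

text \<open>The matrix \<open>Z\<close> below is the argument of the first log-determinant of the rate; the Woodbury identity
  recognizes the derivative of the inner inverse as the first load. Along the hyperbola \<open>(l k, kt / l)\<close> the bilinear term of the rate is constant and the
  derivative in \<open>l\<close> is \<open>k\<close> times the second load minus \<open>kt / l\<^sup>2\<close> times the first.\<close>

lemma rate_hyperbola_derivative:
  assumes Q: "psd Q" and k: "0 < k" and kt: "0 < kt" and l: "0 < l"
  shows "((\<lambda>l. rate (l * k) (kt / l) Q) has_real_derivative
    k * tx_load (l * k) (kt / l) Q - kt / l\<^sup>2 * rx_load (l * k) (kt / l) Q) (at l)"
proof -
  note sq = psd_psd_sqrt[OF Q] psd_sqrt_mult_self[OF Q]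
  define S where "S = psd_sqrt Q"
  note sq = sq[folded S_def]
  have hS: "S\<^sup>H = S" using sq(1) by (rule psd_hermitian)
  define B where "B = A ** S"
  have BH: "B\<^sup>H = S ** A\<^sup>H" by (simp add: B_def ctranspose_mult hS)
  define X where "X = S ** D ** S"
  define U where "U l = rx (kt / l)" for l
  define Z where "Z l = mat 1 + (l * k) *\<^sub>R X + B\<^sup>H ** matrix_inv (U l) ** B" for l
  have U: "pos_def (U l)" if "0 < l" for l using that kt by (simp add: U_def pos_def_rx)
  have Z_eq: "mat 1 + S ** gain (l * k) (kt / l) ** S = Z l" for l
    by (simp add: Z_def gain_def BH U_def X_def) (simp add: B_def matrix_expand matrix_mul_assoc)
  have Z: "pos_def (Z l)" if "0 < l" for l
    unfolding Z_eq[symmetric] using that k kt sq hS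
    by (intro pos_def_add_psd pos_def_mat psd_congruence_hermitian psd_gain) auto
  define U' where "U' = - (kt / l\<^sup>2) *\<^sub>R C"
  define Z' where "Z' = k *\<^sub>R X - B\<^sup>H ** (matrix_inv (U l) ** U' ** matrix_inv (U l)) ** B"
  have dU: "(U has_vector_derivative U') (at l)"
    unfolding U_def[abs_def] rx_def U'_def using l
    by (auto intro!: derivative_eq_intros simp: has_vector_derivative_def power2_eq_square)
  have dZ: "(Z has_vector_derivative Z') (at l)"
  proof -
    have "((\<lambda>l. B\<^sup>H ** matrix_inv (U l) ** B) has_vector_derivative
        B\<^sup>H ** - (matrix_inv (U l) ** U' ** matrix_inv (U l)) ** B) (at l)"
      by (intro has_vector_derivative_matrix_mult has_vector_derivative_matrix_inv dU
          pos_def_invertible U l)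
    moreover have "((\<lambda>l. mat 1 + (l * k) *\<^sub>R X) has_vector_derivative k *\<^sub>R X) (at l)"
      by (auto intro!: derivative_eq_intros simp: has_vector_derivative_def)
    ultimately have "(Z has_vector_derivative k *\<^sub>R X + B\<^sup>H ** - (matrix_inv (U l) ** U' ** matrix_inv (U l)) ** B) (at l)"
      unfolding Z_def[abs_def] by (rule has_vector_derivative_add[rotated])
    moreover have "M ** - N ** R = - (M ** N ** R)" for M :: "complex^'r^'t" and N :: "complex^'r^'r" and R :: "complex^'t^'r"
      using matrix_diff_ldistrib[of M 0 N] matrix_diff_rdistrib[of 0 "M ** N" R] by simp
    ultimately show ?thesis by (simp add: Z'_def)
  qed
  let ?P = "{0<..} :: real set"
  have at: "at l within ?P = at l" by (rule at_within_open) (use l in auto)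
  have "((\<lambda>l. log_det (Z l)) has_real_derivative re_trace (matrix_inv (Z l) ** Z')) (at l within ?P)"
    using dZ l Z by (intro has_real_derivative_log_det) (auto simp: at)
  moreover have "((\<lambda>l. log_det (U l)) has_real_derivative re_trace (matrix_inv (U l) ** U')) (at l within ?P)"
    using dU l U by (intro has_real_derivative_log_det) (auto simp: at)
  ultimately have d: "((\<lambda>l. log_det (Z l) + log_det (U l) - c * k * kt) has_real_derivative
      re_trace (matrix_inv (Z l) ** Z') + re_trace (matrix_inv (U l) ** U')) (at l)"
    unfolding at by (auto intro!: derivative_eq_intros)
  have kl: "0 \<le> l * k" "0 \<le> kt / l" using l k kt by simp_all
  have l2: "tx_load (l * k) (kt / l) Q = re_trace (matrix_inv (Z l) ** X)"
    unfolding schur_trace_tx_load[OF sq kl, symmetric] schur_trace_def schur_mat_sqrt_gain[OF sq]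
      Z_eq X_def by (rule re_trace_mult_sym)
  have "psd X" unfolding X_def by (rule psd_SDS[OF sq])
  have W: "schur_mat C X B (l * k) (kt / l) = U l + B ** matrix_inv (mat 1 + (l * k) *\<^sub>R X) ** B\<^sup>H"
    by (simp add: schur_mat_def U_def rx_def)
  let ?I = "matrix_inv (U l)"
  have l1: "rx_load (l * k) (kt / l) Q = re_trace (?I ** C)
      - re_trace (matrix_inv (Z l) ** (B\<^sup>H ** (?I ** C ** ?I) ** B))"
  proof -
    have "rx_load (l * k) (kt / l) Q = re_trace (C ** (?I - ?I ** B ** matrix_inv (Z l) ** B\<^sup>H ** ?I))"
      unfolding schur_trace_rx_load[OF sq kl(1), symmetric] schur_trace_def X_def[symmetric] B_def[symmetric]
        W woodbury[OF U[OF l] pos_def_shift[OF \<open>psd X\<close> kl(1)]] Z_def ..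
    also have "\<dots> = re_trace (C ** ?I) - re_trace ((C ** ?I ** B) ** (matrix_inv (Z l) ** B\<^sup>H ** ?I))"
      by (simp add: matrix_diff_ldistrib re_trace_diff matrix_mul_assoc)
    also have "re_trace ((C ** ?I ** B) ** (matrix_inv (Z l) ** B\<^sup>H ** ?I))
        = re_trace ((matrix_inv (Z l) ** B\<^sup>H ** ?I) ** (C ** ?I ** B))" by (rule re_trace_mult_sym)
    also have "re_trace (C ** ?I) = re_trace (?I ** C)" by (rule re_trace_mult_sym)
    finally show ?thesis by (simp add: matrix_mul_assoc)
  qed
  have "re_trace (matrix_inv (Z l) ** Z') + re_trace (?I ** U')
      = k * tx_load (l * k) (kt / l) Q - kt / l\<^sup>2 * rx_load (l * k) (kt / l) Q"
    unfolding l1 l2 Z'_def U'_def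
    by (simp add: matrix_expand re_trace_diff re_trace_add re_trace_scaleR algebra_simps
        del: scaleR_minus_left)
  then show ?thesis
    using d unfolding rate_def S_def[symmetric] Z_eq U_def[symmetric] using l
    by (auto elim!: has_field_derivative_transform_within_open[where S = "{0<..}"])
qed

text \<open>By scaling, the derivative along the hyperbola is positive beyond the solution and negative
  before it: a solution of the fixed-point equations minimizes the rate on its hyperbola.\<close>

lemma rate_sol_le_hyperbola:
  assumes Q: "psd Q" "Q \<noteq> 0" and l: "0 < l"
  shows "rate (fst (sol Q)) (snd (sol Q)) Q \<le> rate (l * fst (sol Q)) (snd (sol Q) / l) Q"
proof -
  note sq = psd_psd_sqrt[OF Q(1)] psd_sqrt_mult_self[OF Q(1)]
  let ?k = "fst (sol Q)" and ?kt = "snd (sol Q)"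
  note k = sol_pos1[OF Q] and kt = sol_pos2[OF Q]
  note scal1 = schur_trace_scaling_strict[OF psd_C psd_SDS[OF sq] _ _ C_nonzero, where B = "A ** psd_sqrt Q"]
  note scal2 = schur_trace_scaling_strict[OF psd_SDS[OF sq] psd_C _ _ SDS_nonzero[OF sq Q(2)], where B = "(A ** psd_sqrt Q)\<^sup>H"]
  have s1: "rx_load (m * a) (b / m) Q < m * rx_load a b Q" if "0 \<le> a" "0 \<le> b" "1 < m" for a b m
    using scal1[of a b m] that by (simp add: schur_trace_rx_load[OF sq])
  have s2: "tx_load (b / m) (m * a) Q < m * tx_load b a Q" if "0 \<le> a" "0 \<le> b" "1 < m" for a b m
    using scal2[of a b m] that by (simp add: schur_trace_tx_load[OF sq])
  define h where "h l = rate (l * ?k) (?kt / l) Q" for l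
  define h' where "h' l = ?k * tx_load (l * ?k) (?kt / l) Q - ?kt / l\<^sup>2 * rx_load (l * ?k) (?kt / l) Q" for l
  have d: "(h has_real_derivative h' l) (at l)" if "0 < l" for l
    unfolding h_def[abs_def] h'_def using rate_hyperbola_derivative[OF Q(1) k kt that] .
  have pos: "0 \<le> h' m" if m: "1 \<le> m" for m
  proof (cases "m = 1")
    case True
    then show ?thesis using sol_load[OF Q] by (simp add: h'_def) (simp add: sol_load[OF Q, symmetric])
  next
    case False
    then have m: "1 < m" using m by simp
    have "rx_load (m * ?k) (?kt / m) Q \<le> m * (c * ?k)"
      using s1[of ?k ?kt m] k kt m sol_load[OF Q] by simp
    then have "?kt / m\<^sup>2 * rx_load (m * ?k) (?kt / m) Q \<le> ?kt / m\<^sup>2 * (m * (c * ?k))"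
      using kt by (intro mult_left_mono) auto
    also have "\<dots> = ?k * (c * ?kt / m)" using m by (simp add: power2_eq_square)
    also have "\<dots> \<le> ?k * tx_load (m * ?k) (?kt / m) Q"
    proof (rule mult_left_mono)
      have "tx_load (m * ?k / m) (m * (?kt / m)) Q < m * tx_load (m * ?k) (?kt / m) Q"
        using k kt m by (intro s2) auto
      then have "c * ?kt < m * tx_load (m * ?k) (?kt / m) Q" using m by (simp add: sol_load[OF Q])
      then show "c * ?kt / m \<le> tx_load (m * ?k) (?kt / m) Q" using m by (simp add: divide_le_eq mult.commute)
    qed (use k in simp)
    finally show ?thesis by (simp add: h'_def)
  qed
  have neg: "h' m \<le> 0" if m: "0 < m" "m \<le> 1" for m
  proof (cases "m = 1")
    case True
    then show ?thesis using sol_load[OF Q] by (simp add: h'_def) (simp add: sol_load[OF Q, symmetric])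
  next
    case False
    then have m: "0 < m" "1 < 1 / m" using m by (simp_all add: less_divide_eq)
    have "tx_load (m * ?k) (?kt / m) Q \<le> c * ?kt / m"
      using s2[of ?kt ?k "1 / m"] k kt m sol_load[OF Q] by (simp add: mult.commute)
    then have "?k * tx_load (m * ?k) (?kt / m) Q \<le> ?k * (c * ?kt / m)"
      using k by (intro mult_left_mono) auto
    also have "\<dots> = ?kt / m\<^sup>2 * (m * (c * ?k))" using m by (simp add: power2_eq_square)
    also have "\<dots> \<le> ?kt / m\<^sup>2 * rx_load (m * ?k) (?kt / m) Q"
    proof (rule mult_left_mono)
      have "rx_load ((1 / m) * (m * ?k)) ((?kt / m) / (1 / m)) Q < (1 / m) * rx_load (m * ?k) (?kt / m) Q"
        using k kt m by (intro s1) auto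
      then have "c * ?k < rx_load (m * ?k) (?kt / m) Q / m" using m by (simp add: sol_load[OF Q])
      then show "m * (c * ?k) \<le> rx_load (m * ?k) (?kt / m) Q" using m by (simp add: less_divide_eq mult.commute)
    qed (use kt in simp)
    finally show ?thesis by (simp add: h'_def)
  qed
  have "h 1 \<le> h l"
  proof (cases "1 \<le> l")
    case True
    then show ?thesis
    proof (rule DERIV_nonneg_imp_nondecreasing)
      fix x :: real assume "1 \<le> x"
      then show "\<exists>y. (h has_real_derivative y) (at x) \<and> 0 \<le> y"
        using d[of x] pos[of x] by (intro exI[of _ "h' x"]) simp
    qed
  next
    case False
    then have "l \<le> 1" by simp
    then show ?thesis
    proof (rule DERIV_nonpos_imp_nonincreasing)
      fix x assume "l \<le> x" "x \<le> 1"
      then show "\<exists>y. (h has_real_derivative y) (at x) \<and> y \<le> 0"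
        using d[of x] neg[of x] l by (intro exI[of _ "h' x"]) simp
    qed
  qed
  then show ?thesis by (simp add: h_def)
qed

subsection \<open>Joint concavity in the input covariance and the second variable\<close>

text \<open>Notation for the form of the rate in which its concavity can be read off; \<open>base k\<close> is where the
  positivity of \<open>k\<close> enters.\<close>

definition base :: "real \<Rightarrow> complex^'t^'t" where
  "base k = matrix_inv (k *\<^sub>R D)"

definition rx_total :: "real \<Rightarrow> real \<Rightarrow> complex^'t^'t \<Rightarrow> complex^'r^'r" where
  "rx_total k kt Q = rx kt + A ** (base k - base k ** matrix_inv (base k + Q) ** base k) ** A\<^sup>H"

text \<open>The gradient in \<open>Q\<close> of the rate, obtained by differentiating \<open>rate_eq\<close>.\<close>

definition grad_mat :: "real \<Rightarrow> real \<Rightarrow> complex^'t^'t \<Rightarrow> complex^'t^'t" where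
  "grad_mat k kt Q = matrix_inv (base k + Q) + matrix_inv (base k + Q) ** base k ** A\<^sup>H
    ** matrix_inv (rx_total k kt Q) ** A ** base k ** matrix_inv (base k + Q)"

lemma pos_def_base: "0 < k \<Longrightarrow> pos_def (base k)"
  unfolding base_def by (intro pos_def_matrix_inv pos_def_scaleR D)

lemma rx_total_eq: "psd Q \<Longrightarrow> 0 < k \<Longrightarrow> rx_total k kt Q = rx kt + A ** reduced Q (k *\<^sub>R D) ** A\<^sup>H"
  by (simp add: rx_total_def base_def reduced_scaleR_pos_def[OF D])

lemma rx_load_eq: "psd Q \<Longrightarrow> 0 < k \<Longrightarrow> rx_load k kt Q = re_trace (C ** matrix_inv (rx_total k kt Q))"
  by (simp add: rx_load_def rx_total_eq)

lemma pos_def_rx_total: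
  assumes "psd Q" "0 < k" "0 \<le> kt"
  shows "pos_def (rx_total k kt Q)"
proof -
  note sq = psd_psd_sqrt[OF assms(1)] psd_sqrt_mult_self[OF assms(1)]
  have k: "0 \<le> k" using assms(2) by simp
  show ?thesis
    unfolding rx_total_eq[OF assms(1,2)] schur_mat_sqrt[OF sq k, symmetric]
    by (rule pos_def_schur_mat[OF psd_C psd_SDS[OF sq] k assms(3)])
qed

text \<open>Sylvester's identity moves the inverse from \<open>rx kt\<close> to \<open>mat 1 + k S D S\<close>, where \<open>S\<close> is the square root
  of \<open>Q\<close>; afterwards \<open>kt\<close> enters affinely.\<close>

lemma rate_eq:
  assumes Q: "psd Q" and k: "0 < k" and kt: "0 \<le> kt"
  shows "rate k kt Q = log_det (k *\<^sub>R D) + log_det (base k + Q) + log_det (rx_total k kt Q) - c * k * kt"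
proof -
  note sq = psd_psd_sqrt[OF Q] psd_sqrt_mult_self[OF Q]
  define S where "S = psd_sqrt Q"
  note sq = sq[folded S_def]
  have k0: "0 \<le> k" using k by simp
  note X = pos_def_shift[OF psd_SDS[OF sq] k0]
  have "log_det (rx kt) + log_det (mat 1 + S ** gain k kt ** S)
      = log_det (mat 1 + k *\<^sub>R (S ** D ** S)) + log_det (schur_mat C (S ** D ** S) (A ** S) k kt)"
    unfolding schur_mat_sqrt_gain[OF sq, symmetric] schur_mat_def
    using log_det_sylvester[OF pos_def_rx[OF kt] X, of "A ** S"] by (simp add: rx_def)
  also have "schur_mat C (S ** D ** S) (A ** S) k kt = rx_total k kt Q"
    by (simp add: rx_total_eq Q k schur_mat_sqrt[OF sq k0])
  also have "mat 1 + k *\<^sub>R (S ** D ** S) = mat 1 + S ** (k *\<^sub>R D) ** S" by (simp add: matrix_expand)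
  also have "log_det \<dots> = log_det (k *\<^sub>R D) + log_det (base k + Q)"
    using log_det_sqrt_shift[OF sq(1) pos_def_scaleR[OF D k]] by (simp add: base_def sq(2))
  finally show ?thesis by (simp add: rate_def S_def)
qed

text \<open>The matrix \<open>rx_total\<close> is concave in \<open>(kt, Q)\<close> in the Loewner order, as inversion is convex, and
  \<open>log_det\<close> is monotone and concave. The coefficient of \<open>kt' - kt\<close> vanishes at a solution of the
  fixed-point equations.\<close>

lemma rate_tangent:
  assumes Q: "psd Q" and P: "psd P" and k: "0 < k" and kt: "0 \<le> kt" and kt': "0 \<le> kt'"
  shows "rate k kt' P \<le> rate k kt Q + (kt' - kt) * (rx_load k kt Q - c * k)
      + re_trace (grad_mat k kt Q ** (P - Q))"
    and "P \<noteq> Q \<Longrightarrow> rate k kt' P < rate k kt Q + (kt' - kt) * (rx_load k kt Q - c * k)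
      + re_trace (grad_mat k kt Q ** (P - Q))"
proof -
  define E where "E = base k"
  define Y where "Y = matrix_inv (E + Q)"
  define W where "W = rx_total k kt Q"
  have E: "pos_def E" unfolding E_def using k by (rule pos_def_base)
  have hE: "E\<^sup>H = E" using E by (rule pos_def_hermitian)
  have EQ: "pos_def (E + Q)" and EP: "pos_def (E + P)" using E Q P by (auto intro: pos_def_add_psd)
  have W: "pos_def W" unfolding W_def using Q k kt by (rule pos_def_rx_total)
  have W': "pos_def (rx_total k kt' P)" using P k kt' by (rule pos_def_rx_total)
  have diff: "E + P - (E + Q) = P - Q" by simp
  define \<Delta> where "\<Delta> = (kt' - kt) *\<^sub>R C + A ** E ** (Y ** (P - Q) ** Y) ** E ** A\<^sup>H"
  have "psd (\<Delta> - (rx_total k kt' P - W))"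
  proof -
    have "\<Delta> - (rx_total k kt' P - W)
        = (A ** E) ** (matrix_inv (E + P) - (Y - Y ** (P - Q) ** Y)) ** (A ** E)\<^sup>H"
      unfolding \<Delta>_def W_def rx_total_def rx_def E_def[symmetric] Y_def[symmetric] ctranspose_mult hE
      by (simp add: matrix_expand matrix_mul_assoc scaleR_diff_left algebra_simps)
    moreover have "psd (matrix_inv (E + P) - (Y - Y ** (P - Q) ** Y))"
      using psd_matrix_inv_tangent[OF EP EQ] by (simp add: Y_def)
    ultimately show ?thesis by (simp only: psd_congruence)
  qed
  then have "re_trace (matrix_inv W ** (rx_total k kt' P - W)) \<le> re_trace (matrix_inv W ** \<Delta>)"
    by (rule re_trace_mult_mono[OF pos_def_psd[OF pos_def_matrix_inv[OF W]]])
  also have "re_trace (matrix_inv W ** \<Delta>) = (kt' - kt) * rx_load k kt Q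
      + re_trace (Y ** E ** A\<^sup>H ** matrix_inv W ** A ** E ** Y ** (P - Q))"
  proof -
    have "re_trace (matrix_inv W ** C) = rx_load k kt Q"
      using rx_load_eq[OF Q k, of kt] by (simp add: W_def re_trace_mult_sym[of C])
    moreover have "re_trace ((matrix_inv W ** A ** E ** Y ** (P - Q)) ** (Y ** E ** A\<^sup>H))
        = re_trace ((Y ** E ** A\<^sup>H) ** (matrix_inv W ** A ** E ** Y ** (P - Q)))"
      by (rule re_trace_mult_sym)
    ultimately show ?thesis
      by (simp add: \<Delta>_def matrix_add_ldistrib scaleR_mult_right re_trace_add re_trace_scaleR matrix_mul_assoc)
  qed
  finally have "log_det (rx_total k kt' P) \<le> log_det W + (kt' - kt) * rx_load k kt Q
      + re_trace (Y ** E ** A\<^sup>H ** matrix_inv W ** A ** E ** Y ** (P - Q))"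
    using log_det_tangent(1)[OF W W'] by linarith
  moreover have "re_trace (grad_mat k kt Q ** (P - Q)) = re_trace (Y ** (P - Q))
      + re_trace (Y ** E ** A\<^sup>H ** matrix_inv W ** A ** E ** Y ** (P - Q))"
    by (simp add: grad_mat_def E_def Y_def W_def matrix_add_rdistrib_cplx re_trace_add)
  moreover note rate_eq[OF Q k kt, folded E_def W_def] rate_eq[OF P k kt', folded E_def]
  moreover have "(kt' - kt) * (rx_load k kt Q - c * k) = (kt' - kt) * rx_load k kt Q - c * k * kt' + c * k * kt"
    by (simp add: algebra_simps)
  moreover have "log_det (E + P) \<le> log_det (E + Q) + re_trace (Y ** (P - Q))"
    using log_det_tangent(1)[OF EQ EP] by (simp add: Y_def)
  moreover have "log_det (E + P) < log_det (E + Q) + re_trace (Y ** (P - Q))" if "P \<noteq> Q"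
    using log_det_tangent(2)[OF EQ EP] that by (simp add: Y_def)
  ultimately show "rate k kt' P \<le> rate k kt Q + (kt' - kt) * (rx_load k kt Q - c * k)
      + re_trace (grad_mat k kt Q ** (P - Q))"
    and "P \<noteq> Q \<Longrightarrow> rate k kt' P < rate k kt Q + (kt' - kt) * (rx_load k kt Q - c * k)
      + re_trace (grad_mat k kt Q ** (P - Q))"
    by linarith+
qed

end

section \<open>The input constraint set\<close>

lemma C1_iff: "(Q :: complex^'t^'t) \<in> C1 \<longleftrightarrow> psd Q \<and> trace Q = of_nat CARD('t)"
  by (auto simp: C1_def divide_eq_eq)

lemma C1_psd: "Q \<in> C1 \<Longrightarrow> psd Q"
  by (simp add: C1_iff)

lemma C1_re_trace: "(Q :: complex^'t^'t) \<in> C1 \<Longrightarrow> re_trace Q = CARD('t)"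
  by (simp add: C1_iff re_trace_def)

lemma C1_nonzero: "Q \<in> C1 \<Longrightarrow> Q \<noteq> 0"
  using C1_re_trace by fastforce

lemma trace_scaleR: "trace (k *\<^sub>R (M::complex^'n^'n)) = of_real k * trace M"
  by (simp add: trace_def sum_distrib_left complex_eq_iff)

lemma mat_in_C1: "mat 1 \<in> C1"
  by (simp add: C1_iff pos_def_psd) (simp add: trace_def mat_def)

lemma convex_C1: "convex (C1 :: (complex^'t^'t) set)"
  unfolding convex_def
proof (intro ballI allI impI)
  fix P Q :: "complex^'t^'t" and u v :: real
  assume *: "P \<in> C1" "Q \<in> C1" "0 \<le> u" "0 \<le> v" "u + v = 1"
  then have "of_real u + of_real v = (1 :: complex)" by (metis of_real_1 of_real_add)
  then have "of_real u * of_nat CARD('t) + of_real v * of_nat CARD('t) = (of_nat CARD('t) :: complex)"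
    by (metis distrib_right mult_1)
  then show "u *\<^sub>R P + v *\<^sub>R Q \<in> C1"
    using * by (auto simp: C1_iff psd_add psd_scaleR trace_add trace_scaleR)
qed

text \<open>Boundedness: for \<open>Q = S S\<close> the squared Frobenius norm of \<open>S\<close> is the trace of \<open>Q\<close>.\<close>

lemma compact_C1: "compact (C1 :: (complex^'t^'t) set)"
  unfolding compact_eq_bounded_closed
proof
  obtain k where k: "0 < k" "\<And>(A::complex^'t^'t) (B::complex^'t^'t). norm (A ** B) \<le> norm A * norm B * k"
    by (rule matrix_mult_bound) (rule that)
  have "norm Q \<le> CARD('t) * k" if q: "Q \<in> C1" for Q :: "complex^'t^'t"
  proof -
    obtain S where S: "psd S" "S ** S = Q" using psd_sqrt_exists[OF C1_psd[OF q]] by blast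
    have "(norm S)\<^sup>2 = re_trace Q"
      by (simp add: dot_square_norm[symmetric] inner_eq_re_trace psd_hermitian S)
    then show ?thesis using k(2)[of S S] C1_re_trace[OF q] S(2) by (simp add: power2_eq_square)
  qed
  then show "bounded (C1 :: (complex^'t^'t) set)" unfolding bounded_iff by blast
  have lin: "continuous_on UNIV f" if "linear f" for f :: "complex^'t^'t \<Rightarrow> 'b::real_normed_vector"
    using that by (simp add: linear_continuous_on linear_conv_bounded_linear)
  have eq: "C1 = {Q :: complex^'t^'t. Q\<^sup>H = Q} \<inter> (\<Inter>x. {Q. 0 \<le> x \<bullet> (Q *v x)}) \<inter> {Q. trace Q = of_nat CARD('t)}"
    by (auto simp: C1_iff psd_iff)
  have c1: "closed {Q :: complex^'t^'t. Q\<^sup>H = Q}"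
    by (intro closed_Collect_eq lin linear_ctranspose continuous_on_id)
  have c2: "closed {Q :: complex^'t^'t. 0 \<le> x \<bullet> (Q *v x)}" for x
    by (intro closed_Collect_le continuous_on_const lin linearI)
      (simp_all add: matrix_vector_mult_add_rdistrib inner_add_right scaleR_mult_vec)
  have c3: "closed {Q :: complex^'t^'t. trace Q = of_nat CARD('t)}"
    by (intro closed_Collect_eq continuous_on_const lin linearI)
      (simp_all add: trace_add trace_scaleR scaleR_conv_of_real[where 'a = complex])
  show "closed (C1 :: (complex^'t^'t) set)"
    unfolding eq by (intro closed_Int closed_INT ballI c1 c2 c3)
qed

text \<open>Both derivatives give the one-sided velocity along the segment from \<open>x\<close> to \<open>y\<close>, which stays in \<open>S\<close>.\<close>

lemma has_derivative_within_convex_unique: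
  fixes f :: "'a::real_normed_vector \<Rightarrow> 'b::real_normed_vector"
  assumes f': "(f has_derivative f') (at x within S)" and f'': "(f has_derivative f'') (at x within S)"
    and S: "convex S" "x \<in> S" "y \<in> S"
  shows "f' (y - x) = f'' (y - x)"
proof -
  let ?g = "\<lambda>s::real. x + s *\<^sub>R (y - x)"
  have im: "?g ` {0..1} \<subseteq> S"
  proof
    fix z assume "z \<in> ?g ` {0..1}"
    then obtain s where s: "s \<in> {0..1}" "z = (1 - s) *\<^sub>R x + s *\<^sub>R y" by (auto simp: algebra_simps)
    then show "z \<in> S" using S by (auto intro: convexD)
  qed
  have curve: "((\<lambda>s. f (?g s)) has_vector_derivative F (y - x)) (at 0 within {0..1})"
    if F: "(f has_derivative F) (at x within S)" for F
  proof -
    have "(?g has_derivative (\<lambda>h. h *\<^sub>R (y - x))) (at 0 within {0..1})"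
      by (auto intro!: derivative_eq_intros)
    moreover have "(f has_derivative F) (at (?g 0) within ?g ` {0..1})"
      using F im by (auto intro: has_derivative_subset)
    ultimately have "(f \<circ> ?g has_derivative F \<circ> (\<lambda>h. h *\<^sub>R (y - x))) (at 0 within {0..1})"
      by (rule diff_chain_within)
    then show ?thesis
      using has_derivative_linear[OF F] by (simp add: has_vector_derivative_def o_def linear_cmul)
  qed
  show ?thesis
    by (rule vector_derivative_unique_within[OF _ curve[OF f'] curve[OF f'']])
      (simp add: trivial_limit_within islimpt_Icc)
qed

section \<open>The optimized rate over the constraint set\<close>

context channel
begin

text \<open>The solution stays in a compact box, and by uniqueness its graph is the set where \<open>defect\<close>
  vanishes on the closed quadrant: a limit of solutions is a nonnegative solution, hence positive.\<close>

lemma continuous_on_sol: "continuous_on C1 sol"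
proof -
  have "continuous_on C1 (\<lambda>Q. re_trace (D ** Q))"
    by (intro continuous_on_re_trace continuous_on_matrix_mult continuous_on_const continuous_on_id)
  then have "bounded ((\<lambda>Q. re_trace (D ** Q)) ` C1)"
    by (intro compact_imp_bounded compact_continuous_image compact_C1)
  then obtain b where b: "\<And>Q. Q \<in> C1 \<Longrightarrow> re_trace (D ** Q) \<le> b"
    unfolding bounded_iff by (auto simp: abs_le_iff)
  show ?thesis
  proof (rule continuous_from_closed_graph)
    show "compact ({0..re_trace C / c} \<times> {0..b / c})" by (intro compact_Times) auto
    show "sol \<in> C1 \<rightarrow> {0..re_trace C / c} \<times> {0..b / c}"
    proof
      fix Q :: "complex^'t^'t" assume Q: "Q \<in> C1"
      note Q' = C1_psd[OF Q] C1_nonzero[OF Q]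
      show "sol Q \<in> {0..re_trace C / c} \<times> {0..b / c}"
        using sol_pos1[OF Q'] sol_pos2[OF Q'] sol_bounds[OF Q'] b[OF Q] c
        by (auto simp: mem_Times_iff pos_le_divide_eq mult.commute[of _ c])
    qed
    let ?T = "C1 \<times> ({0..} \<times> {0..}) :: ((complex^'t^'t) \<times> real \<times> real) set"
    have eq: "(\<lambda>Q. (Q, sol Q)) ` C1 = {z \<in> ?T. defect (snd z, fst z) = 0}" (is "?l = ?r")
    proof
      show "?l \<subseteq> ?r"
      proof
        fix z assume "z \<in> ?l"
        then obtain Q where Q: "Q \<in> C1" "z = (Q, sol Q)" by blast
        note Q' = C1_psd[OF Q(1)] C1_nonzero[OF Q(1)]
        show "z \<in> ?r"
          using Q sol_pos1[OF Q'] sol_pos2[OF Q'] defect_sol[OF Q'] by (simp add: mem_Times_iff)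
      qed
      show "?r \<subseteq> ?l"
      proof
        fix z assume "z \<in> ?r"
        then obtain Q k kt where z: "z = (Q, k, kt)" "Q \<in> C1" "0 \<le> k" "0 \<le> kt" "defect ((k, kt), Q) = 0"
          by (cases z) auto
        then have "sol Q = (k, kt)"
          by (intro sol_eqI C1_psd C1_nonzero) (auto simp: defect_def zero_prod_def)
        then show "z \<in> ?l" using z by force
      qed
    qed
    have "continuous_on ((\<lambda>z. (snd z, fst z)) ` ?T) defect"
      by (rule differentiable_imp_continuous_on)
        (auto simp: differentiable_on_def intro!: differentiable_defect C1_psd)
    then have "continuous_on ?T (defect \<circ> (\<lambda>z. (snd z, fst z)))"
      by (intro continuous_on_compose continuous_intros)
    moreover have "closed ?T" by (intro closed_Times compact_imp_closed[OF compact_C1]) auto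
    ultimately show "closed ((\<lambda>Q. (Q, sol Q)) ` C1)"
      unfolding eq by (simp only: o_def continuous_closed_preimage_constant)
  qed
qed

lemma differentiable_on_sol: "sol differentiable_on C1"
  unfolding differentiable_on_def
proof
  fix Q :: "complex^'t^'t" assume Q: "Q \<in> C1"
  note Q' = C1_psd[OF Q] C1_nonzero[OF Q]
  have "defect differentiable (at ((fst (sol Q), snd (sol Q)), Q))"
    using sol_pos1[OF Q'] sol_pos2[OF Q'] by (intro differentiable_defect Q') auto
  then obtain L where L: "(defect has_derivative L) (at (sol Q, Q))"
    unfolding differentiable_def by auto
  show "sol differentiable (at Q within C1)"
  proof (rule implicit_differentiable_within[where F = defect and x = sol and L = L and q = Q])
    show "continuous (at Q within C1) sol"
      using continuous_on_sol Q by (simp add: continuous_on_eq_continuous_within)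
    show "defect (sol P, P) = 0" if "P \<in> C1" for P
      using that by (intro defect_sol C1_psd C1_nonzero)
  qed (use Q L defect_partial_injective[OF Q' L] in blast)+
qed

definition opt_rate :: "complex^'t^'t \<Rightarrow> real" where
  "opt_rate Q = rate (fst (sol Q)) (snd (sol Q)) Q"

definition opt_grad :: "complex^'t^'t \<Rightarrow> complex^'t^'t" where
  "opt_grad Q = grad_mat (fst (sol Q)) (snd (sol Q)) Q"

text \<open>The optimized rate is the minimum over \<open>k\<close> of the maximum over \<open>kt\<close> of the rate; the inner maximum
  of a jointly concave function and the outer minimum both preserve concavity.\<close>

lemma opt_rate_tangent:
  assumes Q: "Q \<in> C1" and P: "P \<in> C1"
  shows "opt_rate P \<le> opt_rate Q + re_trace (opt_grad Q ** (P - Q))"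
    and "P \<noteq> Q \<Longrightarrow> opt_rate P < opt_rate Q + re_trace (opt_grad Q ** (P - Q))"
proof -
  note Q' = C1_psd[OF Q] C1_nonzero[OF Q] and P' = C1_psd[OF P] C1_nonzero[OF P]
  note pos = sol_pos1[OF Q'] sol_pos2[OF Q'] sol_pos1[OF P'] sol_pos2[OF P']
  let ?l = "fst (sol Q) / fst (sol P)" and ?kt = "snd (sol P) / (fst (sol Q) / fst (sol P))"
  \<comment> \<open>The point of the hyperbola of \<open>P\<close> whose first coordinate belongs to \<open>Q\<close>.\<close>
  have "opt_rate P \<le> rate (fst (sol Q)) ?kt P"
    using rate_sol_le_hyperbola[OF P', of ?l] pos by (simp add: opt_rate_def)
  moreover have "0 \<le> ?kt" "0 \<le> snd (sol Q)" using pos by simp_all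
  note rate_tangent[OF Q'(1) P'(1) pos(1) this(2,1), folded opt_rate_def opt_grad_def]
  ultimately show "opt_rate P \<le> opt_rate Q + re_trace (opt_grad Q ** (P - Q))"
    "P \<noteq> Q \<Longrightarrow> opt_rate P < opt_rate Q + re_trace (opt_grad Q ** (P - Q))"
    using sol_load(1)[OF Q'] by auto
qed

lemma continuous_on_opt_grad: "continuous_on C1 opt_grad"
proof -
  have k: "continuous_on C1 (\<lambda>Q. fst (sol Q))" and kt: "continuous_on C1 (\<lambda>Q. snd (sol Q))"
    by (intro continuous_intros continuous_on_sol)+
  note pos = sol_pos1[OF C1_psd C1_nonzero] sol_pos2[OF C1_psd C1_nonzero]
  have base: "continuous_on C1 (\<lambda>Q. base (fst (sol Q)))"
    unfolding base_def by (intro continuous_on_matrix_inv continuous_intros k pos_def_invertible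
        pos_def_scaleR D pos)
  have inv: "continuous_on C1 (\<lambda>Q. matrix_inv (base (fst (sol Q)) + Q))"
    by (intro continuous_on_matrix_inv continuous_intros base pos_def_invertible pos_def_add_psd
        pos_def_base pos C1_psd)
  have "continuous_on C1 (\<lambda>Q. rx_total (fst (sol Q)) (snd (sol Q)) Q)"
    unfolding rx_total_def rx_def
    by (intro continuous_intros continuous_on_matrix_mult kt base inv)
  then have "continuous_on C1 (\<lambda>Q. matrix_inv (rx_total (fst (sol Q)) (snd (sol Q)) Q))"
    by (intro continuous_on_matrix_inv pos_def_invertible pos_def_rx_total C1_psd pos less_imp_le[OF pos(2)])
  then show ?thesis
    unfolding opt_grad_def[abs_def] grad_mat_def
    by (intro continuous_intros continuous_on_matrix_mult base inv)
qed

lemma has_derivative_opt_rate: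
  assumes Q: "Q \<in> C1"
  shows "(opt_rate has_derivative (\<lambda>H. re_trace (opt_grad Q ** H))) (at Q within C1)"
proof -
  obtain b where b: "\<And>(A::complex^'t^'t) (B::complex^'t^'t). \<bar>re_trace (A ** B)\<bar> \<le> norm A * norm B * b"
    by (rule norm_re_trace_mult_le) (rule that)
  show ?thesis
  proof (rule has_derivative_within_tangent[where \<Phi> = "\<lambda>P H. re_trace (opt_grad P ** H)"
        and \<epsilon> = "\<lambda>P. norm (opt_grad P - opt_grad Q) * b"])
    show "bounded_linear (\<lambda>H. re_trace (opt_grad P ** H))" for P
      by (intro linear_conv_bounded_linear[THEN iffD1] linearI)
        (simp_all add: matrix_expand re_trace_add re_trace_scaleR)
    show "\<bar>re_trace (opt_grad P ** H) - re_trace (opt_grad Q ** H)\<bar>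
        \<le> norm (opt_grad P - opt_grad Q) * b * norm H" for P H
      using b[of "opt_grad P - opt_grad Q" H]
      by (simp add: matrix_diff_rdistrib re_trace_diff ac_simps)
    have "(opt_grad \<longlongrightarrow> opt_grad Q) (at Q within C1)"
      using continuous_on_opt_grad Q by (simp add: continuous_on_def)
    then have "((\<lambda>P. norm (opt_grad P - opt_grad Q) * b) \<longlongrightarrow> norm (opt_grad Q - opt_grad Q) * b)
        (at Q within C1)"
      by (intro tendsto_intros)
    then show "((\<lambda>P. norm (opt_grad P - opt_grad Q) * b) \<longlongrightarrow> 0) (at Q within C1)" by simp
  qed (use Q opt_rate_tangent in auto)
qed

lemma opt_rate_maximizer:
  obtains Qs where "Qs \<in> C1" "\<And>P. P \<in> C1 \<Longrightarrow> opt_rate P \<le> opt_rate Qs"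
proof -
  have "continuous_on C1 opt_rate"
    using has_derivative_opt_rate
    by (intro differentiable_imp_continuous_on) (auto simp: differentiable_on_def differentiable_def)
  then show thesis
    using continuous_attains_sup[OF compact_C1, of opt_rate] mat_in_C1 that by blast
qed

lemma opt_rate_stationary_unique_max:
  assumes "Q \<in> C1" "\<And>P. P \<in> C1 \<Longrightarrow> re_trace (opt_grad Q ** (P - Q)) \<le> 0" "P \<in> C1" "P \<noteq> Q"
  shows "opt_rate P < opt_rate Q"
  using opt_rate_tangent(2)[OF assms(1,3,4)] assms(2)[OF assms(3)] by simp

text \<open>The tangent inequality at the points \<open>Q + s (P - Q)\<close>, evaluated at \<open>Q\<close>, bounds the slope there; then
  \<open>s\<close> tends to zero.\<close>

lemma opt_rate_max_stationary:
  assumes Q: "Q \<in> C1" "\<And>P. P \<in> C1 \<Longrightarrow> opt_rate P \<le> opt_rate Q" and P: "P \<in> C1"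
  shows "re_trace (opt_grad Q ** (P - Q)) \<le> 0"
proof -
  let ?g = "\<lambda>s::real. Q + s *\<^sub>R (P - Q)"
  have g: "?g s \<in> C1" if "s \<in> {0..1}" for s
  proof -
    have "?g s = (1 - s) *\<^sub>R Q + s *\<^sub>R P" by (simp add: algebra_simps)
    then show ?thesis using that Q P convex_C1 by (auto intro: convexD)
  qed
  have le: "re_trace (opt_grad (?g s) ** (P - Q)) \<le> 0" if s: "s \<in> {0<..1}" for s
  proof -
    have gs: "?g s \<in> C1" using s by (intro g) auto
    have "opt_rate Q \<le> opt_rate (?g s) + re_trace (opt_grad (?g s) ** (Q - ?g s))"
      using gs Q(1) by (rule opt_rate_tangent)
    also have "Q - ?g s = (- s) *\<^sub>R (P - Q)" by simp
    finally have "s * re_trace (opt_grad (?g s) ** (P - Q)) \<le> 0"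
      using Q(2)[OF gs] unfolding scaleR_mult_right re_trace_scaleR by simp
    then show ?thesis using s by (simp add: mult_le_0_iff)
  qed
  have cont: "continuous_on {0..1} (\<lambda>s. re_trace (opt_grad (?g s) ** (P - Q)))"
    by (intro continuous_on_re_trace continuous_on_matrix_mult continuous_on_const
        continuous_on_compose2[OF continuous_on_opt_grad] continuous_intros) (use g in auto)
  have cl: "closure {0<..1::real} = {0..1}" by simp
  have "re_trace (opt_grad (?g 0) ** (P - Q)) \<le> 0"
    by (rule continuous_le_on_closure[where S = "{0<..1::real}"])
      (use cont le in \<open>simp_all add: cl\<close>)
  then show ?thesis by simp
qed

end

section \<open>Reduction to the normalized channel\<close>

text \<open>Absorbing \<open>1 / (K + 1)\<close> into both correlation matrices and the signal-to-noise factor into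
  the line-of-sight matrix reduces every object to the normalized channel.\<close>

context
  fixes \<sigma> K :: real and A An :: "complex^'t^'r" and C Cn :: "complex^'r^'r"
    and Ct Dn :: "complex^'t^'t" and cn :: real
  assumes \<sigma>: "\<sigma>\<^sup>2 > 0" and K: "K \<ge> 0" and pd_C: "pos_def C" and pd_Ct: "pos_def Ct"
    and An: "An = sqrt (K / (\<sigma>\<^sup>2 * (K + 1))) *\<^sub>R A"
    and Cn: "Cn = (1 / (K + 1)) *\<^sub>R C" and Dn: "Dn = (1 / (K + 1)) *\<^sub>R Ct"
    and cn: "cn = real CARD('t) * \<sigma>\<^sup>2 / (K + 1)"
begin

lemma channel_normalized: "channel Cn Dn cn"
  using \<sigma> K pd_C pd_Ct by unfold_locales (auto intro: pos_def_scaleR simp: Cn Dn cn)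

interpretation channel An Cn Dn cn
  by (rule channel_normalized)

lemma An_sandwich: "An ** M ** An\<^sup>H = (K / (\<sigma>\<^sup>2 * (K + 1))) *\<^sub>R (A ** M ** A\<^sup>H)"
  and An_sandwich': "An\<^sup>H ** N ** An = (K / (\<sigma>\<^sup>2 * (K + 1))) *\<^sub>R (A\<^sup>H ** N ** A)"
  using \<sigma> K by (simp_all add: An matrix_expand ctranspose_scaleR)

lemma G_eq_gain: "G \<sigma> K A C Ct k kt = gain k kt"
  unfolding G_def gain_def An_sandwich' rx_def by (simp add: Cn Dn)

lemma V_eq_rate: "V \<sigma> K A C Ct k kt Q = rate k kt Q"
  unfolding V_def rate_def Let_def gain_def An_sandwich' rx_def
  by (simp add: Cn Dn cn matrix_expand matrix_mul_assoc add.assoc)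

text \<open>Traces of products of Hermitian matrices are real, so the complex equation is a real one.\<close>

lemma canonical_equation_iff:
  fixes N :: "complex^'n^'n"
  assumes N: "pos_def N" and M: "M\<^sup>H = M"
  shows "complex_of_real d = trace (M ** matrix_inv (\<sigma>\<^sup>2 *\<^sub>R N)) / of_nat CARD('t)
    \<longleftrightarrow> cn * d = re_trace ((1 / (K + 1)) *\<^sub>R M ** matrix_inv N)"
proof -
  have N': "(matrix_inv N)\<^sup>H = matrix_inv N"
    using N by (intro pos_def_hermitian pos_def_matrix_inv)
  have "trace (M ** matrix_inv (\<sigma>\<^sup>2 *\<^sub>R N)) = of_real (re_trace (M ** matrix_inv N) / \<sigma>\<^sup>2)"
    using \<sigma> by (simp add: matrix_inv_scaleR pos_def_invertible N matrix_expand trace_scaleR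
        trace_mult_hermitian_real[OF M N'])
  then have "trace (M ** matrix_inv (\<sigma>\<^sup>2 *\<^sub>R N)) / of_nat CARD('t)
      = complex_of_real (re_trace (M ** matrix_inv N) / \<sigma>\<^sup>2 / real CARD('t))" by simp
  then have "complex_of_real d = trace (M ** matrix_inv (\<sigma>\<^sup>2 *\<^sub>R N)) / of_nat CARD('t)
      \<longleftrightarrow> d = re_trace (M ** matrix_inv N) / \<sigma>\<^sup>2 / real CARD('t)"
    by (simp only: of_real_eq_iff)
  also have "\<dots> \<longleftrightarrow> cn * d = re_trace ((1 / (K + 1)) *\<^sub>R M ** matrix_inv N)"
    using \<sigma> K by (simp add: cn matrix_expand re_trace_scaleR field_simps)
  finally show ?thesis .
qed

lemma canonical_system_iff:
  assumes Q: "psd Q" and d: "0 < d" and dt: "0 < dt"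
  shows "canonical_system \<sigma> K A C Ct Q d dt
    \<longleftrightarrow> fixed_point_pair cn Cn (psd_sqrt Q ** Dn ** psd_sqrt Q) (An ** psd_sqrt Q) d dt"
proof -
  define S where "S = psd_sqrt Q"
  have S: "psd S" "S ** S = Q" using Q by (simp_all add: S_def psd_psd_sqrt psd_sqrt_mult_self)
  have hS: "S\<^sup>H = S" using S(1) by (rule psd_hermitian)
  let ?X = "S ** Dn ** S"
  have X: "psd ?X" by (rule psd_SDS[OF S])
  define T where "T = mat 1 + (d / (K + 1)) *\<^sub>R (S ** Ct ** S)"
  define R where "R = mat 1 + (dt / (K + 1)) *\<^sub>R C"
  have T: "mat 1 + d *\<^sub>R ?X = T" and R: "mat 1 + dt *\<^sub>R Cn = R"
    by (simp_all add: T_def R_def Cn Dn matrix_expand)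
  have W: "\<sigma>\<^sup>2 *\<^sub>R schur_mat Cn ?X (An ** S) d dt
      = \<sigma>\<^sup>2 *\<^sub>R R + (K / (K + 1)) *\<^sub>R (A ** S ** matrix_inv T ** S ** A\<^sup>H)"
  proof -
    have "An ** S ** matrix_inv T ** (An ** S)\<^sup>H = An ** (S ** matrix_inv T ** S) ** An\<^sup>H"
      by (simp only: ctranspose_mult hS matrix_mul_assoc)
    then show ?thesis
      unfolding schur_mat_def T R An_sandwich using \<sigma>
      by (simp add: An_sandwich scaleR_add_right matrix_mul_assoc)
  qed
  have Z: "\<sigma>\<^sup>2 *\<^sub>R schur_mat ?X Cn ((An ** S)\<^sup>H) dt d
      = \<sigma>\<^sup>2 *\<^sub>R T + (K / (K + 1)) *\<^sub>R (S ** A\<^sup>H ** matrix_inv R ** A ** S)"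
  proof -
    have "(An ** S)\<^sup>H ** matrix_inv R ** ((An ** S)\<^sup>H)\<^sup>H = S ** (An\<^sup>H ** matrix_inv R ** An) ** S"
      by (simp only: ctranspose_ctranspose ctranspose_mult hS matrix_mul_assoc)
    then show ?thesis
      unfolding schur_mat_def T R using \<sigma>
      by (simp add: An_sandwich' scaleR_add_right matrix_mul_assoc matrix_expand)
  qed
  have pdW: "pos_def (schur_mat Cn ?X (An ** S) d dt)" and pdZ: "pos_def (schur_mat ?X Cn ((An ** S)\<^sup>H) dt d)"
    using psd_C X d dt by (auto intro: pos_def_schur_mat)
  have hX: "(S ** Ct ** S)\<^sup>H = S ** Ct ** S"
    using pos_def_hermitian[OF pd_Ct] by (simp add: ctranspose_mult hS matrix_mul_assoc)
  have SDS: "(1 / (K + 1)) *\<^sub>R (S ** Ct ** S) = ?X" by (simp add: Dn matrix_expand)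
  show ?thesis
    unfolding canonical_system_def Let_def fixed_point_pair_def S_def[symmetric] T_def[symmetric]
      R_def[symmetric] W[symmetric] Z[symmetric] canonical_equation_iff[OF pdW pos_def_hermitian[OF pd_C]]
      canonical_equation_iff[OF pdZ hX] schur_trace_def SDS Cn[symmetric]
    ..
qed

lemma canonical_solution_eq_sol: "psd Q \<Longrightarrow> canonical_solution \<sigma> K A C Ct Q = sol Q"
  unfolding canonical_solution_def sol_def
  by (rule arg_cong[where f = The]) (auto simp: canonical_system_iff)

lemma delta_eq: "psd Q \<Longrightarrow> delta \<sigma> K A C Ct Q = fst (sol Q)"
  and delta_tilde_eq: "psd Q \<Longrightarrow> delta_tilde \<sigma> K A C Ct Q = snd (sol Q)"
  by (simp_all add: delta_def delta_tilde_def canonical_solution_eq_sol)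

lemma I_bar_eq: "psd Q \<Longrightarrow> I_bar \<sigma> K A C Ct Q = opt_rate Q"
  by (simp add: I_bar_def opt_rate_def V_eq_rate delta_eq delta_tilde_eq)

lemma I_bar_has_derivative:
  "Q \<in> C1 \<Longrightarrow> (I_bar \<sigma> K A C Ct has_derivative (\<lambda>H. re_trace (opt_grad Q ** H))) (at Q within C1)"
  by (rule has_derivative_transform[OF _ _ has_derivative_opt_rate]) (auto simp: I_bar_eq C1_psd)

lemma grad_C1_I_bar:
  assumes "Q \<in> C1" "P \<in> C1"
  shows "grad_C1 (I_bar \<sigma> K A C Ct) Q (P - Q) = re_trace (opt_grad Q ** (P - Q))"
proof -
  have "I_bar \<sigma> K A C Ct differentiable (at Q within C1)"
    using I_bar_has_derivative[OF assms(1)] unfolding differentiable_def by blast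
  then show ?thesis
    unfolding grad_C1_def frechet_derivative_works
    by (rule has_derivative_within_convex_unique[OF _ I_bar_has_derivative convex_C1]) (rule assms)+
qed

lemma differentiable_on_C1:
  "delta \<sigma> K A C Ct differentiable_on C1" "delta_tilde \<sigma> K A C Ct differentiable_on C1"
  "I_bar \<sigma> K A C Ct differentiable_on C1"
proof -
  have *: "f differentiable_on C1" if "bounded_linear g" "\<And>Q. psd Q \<Longrightarrow> f Q = g (sol Q)"
    for f :: "complex^'t^'t \<Rightarrow> real" and g
    unfolding differentiable_on_def
  proof
    fix Q :: "complex^'t^'t" assume Q: "Q \<in> C1"
    then obtain L where "(sol has_derivative L) (at Q within C1)"
      using differentiable_on_sol unfolding differentiable_on_def differentiable_def by blast
    then have "((\<lambda>Q. g (sol Q)) has_derivative (\<lambda>H. g (L H))) (at Q within C1)"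
      by (rule bounded_linear.has_derivative[OF that(1)])
    then have "(f has_derivative (\<lambda>H. g (L H))) (at Q within C1)"
      using Q that(2) by (intro has_derivative_transform[of Q C1 f "\<lambda>Q. g (sol Q)"]) (auto simp: C1_psd)
    then show "f differentiable (at Q within C1)" unfolding differentiable_def by blast
  qed
  show "delta \<sigma> K A C Ct differentiable_on C1" "delta_tilde \<sigma> K A C Ct differentiable_on C1"
    by (rule *[OF bounded_linear_fst delta_eq], assumption)
      (rule *[OF bounded_linear_snd delta_tilde_eq], assumption)
  show "I_bar \<sigma> K A C Ct differentiable_on C1"
    using I_bar_has_derivative unfolding differentiable_on_def differentiable_def by blast
qed

lemma I_bar_stationary_unique_max:
  assumes "Q \<in> C1" "\<And>P. P \<in> C1 \<Longrightarrow> grad_C1 (I_bar \<sigma> K A C Ct) Q (P - Q) \<le> 0" "P \<in> C1" "P \<noteq> Q"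
  shows "I_bar \<sigma> K A C Ct P < I_bar \<sigma> K A C Ct Q"
  using opt_rate_stationary_unique_max[OF assms(1) _ assms(3,4)] assms(2) grad_C1_I_bar[OF assms(1)]
  by (simp add: I_bar_eq C1_psd assms(1,3))

lemma I_bar_max_stationary:
  assumes "Q \<in> C1" "\<And>P. P \<in> C1 \<Longrightarrow> I_bar \<sigma> K A C Ct P \<le> I_bar \<sigma> K A C Ct Q" "P \<in> C1"
  shows "grad_C1 (I_bar \<sigma> K A C Ct) Q (P - Q) \<le> 0"
  unfolding grad_C1_I_bar[OF assms(1,3)]
  by (rule opt_rate_max_stationary[OF assms(1) _ assms(3)])
    (use assms(2) in \<open>simp add: I_bar_eq[symmetric] C1_psd assms(1)\<close>)

text \<open>The slope that is nonpositive at a stationary point is also the gradient of \<open>V\<close> in its last argument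
  with the pair frozen at \<open>Q\<close>.\<close>

lemma V_waterfilling:
  assumes Q: "Q \<in> C1" "\<And>P. P \<in> C1 \<Longrightarrow> grad_C1 (I_bar \<sigma> K A C Ct) Q (P - Q) \<le> 0"
    and P: "P \<in> C1" "P \<noteq> Q"
  defines "k \<equiv> delta \<sigma> K A C Ct Q" and "kt \<equiv> delta_tilde \<sigma> K A C Ct Q"
  shows "V \<sigma> K A C Ct k kt P < V \<sigma> K A C Ct k kt Q"
proof -
  note Q' = C1_psd[OF Q(1)] C1_nonzero[OF Q(1)] and P' = C1_psd[OF P(1)]
  have k: "0 < k" "0 \<le> kt"
    using sol_pos1[OF Q'] sol_pos2[OF Q'] by (simp_all add: k_def kt_def delta_eq delta_tilde_eq Q')
  have "re_trace (grad_mat k kt Q ** (P - Q)) \<le> 0"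
    using Q(2)[OF P(1)] grad_C1_I_bar[OF Q(1) P(1)]
    by (simp add: opt_grad_def k_def kt_def delta_eq delta_tilde_eq Q')
  then show ?thesis
    using rate_tangent(2)[OF Q'(1) P' k k(2) P(2)] by (simp add: V_eq_rate)
qed

text \<open>The two objectives of the waterfilling problem differ by a constant.\<close>

lemma V_eq_log_det_gain:
  assumes "Q \<in> C1" "P \<in> C1"
  defines "k \<equiv> delta \<sigma> K A C Ct Q" and "kt \<equiv> delta_tilde \<sigma> K A C Ct Q"
  shows "V \<sigma> K A C Ct k kt P = log_det (mat 1 + P ** G \<sigma> K A C Ct k kt)
    + (log_det (rx kt) - cn * k * kt)"
proof -
  note Q' = C1_psd[OF assms(1)] C1_nonzero[OF assms(1)]
  have k: "0 < k" "0 \<le> kt"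
    using sol_pos1[OF Q'] sol_pos2[OF Q'] by (simp_all add: k_def kt_def delta_eq delta_tilde_eq Q')
  show ?thesis
    using log_det_mult_gain[OF C1_psd[OF assms(2)] k] by (simp add: V_eq_rate G_eq_gain rate_def)
qed

lemma I_bar_maximizer_exists: "\<exists>Q\<in>C1. \<forall>P\<in>C1. I_bar \<sigma> K A C Ct P \<le> I_bar \<sigma> K A C Ct Q"
  using opt_rate_maximizer by (metis I_bar_eq C1_psd)

end

lemma is_arg_max_unique_iff:
  fixes f :: "'a \<Rightarrow> real"
  assumes "q \<in> S" "\<And>p. p \<in> S \<Longrightarrow> p \<noteq> q \<Longrightarrow> f p < f q"
  shows "is_arg_max f (\<lambda>x. x \<in> S) x \<longleftrightarrow> x = q"
  using assms unfolding is_arg_max_def by (metis less_asym less_irrefl)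

theorem proposition5:
  fixes \<sigma> K :: real
    and A :: "complex^'t^'r" and C :: "complex^'r^'r" and Ct :: "complex^'t^'t"
  assumes "\<sigma>\<^sup>2 > 0" and "K \<ge> 0"
    and "trace (A ** ctranspose A) / of_nat CARD('r) = 1"
    and "pos_def C" and "trace C / of_nat CARD('r) = 1"
    and "pos_def Ct" and "trace Ct / of_nat CARD('t) = 1"
  shows "(\<forall>F \<in> {delta \<sigma> K A C Ct, delta_tilde \<sigma> K A C Ct, I_bar \<sigma> K A C Ct}.
            F differentiable_on C1 \<and> continuous_on C1 F)
    \<and> (let Qs = arg_max_on (I_bar \<sigma> K A C Ct) C1;
           ds = delta \<sigma> K A C Ct Qs;
           dts = delta_tilde \<sigma> K A C Ct Qs
       in is_arg_max (I_bar \<sigma> K A C Ct) (\<lambda>Q. Q \<in> C1) Qs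
        \<and> (\<forall>Q\<in>C1. (\<forall>P\<in>C1. grad_C1 (I_bar \<sigma> K A C Ct) Q (P - Q) \<le> 0) \<longleftrightarrow> Q = Qs)
        \<and> (\<forall>Q. is_arg_max (V \<sigma> K A C Ct ds dts) (\<lambda>Q. Q \<in> C1) Q \<longleftrightarrow> Q = Qs)
        \<and> (\<forall>Q. is_arg_max (\<lambda>Q. log_det (mat 1 + Q ** G \<sigma> K A C Ct ds dts)) (\<lambda>Q. Q \<in> C1) Q
               \<longleftrightarrow> Q = Qs))"
proof -
  note hyps = assms(1,2,4,6) refl refl refl refl
  let ?I = "I_bar \<sigma> K A C Ct"
  obtain q where q: "q \<in> C1" "\<And>P. P \<in> C1 \<Longrightarrow> ?I P \<le> ?I q"
    using I_bar_maximizer_exists[OF hyps] by blast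
  have stat: "grad_C1 ?I q (P - q) \<le> 0" if "P \<in> C1" for P
    using I_bar_max_stationary[OF hyps q that] .
  have arg_max: "is_arg_max ?I (\<lambda>Q. Q \<in> C1) Q \<longleftrightarrow> Q = q" for Q
    by (rule is_arg_max_unique_iff[OF q(1)])
      (use I_bar_stationary_unique_max[OF hyps q(1)] stat in blast)
  have Qs: "arg_max_on ?I C1 = q"
    by (simp add: arg_max_on_def arg_max_def arg_max)
  have stationary_iff: "(\<forall>P\<in>C1. grad_C1 ?I Q (P - Q) \<le> 0) \<longleftrightarrow> Q = q" if Q: "Q \<in> C1" for Q
    using stat I_bar_stationary_unique_max[OF hyps Q _ q(1)] q(2)[OF Q] by fastforce
  let ?k = "delta \<sigma> K A C Ct q" and ?kt = "delta_tilde \<sigma> K A C Ct q"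
  have V: "V \<sigma> K A C Ct ?k ?kt P < V \<sigma> K A C Ct ?k ?kt q" if "P \<in> C1" "P \<noteq> q" for P
    using V_waterfilling[OF hyps q(1) _ that] stat by blast
  then have waterfilling: "is_arg_max (V \<sigma> K A C Ct ?k ?kt) (\<lambda>Q. Q \<in> C1) Q \<longleftrightarrow> Q = q" for Q
    by (rule is_arg_max_unique_iff[OF q(1)])
  have "log_det (mat 1 + P ** G \<sigma> K A C Ct ?k ?kt) < log_det (mat 1 + q ** G \<sigma> K A C Ct ?k ?kt)"
    if "P \<in> C1" "P \<noteq> q" for P
    using V[OF that] V_eq_log_det_gain[OF hyps q(1) that(1)] V_eq_log_det_gain[OF hyps q(1) q(1)]
    by simp
  then have waterfilling': "is_arg_max (\<lambda>Q. log_det (mat 1 + Q ** G \<sigma> K A C Ct ?k ?kt)) (\<lambda>Q. Q \<in> C1) Q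
      \<longleftrightarrow> Q = q" for Q
    by (rule is_arg_max_unique_iff[OF q(1)])
  show ?thesis
    unfolding Let_def Qs
    using differentiable_on_C1[OF hyps] differentiable_imp_continuous_on
      arg_max stationary_iff waterfilling waterfilling' by blast
qed

end
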